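(* Let $\beta\in(0,3)$ and let $(q,\lambda)$ be a smooth localization pair on $\Omega=(0,1)$ (as defined in the context). Then there exists a constant $C>0$, independent of $u$, $v$ and $\delta$, such that for every $\delta\in(0,\delta_* )$, every $u\in H^4(\Omega)\cap H_0^1(\Omega)$ and every $v\in\mathfrak W_0^{\beta,2}[\delta;q](\Omega)$, with $\mathcal B_0(u,v):=(-u'',v)$, $$|\mathcal B_\delta(u,v)-\mathcal B_0(u,v)|\le C\delta^2\|u\|_{H^4(\Omega)}\|v\|_{L^2(\Omega)},$$ and consequently $$|\mathcal B_\delta(u,v)-\mathcal B_0(u,v)|\le C\delta^2\|u\|_{H^4(\Omega)}\|v\|_{\mathfrak W^{\beta,2}[\delta;q](\Omega)}.$$
   Context: Let $\Omega=(0,1)$, $d(x)=\operatorname{dist}(x,\partial\Omega)$, $\beta\in(0,3)$, and $(\cdot,\cdot)$ the $L^2(\Omega)$ inner product. Localization pair: functions $q:[0,\infty)\to[0,\infty)$ and $\lambda:\overline\Omega\to[0,\infty)$, together with constants $C_q\ge1$, $\kappa_0\ge1$, $\kappa_1,\kappa_2>0$, such that: (1) $q\in C^3([0,\infty))$, $q(0)=q'(0)=0$, $q''(0)>0$; $0<q(r)\le r$ for $r>0$; $0\le q'(r)\le1$ and $0\le q''(r)\le1$ for $r\ge0$; $q''\in C_b^1([0,\infty))$ (bounded with bounded continuous derivative); $q(2r)\le C_q q(r)$ for $r>0$. (2) $\lambda\in C^0(\overline\Omega)\cap C^2(\Omega)$; $\kappa_0^{-1}d(x)\le\lambda(x)\le\kappa_0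 d(x)$ on $\overline\Omega$; $|\lambda(x)-\lambda(y)|\le\kappa_1|x-y|$ for $x,y\in\Omega$; $|\lambda^{(j)}(x)|\le\kappa_j d(x)^{1-j}$ for $x\in\Omega$, $j=0,1,2$; $\lambda'(0^+)=1$, $\lambda'(1^-)=-1$. Smooth localization pair: in addition $\lambda\in C^3(\Omega)$ and $|\lambda'''(x)|\le\kappa_3 d(x)^{-2}$ on $\Omega$ for some constant $\kappa_3>0$. Range of $\delta$: $\delta_*:=\min\{\delta_0,\bar\delta_0\}$, where $\delta_0=\bigl(3\max\{1,\kappa_1,C_q\kappa_0^{\log_2 C_q}\}\bigr)^{-1}$ and $\bar\delta_0$ is the smallest positive root of $\frac{\delta(1+\kappa_1\delta)}{(1-\kappa_1\delta)^2}=\frac13$. Put $\eta(x)=q(\lambda(x))$, $\eta_\delta(x)=\delta\eta(x)$, $C_\beta=\frac{3-\beta}{2}$, $w_\delta(x)=C_\beta\,\eta_\delta(x)^{-(3-\beta)}$. Bilinear form, spaces and norm: $$\mathcal B_\delta(u,v)=\int_0^1\int_0^1 w_\delta(x)\mathbf 1_{\{|y-x|<\eta_\delta(x)\}}\frac{(u(x)-u(y))(v(x)-v(y))}{|x-y|^\beta}\,dy\,dx;$$ $\mathfrak W^{\beta,2}[\delta;q](\Omega)$ is the Hilbert space of $u\in L^2(\Omega)$ with $\mathcal B_\delta(u,u)<\infty$, with norm $\|u\|_{\mathfrak W^{\beta,2}[\delta;q](\Omega)}=(\|u\|_{L^2(\Omega)}^2+\mathcal B_\delta(u,u))^{1/2}$.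 The boundary trace map $T$ (restriction to $\partial\Omega=\{0,1\}$ for functions smooth up to the boundary) extends continuously to this space, and $\mathfrak W_0^{\beta,2}[\delta;q](\Omega)$ is the subspace $\{Tu=0\}$; it coincides with the closure of $C_c^1(\Omega)$ in $\mathfrak W^{\beta,2}[\delta;q](\Omega)$. *)

theory Defs
  imports "HOL-Analysis.Analysis"
begin

abbreviation Omega :: "real set" where
  "Omega \<equiv> {0<..<1}"

abbreviation LOmega :: "real measure" where
  "LOmega \<equiv> lebesgue_on Omega"

definition bdist :: "real \<Rightarrow> real" where
  "bdist x = infdist x (frontier Omega)"


subsection \<open>Classical differentiability\<close>

text \<open>Derivatives are taken within \<open>S\<close>: they are one-sided at an endpoint belonging to \<open>S\<close>,
  and for \<open>x \<in> S\<close> only the values of the function on \<open>S\<close> matter.\<close>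

definition nderiv_on :: "real set \<Rightarrow> nat \<Rightarrow> (real \<Rightarrow> real) \<Rightarrow> real \<Rightarrow> real" where
  "nderiv_on S j f = ((\<lambda>g x. vector_derivative g (at x within S)) ^^ j) f"

definition Ck_on :: "nat \<Rightarrow> real set \<Rightarrow> (real \<Rightarrow> real) \<Rightarrow> bool" where
  "Ck_on k S f \<longleftrightarrow>
     (\<forall>j<k. nderiv_on S j f differentiable_on S) \<and>
     (\<forall>j\<le>k. continuous_on S (nderiv_on S j f))"

definition smooth_on :: "real set \<Rightarrow> (real \<Rightarrow> real) \<Rightarrow> bool" where
  "smooth_on S f \<longleftrightarrow> (\<forall>k. Ck_on k S f)"


subsection \<open>Localization pairs\<close>

text \<open>The constants \<open>\<kappa>\<^sub>0, \<kappa>\<^sub>1, \<dots>\<close> are collected in one function \<open>\<kappa> :: nat \<Rightarrow> real\<close>.\<close>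

definition localization_pair ::
    "(real \<Rightarrow> real) \<Rightarrow> (real \<Rightarrow> real) \<Rightarrow> real \<Rightarrow> (nat \<Rightarrow> real) \<Rightarrow> bool" where
  "localization_pair q lam Cq \<kappa> \<longleftrightarrow>
     Cq \<ge> 1 \<and> \<kappa> 0 \<ge> 1 \<and> \<kappa> 1 > 0 \<and> \<kappa> 2 > 0 \<and>
     (\<forall>r\<ge>0. q r \<ge> 0) \<and>
     Ck_on 3 {0..} q \<and>
     q 0 = 0 \<and> nderiv_on {0..} 1 q 0 = 0 \<and> nderiv_on {0..} 2 q 0 > 0 \<and>
     (\<forall>r>0. 0 < q r \<and> q r \<le> r) \<and>
     (\<forall>r\<ge>0. 0 \<le> nderiv_on {0..} 1 q r \<and> nderiv_on {0..} 1 q r \<le> 1) \<and>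
     (\<forall>r\<ge>0. 0 \<le> nderiv_on {0..} 2 q r \<and> nderiv_on {0..} 2 q r \<le> 1) \<and>
     bounded (nderiv_on {0..} 2 q ` {0..}) \<and> bounded (nderiv_on {0..} 3 q ` {0..}) \<and>
     (\<forall>r>0. q (2 * r) \<le> Cq * q r) \<and>
     (\<forall>x\<in>closure Omega. lam x \<ge> 0) \<and>
     continuous_on (closure Omega) lam \<and> Ck_on 2 Omega lam \<and>
     (\<forall>x\<in>closure Omega. bdist x / \<kappa> 0 \<le> lam x \<and> lam x \<le> \<kappa> 0 * bdist x) \<and>
     (\<forall>x\<in>Omega. \<forall>y\<in>Omega. \<bar>lam x - lam y\<bar> \<le> \<kappa> 1 * \<bar>x - y\<bar>) \<and>
     (\<forall>j\<le>2. \<forall>x\<in>Omega. \<bar>nderiv_on Omega j lam x\<bar> \<le> \<kappa> j * bdist x powi (1 - int j)) \<and>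
     (nderiv_on Omega 1 lam \<longlongrightarrow> 1) (at_right 0) \<and>
     (nderiv_on Omega 1 lam \<longlongrightarrow> -1) (at_left 1)"

definition smooth_localization_pair ::
    "(real \<Rightarrow> real) \<Rightarrow> (real \<Rightarrow> real) \<Rightarrow> real \<Rightarrow> (nat \<Rightarrow> real) \<Rightarrow> bool" where
  "smooth_localization_pair q lam Cq \<kappa> \<longleftrightarrow>
     localization_pair q lam Cq \<kappa> \<and>
     \<kappa> 3 > 0 \<and> Ck_on 3 Omega lam \<and>
     (\<forall>x\<in>Omega. \<bar>nderiv_on Omega 3 lam x\<bar> \<le> \<kappa> 3 * bdist x powi (-2))"

definition delta0 :: "real \<Rightarrow> (nat \<Rightarrow> real) \<Rightarrow> real" where
  "delta0 Cq \<kappa> = inverse (3 * Max {1, \<kappa> 1, Cq * \<kappa> 0 powr log 2 Cq})"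

definition delta0_bar :: "(nat \<Rightarrow> real) \<Rightarrow> real" where
  "delta0_bar \<kappa> =
     (LEAST \<delta>. \<delta> > 0 \<and> \<delta> * (1 + \<kappa> 1 * \<delta>) / (1 - \<kappa> 1 * \<delta>)\<^sup>2 = 1 / 3)"

definition delta_star :: "real \<Rightarrow> (nat \<Rightarrow> real) \<Rightarrow> real" where
  "delta_star Cq \<kappa> = min (delta0 Cq \<kappa>) (delta0_bar \<kappa>)"


subsection \<open>\<open>L\<^sup>2\<close> and Sobolev spaces on \<open>\<Omega>\<close>\<close>

text \<open>Elements of function spaces are represented by functions \<open>real \<Rightarrow> real\<close>; only their values
  on \<open>\<Omega>\<close>, up to null sets, matter.\<close>

definition L2 :: "(real \<Rightarrow> real) set" where
  "L2 = {u. u \<in> borel_measurable LOmega \<and> integrable LOmega (\<lambda>x. (u x)\<^sup>2)}"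

definition L2_inner :: "(real \<Rightarrow> real) \<Rightarrow> (real \<Rightarrow> real) \<Rightarrow> real" where
  "L2_inner u v = (LINT x|LOmega. u x * v x)"

definition L2_norm :: "(real \<Rightarrow> real) \<Rightarrow> real" where
  "L2_norm u = sqrt (L2_inner u u)"

definition test_function :: "(real \<Rightarrow> real) \<Rightarrow> bool" where
  "test_function \<phi> \<longleftrightarrow>
     smooth_on UNIV \<phi> \<and> (\<exists>K. compact K \<and> K \<subseteq> Omega \<and> (\<forall>x. x \<notin> K \<longrightarrow> \<phi> x = 0))"

definition has_weak_deriv :: "nat \<Rightarrow> (real \<Rightarrow> real) \<Rightarrow> (real \<Rightarrow> real) \<Rightarrow> bool" where
  "has_weak_deriv j u g \<longleftrightarrow>
     (\<forall>\<phi>. test_function \<phi> \<longrightarrow>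
        (LINT x|LOmega. u x * nderiv_on UNIV j \<phi> x) = (-1) ^ j * (LINT x|LOmega. g x * \<phi> x))"

text \<open>The choice below is unique up to a null set whenever a weak derivative in \<open>L\<^sup>2\<close> exists.\<close>

definition weak_deriv :: "nat \<Rightarrow> (real \<Rightarrow> real) \<Rightarrow> real \<Rightarrow> real" where
  "weak_deriv j u = (SOME g. g \<in> L2 \<and> has_weak_deriv j u g)"

definition Hk :: "nat \<Rightarrow> (real \<Rightarrow> real) set" where
  "Hk k = {u \<in> L2. \<forall>j\<le>k. \<exists>g\<in>L2. has_weak_deriv j u g}"

definition Hk_norm :: "nat \<Rightarrow> (real \<Rightarrow> real) \<Rightarrow> real" where
  "Hk_norm k u = sqrt (\<Sum>j\<le>k. (L2_norm (weak_deriv j u))\<^sup>2)"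

definition H10 :: "(real \<Rightarrow> real) set" where
  "H10 = {u \<in> Hk 1. \<exists>\<phi>. (\<forall>n. test_function (\<phi> n)) \<and>
            (\<lambda>n. Hk_norm 1 (\<lambda>x. u x - \<phi> n x)) \<longlonglongrightarrow> 0}"


subsection \<open>The nonlocal form and its energy space\<close>

definition eta_delta :: "(real \<Rightarrow> real) \<Rightarrow> (real \<Rightarrow> real) \<Rightarrow> real \<Rightarrow> real \<Rightarrow> real" where
  "eta_delta q lam \<delta> x = \<delta> * q (lam x)"

definition w_delta ::
    "(real \<Rightarrow> real) \<Rightarrow> (real \<Rightarrow> real) \<Rightarrow> real \<Rightarrow> real \<Rightarrow> real \<Rightarrow> real" where
  "w_delta q lam \<beta> \<delta> x = (3 - \<beta>) / 2 * eta_delta q lam \<delta> x powr (- (3 - \<beta>))"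

definition B_integrand ::
    "(real \<Rightarrow> real) \<Rightarrow> (real \<Rightarrow> real) \<Rightarrow> real \<Rightarrow> real \<Rightarrow>
     (real \<Rightarrow> real) \<Rightarrow> (real \<Rightarrow> real) \<Rightarrow> real \<Rightarrow> real \<Rightarrow> real" where
  "B_integrand q lam \<beta> \<delta> u v x y =
     w_delta q lam \<beta> \<delta> x * indicator {y. \<bar>y - x\<bar> < eta_delta q lam \<delta> x} y *
     ((u x - u y) * (v x - v y) / \<bar>x - y\<bar> powr \<beta>)"

definition B_delta ::
    "(real \<Rightarrow> real) \<Rightarrow> (real \<Rightarrow> real) \<Rightarrow> real \<Rightarrow> real \<Rightarrow>
     (real \<Rightarrow> real) \<Rightarrow> (real \<Rightarrow> real) \<Rightarrow> real" where
  "B_delta q lam \<beta> \<delta> u v =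
     (LINT x|LOmega. (LINT y|LOmega. B_integrand q lam \<beta> \<delta> u v x y))"

text \<open>Finiteness of the energy is expressed with the extended nonnegative integral, since the
  Bochner integral of a non-integrable function is \<open>0\<close>.\<close>

definition W_space ::
    "(real \<Rightarrow> real) \<Rightarrow> (real \<Rightarrow> real) \<Rightarrow> real \<Rightarrow> real \<Rightarrow> (real \<Rightarrow> real) set" where
  "W_space q lam \<beta> \<delta> =
     {u \<in> L2. (\<integral>\<^sup>+x. (\<integral>\<^sup>+y. ennreal (B_integrand q lam \<beta> \<delta> u u x y) \<partial>LOmega) \<partial>LOmega) < \<infinity>}"

definition W_norm ::
    "(real \<Rightarrow> real) \<Rightarrow> (real \<Rightarrow> real) \<Rightarrow> real \<Rightarrow> real \<Rightarrow> (real \<Rightarrow> real) \<Rightarrow> real" where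
  "W_norm q lam \<beta> \<delta> u = sqrt ((L2_norm u)\<^sup>2 + B_delta q lam \<beta> \<delta> u u)"

text \<open>\<open>has_trace q lam \<beta> \<delta> u a b\<close> says \<open>T u = (a, b)\<close>, where \<open>T\<close> is the continuous extension of
  \<open>\<phi> \<mapsto> (\<phi>(0), \<phi>(1))\<close> from functions smooth up to the boundary. It is a relation, so that the
  definition does not presuppose the trace theorem.\<close>

definition has_trace ::
    "(real \<Rightarrow> real) \<Rightarrow> (real \<Rightarrow> real) \<Rightarrow> real \<Rightarrow> real \<Rightarrow>
     (real \<Rightarrow> real) \<Rightarrow> real \<Rightarrow> real \<Rightarrow> bool" where
  "has_trace q lam \<beta> \<delta> u a b \<longleftrightarrow>
     (\<exists>\<phi>. (\<forall>n. smooth_on {0..1} (\<phi> n) \<and> (\<lambda>x. u x - \<phi> n x) \<in> W_space q lam \<beta> \<delta>) \<and>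
        (\<lambda>n. W_norm q lam \<beta> \<delta> (\<lambda>x. u x - \<phi> n x)) \<longlonglongrightarrow> 0 \<and>
        (\<lambda>n. \<phi> n 0) \<longlonglongrightarrow> a \<and> (\<lambda>n. \<phi> n 1) \<longlonglongrightarrow> b)"

definition W0_space ::
    "(real \<Rightarrow> real) \<Rightarrow> (real \<Rightarrow> real) \<Rightarrow> real \<Rightarrow> real \<Rightarrow> (real \<Rightarrow> real) set" where
  "W0_space q lam \<beta> \<delta> = {u \<in> W_space q lam \<beta> \<delta>. has_trace q lam \<beta> \<delta> u 0 0}"

definition B_zero :: "(real \<Rightarrow> real) \<Rightarrow> (real \<Rightarrow> real) \<Rightarrow> real" where
  "B_zero u v = L2_inner (\<lambda>x. - weak_deriv 2 u x) v"

end

theory Submission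
  imports Defs
begin

text \<open>Substituting \<open>y = x + s \<eta>(x)\<close> turns the nonlocal form into an integral over \<open>s \<in> (-1, 1)\<close>,
  with a weight independent of \<open>\<delta>\<close>, of the slices
  \<open>\<integral> \<eta>(x)\<^sup>-\<^sup>2 (u(x) - u(\<phi>\<^sub>s x)) (v(x) - v(\<phi>\<^sub>s x)) dx\<close> with \<open>\<phi>\<^sub>s = id + s \<eta>\<close>.
  In the part containing \<open>v(\<phi>\<^sub>s x)\<close> the map \<open>\<phi>\<^sub>s\<close> is never inverted: instead one exhibits a cubic
  polynomial \<open>adj s\<close> in \<open>s\<close> whose pullback \<open>(adj s \<circ> \<phi>\<^sub>s) \<phi>\<^sub>s'\<close> agrees with
  \<open>\<eta>\<^sup>-\<^sup>2 (u - u \<circ> \<phi>\<^sub>s)\<close> up to \<open>O(\<delta>\<^sup>2 s\<^sup>2)\<close> in \<open>L\<^sup>2\<close>. Adding the slices for \<open>s\<close> and \<open>-s\<close> cancels the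
  singular odd part and leaves \<open>-2 s\<^sup>2 \<integral> u'' v\<close>. The manipulations are legitimate for compactly
  supported Lipschitz \<open>v\<close>; a function of trace zero is a limit, in energy, of Lipschitz functions
  vanishing at the end points, and these are limits of their soft thresholdings, which have compact
  support. Only here is the vanishing trace used.\<close>

subsection \<open>Smooth bump functions\<close>

text \<open>Only the \<open>L2\<close> norm of \<open>v\<close> may appear on the right, so no
  difference of \<open>v\<close> can be estimated: it has to be moved onto \<open>u\<close>. Near
  the boundary this is delicate, because \<open>\<eta>\<close> tends to 0,
  \<open>\<eta>\<^sup>-\<^sup>2\<close> is singular and \<open>\<eta>'''\<close> may be unbounded.
  With a candidate density evaluated at \<open>\<phi>\<^sub>s x\<close> and multiplied by the
  Jacobian, only Taylor expansions around that point occur. The polynomial has to reach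
  \<open>s\<^sup>3\<close> although only its \<open>s\<^sup>2\<close> coefficient survives: the
  cubic coefficient is of order \<open>\<delta>\<close>, so dropping it would lose one order in each
  slice, but it is odd in \<open>s\<close> and disappears from the symmetric sum. For
  \<open>u\<close> in \<open>Hk 4\<close> the fourth derivative has no pointwise bound. Taylor
  remainders are therefore measured by its averages over the balls of radius \<open>\<eta>\<close>,
  which are bounded in \<open>L2\<close> because \<open>\<eta>\<close> is comparable at all points
  of such a ball. Every error keeps a factor \<open>s\<^sup>2\<close>, since the weight in
  \<open>s\<close> need not be integrable while its second moment is 1.\<close>

primrec ndiff :: "nat \<Rightarrow> (real \<Rightarrow> real) \<Rightarrow> bool" where
  "ndiff 0 f \<longleftrightarrow> True"
| "ndiff (Suc n) f \<longleftrightarrow> (\<exists>f'. (\<forall>x. (f has_real_derivative f' x) (at x)) \<and> ndiff n f')"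

lemma ndiff_SucD: "ndiff (Suc n) f \<Longrightarrow> ndiff n f"
  by (induction n arbitrary: f) auto

lemma ndiff_add:
  assumes "ndiff n f" "ndiff n g"
  shows "ndiff n (\<lambda>x. f x + g x)"
  using assms
proof (induction n arbitrary: f g)
  case (Suc n)
  then obtain f' g' where "\<forall>x. (f has_real_derivative f' x) (at x)" "ndiff n f'"
    "\<forall>x. (g has_real_derivative g' x) (at x)" "ndiff n g'"
    by auto
  with Suc.IH[of f' g'] show ?case
    by (auto intro!: exI[of _ "\<lambda>x. f' x + g' x"] derivative_eq_intros)
qed simp

lemma ndiff_mult:
  assumes "ndiff n f" "ndiff n g"
  shows "ndiff n (\<lambda>x. f x * g x)"
  using assms
proof (induction n arbitrary: f g)
  case (Suc n)
  then obtain f' g' where *: "\<forall>x. (f has_real_derivative f' x) (at x)" "ndiff n f'"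
    "\<forall>x. (g has_real_derivative g' x) (at x)" "ndiff n g'"
    by auto
  have "ndiff n f" "ndiff n g"
    using Suc.prems ndiff_SucD by blast+
  then have "ndiff n (\<lambda>x. f' x * g x + f x * g' x)"
    using * Suc.IH ndiff_add by auto
  with * show ?case
    by (auto intro!: exI[of _ "\<lambda>x. f' x * g x + f x * g' x"] derivative_eq_intros)
qed simp

lemma ndiff_const: "ndiff n (\<lambda>x. c)"
proof (induction n arbitrary: c)
  case (Suc n)
  then show ?case by (auto intro!: exI[of _ "\<lambda>x. 0"])
qed simp

lemma ndiff_affine:
  assumes "ndiff n f"
  shows "ndiff n (\<lambda>x. f (a * x + b))"
  using assms
proof (induction n arbitrary: f)
  case (Suc n)
  then obtain f' where *: "\<And>x. (f has_real_derivative f' x) (at x)" "ndiff n f'"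
    by auto
  have "((\<lambda>x. f (a * x + b)) has_real_derivative a * f' (a * x + b)) (at x)" for x
  proof -
    have "((\<lambda>x. a * x + b) has_real_derivative a) (at x)"
      by (auto intro!: derivative_eq_intros)
    from DERIV_chain2[OF *(1) this] show ?thesis by (simp add: mult.commute)
  qed
  moreover have "ndiff n (\<lambda>x. a * f' (a * x + b))"
    using Suc.IH[OF *(2)] ndiff_mult[OF ndiff_const] by blast
  ultimately show ?case
    by (auto intro!: exI[of _ "\<lambda>x. a * f' (a * x + b)"])
qed simp

text \<open>Smoothness with the successive derivatives quantified existentially in
  \<open>ndiff\<close>, so that closure under sums, products and affine substitutions is a plain
  induction that never computes \<open>nderiv_on\<close>. \<open>smooth_on_UNIV_iff\<close>
  identifies it with the notion used for test functions.\<close>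

definition smooth_fun :: "(real \<Rightarrow> real) \<Rightarrow> bool" where
  "smooth_fun f \<longleftrightarrow> (\<forall>n. ndiff n f)"

lemma nderiv_on_Suc: "nderiv_on S (Suc j) f x = vector_derivative (nderiv_on S j f) (at x within S)"
  by (simp add: nderiv_on_def)

lemma nderiv_on_add: "nderiv_on S i (nderiv_on S j f) = nderiv_on S (i + j) f"
  by (simp add: nderiv_on_def funpow_add)

lemma nderiv_on_1: "nderiv_on S 1 f = (\<lambda>x. vector_derivative f (at x within S))"
  by (simp add: nderiv_on_def)

lemma ndiff_nderiv: "ndiff (n + j) f \<Longrightarrow> ndiff n (nderiv_on UNIV j f)"
proof (induction j arbitrary: f)
  case 0
  then show ?case by (simp add: nderiv_on_def)
next
  case (Suc j)
  then obtain f' where *: "\<And>x. (f has_real_derivative f' x) (at x)" "ndiff (n + j) f'"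
    by auto
  have "nderiv_on UNIV 1 f = f'"
    unfolding nderiv_on_1
    using *(1) by (auto simp: has_real_derivative_iff_has_vector_derivative
        intro!: vector_derivative_at)
  then have "nderiv_on UNIV (Suc j) f = nderiv_on UNIV j f'"
    using nderiv_on_add[of UNIV j 1 f] by simp
  then show ?case using Suc.IH[OF *(2)] by simp
qed

lemma smooth_fun_imp_smooth_on:
  assumes "smooth_fun f"
  shows "smooth_on UNIV f"
proof -
  have "\<exists>f'. \<forall>x. (nderiv_on UNIV j f has_real_derivative f' x) (at x)" for j
    using ndiff_nderiv[of 1 j f] assms unfolding smooth_fun_def
    by (metis One_nat_def ndiff.simps(2))
  then have "nderiv_on UNIV j f differentiable_on UNIV" for j
    by (metis differentiable_on_def real_differentiable_def)
  then show ?thesis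
    unfolding smooth_on_def Ck_on_def using differentiable_imp_continuous_on by blast
qed

lemma nderiv_on_has_derivative:
  assumes "Ck_on k S f" "j < k" "x \<in> S"
  shows "(nderiv_on S j f has_real_derivative nderiv_on S (Suc j) f x) (at x within S)"
  using assms
  by (metis Ck_on_def differentiable_on_def has_real_derivative_iff_has_vector_derivative
      nderiv_on_Suc vector_derivative_works)

definition flat :: "real \<Rightarrow> real" where
  "flat x = (if x \<le> 0 then 0 else exp (- (1 / x)))"

lemma poly_inverse_exp_tendsto:
  "((\<lambda>x. poly p (1 / x) * exp (- (1 / x))) \<longlongrightarrow> 0) (at_right (0::real))"
proof -
  have "((\<lambda>t. poly p t * exp (- t)) \<longlongrightarrow> 0) (at_top :: real filter)"
  proof (induction p)
    case 0
    then show ?case by simp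
  next
    case (pCons a p)
    have mono: "((\<lambda>t. t ^ n * exp (- t)) \<longlongrightarrow> 0) (at_top :: real filter)" for n
      using tendsto_power_div_exp_0[of n] by (simp add: exp_minus divide_inverse)
    have "((\<lambda>t::real. \<Sum>i\<le>degree (pCons a p). coeff (pCons a p) i * (t ^ i * exp (- t))) \<longlongrightarrow>
        (\<Sum>i\<le>degree (pCons a p). coeff (pCons a p) i * 0)) at_top"
      by (intro tendsto_intros mono)
    moreover have "poly (pCons a p) t * exp (- t) =
        (\<Sum>i\<le>degree (pCons a p). coeff (pCons a p) i * (t ^ i * exp (- t)))" for t
      unfolding poly_altdef sum_distrib_right by (simp add: mult.assoc)
    ultimately show ?case by (simp del: poly_pCons)
  qed
  then show ?thesis
    using filterlim_compose[OF _ filterlim_inverse_at_top_right]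
    by (simp add: divide_inverse)
qed

text \<open>The class of functions \<open>p(1/x) e\<^sup>-\<^sup>1\<^sup>/\<^sup>x\<close> is closed under differentiation, also at \<open>0\<close>.\<close>

lemma ndiff_poly_flat:
  "ndiff n (\<lambda>x. if x \<le> 0 then 0 else poly p (1 / x) * exp (- (1 / x)))"
proof (induction n arbitrary: p)
  case (Suc n)
  let ?f = "\<lambda>p x. if x \<le> (0::real) then 0 else poly p (1 / x) * exp (- (1 / x))"
  \<comment> \<open>With \<open>t = 1/x\<close>, the derivative in \<open>x\<close> of
    \<open>p(t) exp(-t)\<close> is \<open>t\<^sup>2 (p(t) - p'(t)) exp(-t)\<close>.\<close>
  define r where "r = [:0, 0, 1:] * (p - pderiv p)"
  have "(?f p has_real_derivative ?f r x) (at x)" for x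
  proof -
    consider "x < 0" | "x = 0" | "x > 0" by linarith
    then show ?thesis
    proof cases
      case 1
      have "((\<lambda>x. 0) has_real_derivative 0) (at x)" by simp
      then have "(?f p has_real_derivative 0) (at x)"
        by (rule has_field_derivative_transform_within_open[of _ _ _ "{..<0}"]) (use 1 in auto)
      then show ?thesis using 1 by simp
    next
      case 2
      \<comment> \<open>The difference quotient at 0 stays in the class: it belongs to the
        polynomial \<open>t p(t)\<close>.\<close>
      have "((\<lambda>h. ?f p h / h) \<longlongrightarrow> 0) (at_right 0)"
        using poly_inverse_exp_tendsto[of "[:0, 1:] * p"]
        by (rule Lim_transform_eventually)
          (auto simp: eventually_at_filter algebra_simps)
      moreover have "((\<lambda>h. ?f p h / h) \<longlongrightarrow> 0) (at_left 0)"
        by (rule Lim_transform_eventually[of "\<lambda>x. 0"]) (auto simp: eventually_at_filter)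
      ultimately have "((\<lambda>h. ?f p h / h) \<longlongrightarrow> 0) (at 0)"
        by (simp add: filterlim_at_split)
      then show ?thesis using 2 by (simp add: DERIV_def cong: if_cong)
    next
      case 3
      have "((\<lambda>x. poly p (1 / x) * exp (- (1 / x))) has_real_derivative ?f r x) (at x)"
        using 3 unfolding r_def
        by (auto intro!: derivative_eq_intros DERIV_chain2[OF poly_DERIV]
            simp: field_simps power2_eq_square)
      then show ?thesis
        by (rule has_field_derivative_transform_within_open[of _ _ _ "{0<..}"]) (use 3 in auto)
    qed
  qed
  then show ?case using Suc.IH by (auto intro!: exI[of _ "?f r"])
qed simp

lemma smooth_flat: "smooth_fun flat"
  unfolding smooth_fun_def flat_def using ndiff_poly_flat[of _ 1] by (simp cong: if_cong)

lemma flat_bounds: "0 \<le> flat x" "flat x \<le> 1"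
  by (auto simp: flat_def)

text \<open>The parameter \<open>n\<close> is a steepness: as it grows, the function tends pointwise
  to the indicator of the open interval from \<open>a\<close> to \<open>b\<close>. The arguments
  \<open>n (x - a)\<close> and \<open>n (b - x)\<close> are written out as affine expressions to
  match \<open>ndiff_affine\<close>.\<close>

definition bump :: "real \<Rightarrow> real \<Rightarrow> real \<Rightarrow> real \<Rightarrow> real" where
  "bump n a b x = flat (n * x + - n * a) * flat (- n * x + n * b)"

lemma smooth_bump: "smooth_fun (bump n a b)"
  using smooth_flat unfolding smooth_fun_def bump_def
  by (intro allI ndiff_mult ndiff_affine) auto

lemma test_function_bump:
  assumes "0 < a" "b < 1" "n \<ge> 0"
  shows "test_function (bump n a b)"
  unfolding test_function_def
proof (intro conjI exI[of _ "{a..b}"] allI impI)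
  show "bump n a b x = 0" if "x \<notin> {a..b}" for x
  proof -
    have "x \<le> a \<or> b \<le> x" using that by auto
    then have "n * x \<le> n * a \<or> n * b \<le> n * x"
      using assms(3) by (metis mult_left_mono)
    then show ?thesis by (auto simp: bump_def flat_def)
  qed
qed (use assms smooth_bump smooth_fun_imp_smooth_on in auto)

lemma bump_bounds: "0 \<le> bump n a b x" "bump n a b x \<le> 1"
  using flat_bounds by (auto simp: bump_def intro: mult_le_one)

lemma bump_tendsto: "(\<lambda>n. bump (real n) a b x) \<longlonglongrightarrow> indicator {a<..<b} x"
proof (cases "a < x \<and> x < b")
  case True
  have flat1: "(\<lambda>n. flat (real n * c)) \<longlonglongrightarrow> 1" if "c > 0" for c
  proof -
    have "(\<lambda>n. exp (- (1 / c) * inverse (real n))) \<longlonglongrightarrow> exp (- (1/c) * 0)"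
      by (intro tendsto_intros lim_inverse_n)
    then have "(\<lambda>n. exp (- (1 / c) * inverse (real n))) \<longlonglongrightarrow> 1" by simp
    then show ?thesis
      by (rule Lim_transform_eventually)
        (use that in \<open>auto simp: eventually_sequentially flat_def mult_le_0_iff field_simps
          intro!: exI[of _ 1]\<close>)
  qed
  have "(\<lambda>n. flat (real n * (x - a)) * flat (real n * (b - x))) \<longlonglongrightarrow> 1 * 1"
    using True by (intro tendsto_intros flat1) auto
  then show ?thesis using True by (simp add: bump_def algebra_simps)
next
  case False
  then have "bump (real n) a b x = 0" for n
    by (auto simp: bump_def flat_def not_less mult_left_mono)
  then show ?thesis using False by (auto simp: indicator_def)
qed

lemma Ck_on_imp_ndiff: "Ck_on n UNIV f \<Longrightarrow> ndiff n f"
proof (induction n arbitrary: f)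
  case (Suc n)
  have "(f has_real_derivative nderiv_on UNIV 1 f x) (at x)" for x
    using nderiv_on_has_derivative[OF Suc.prems, of 0 x] by (simp add: nderiv_on_def)
  moreover have "Ck_on n UNIV (nderiv_on UNIV 1 f)"
    using Suc.prems unfolding Ck_on_def nderiv_on_add
    by (metis Suc_eq_plus1 Suc_leI Suc_le_mono le_imp_less_Suc less_Suc_eq_le)
  ultimately show ?case using Suc.IH by (auto intro!: exI[of _ "nderiv_on UNIV 1 f"])
qed simp

lemma smooth_on_UNIV_iff: "smooth_on UNIV f \<longleftrightarrow> smooth_fun f"
  using smooth_fun_imp_smooth_on Ck_on_imp_ndiff
  by (auto simp: smooth_fun_def smooth_on_def)

lemma smooth_fun_nderiv: "smooth_fun f \<Longrightarrow> smooth_fun (nderiv_on UNIV j f)"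
  by (simp add: smooth_fun_def ndiff_nderiv)

lemma smooth_fun_DERIV:
  "smooth_fun f \<Longrightarrow> (f has_real_derivative nderiv_on UNIV 1 f x) (at x)"
  using nderiv_on_has_derivative[of 1 UNIV f 0 x] smooth_fun_imp_smooth_on[of f]
  by (simp add: smooth_on_def nderiv_on_def)

lemma smooth_fun_continuous: "smooth_fun f \<Longrightarrow> continuous_on A f"
  using smooth_fun_DERIV by (meson DERIV_continuous continuous_at_imp_continuous_on)

text \<open>A compact subset of the open interval lies in some \<open>{a..b}\<close> with
  \<open>0 < a\<close> and \<open>b < 1\<close>. Supports of linear combinations, derivatives and
  antiderivatives can then be tracked through end points.\<close>

lemma test_function_alt:
  "test_function f \<longleftrightarrow> smooth_fun f \<and> (\<exists>a b. 0 < a \<and> b < 1 \<and> (\<forall>x. x \<notin> {a..b} \<longrightarrow> f x = 0))"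
proof -
  have 1: "\<exists>a b. 0 < a \<and> b < 1 \<and> K \<subseteq> {a..b}" if K: "compact K" "K \<subseteq> Omega" for K :: "real set"
  proof (cases "K = {}")
    case True
    then show ?thesis by (auto intro!: exI[of _ "1/2"])
  next
    case False
    obtain l where "l \<in> K" "\<forall>t\<in>K. l \<le> t"
      using compact_attains_inf[OF K(1) False] by blast
    moreover obtain u where "u \<in> K" "\<forall>t\<in>K. t \<le> u"
      using compact_attains_sup[OF K(1) False] by blast
    ultimately show ?thesis using K(2) by (intro exI[of _ l] exI[of _ u]) auto
  qed
  show ?thesis
    unfolding test_function_def smooth_on_UNIV_iff
  proof (intro iffI conjI; elim conjE exE)
    fix K assume "compact K" "K \<subseteq> Omega" and K: "\<forall>x. x \<notin> K \<longrightarrow> f x = 0"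
    then obtain a b where "0 < a" "b < 1" "K \<subseteq> {a..b}" using 1 by blast
    with K show "\<exists>a b. 0 < a \<and> b < 1 \<and> (\<forall>x. x \<notin> {a..b} \<longrightarrow> f x = 0)" by blast
  next
    fix a b :: real assume "0 < a" "b < 1" "\<forall>x. x \<notin> {a..b} \<longrightarrow> f x = 0"
    then show "\<exists>K. compact K \<and> K \<subseteq> Omega \<and> (\<forall>x. x \<notin> K \<longrightarrow> f x = 0)"
      by (intro exI[of _ "{a..b}"]) auto
  qed auto
qed

lemma test_function_lincomb:
  assumes "test_function f" "test_function g"
  shows "test_function (\<lambda>x. f x + c * g x)"
proof -
  obtain a b a' b' where *: "0 < a" "b < 1" "\<forall>x. x \<notin> {a..b} \<longrightarrow> f x = 0"
    "0 < a'" "b' < 1" "\<forall>x. x \<notin> {a'..b'} \<longrightarrow> g x = 0"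
    using assms by (auto simp: test_function_alt)
  have "smooth_fun (\<lambda>x. f x + c * g x)"
    using assms ndiff_add ndiff_mult[OF ndiff_const] by (simp add: test_function_alt smooth_fun_def)
  moreover have "\<forall>x. x \<notin> {min a a'..max b b'} \<longrightarrow> f x + c * g x = 0"
  proof (intro allI impI)
    fix x assume "x \<notin> {min a a'..max b b'}"
    then have "x \<notin> {a..b}" "x \<notin> {a'..b'}" by auto
    then show "f x + c * g x = 0" using *(3,6) by (metis add_0 mult_zero_right)
  qed
  ultimately show ?thesis
    unfolding test_function_alt using *(1,2,4,5)
    by (intro conjI exI[of _ "min a a'"] exI[of _ "max b b'"]) auto
qed

lemma test_function_nderiv1:
  assumes "test_function f"
  shows "test_function (nderiv_on UNIV 1 f)"
proof -
  obtain a b where *: "0 < a" "b < 1" "\<forall>x. x \<notin> {a..b} \<longrightarrow> f x = 0" "smooth_fun f"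
    using assms by (auto simp: test_function_alt)
  have "nderiv_on UNIV 1 f x = 0" if "x \<notin> {a..b}" for x
  proof -
    have "(f has_real_derivative 0) (at x)"
      by (rule has_field_derivative_transform_within_open[of "\<lambda>x. 0" _ _ "- {a..b}"])
        (use that * in auto)
    then show ?thesis using smooth_fun_DERIV[OF *(4)] DERIV_unique by blast
  qed
  then show ?thesis using * smooth_fun_nderiv unfolding test_function_alt by blast
qed

subsection \<open>The measure space \<open>\<Omega>\<close>\<close>

lemma space_LOmega [simp]: "space LOmega = Omega"
  by (simp add: space_restrict_space)

lemma finite_measure_LOmega: "finite_measure LOmega"
  by (rule finite_measureI) (simp add: emeasure_restrict_space)

interpretation LO: finite_measure LOmega
  by (rule finite_measure_LOmega)

interpretation LO2: pair_sigma_finite LOmega LOmega ..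

lemma measure_LOmega [simp]: "measure LOmega Omega = 1"
  by (simp add: measure_restrict_space)

lemma borel_measurable_LOmegaI:
  "f \<in> borel_measurable borel \<Longrightarrow> f \<in> borel_measurable LOmega"
  by (intro measurable_restrict_space1 measurable_completion) simp

lemma continuous_on_LOmega: "continuous_on Omega f \<Longrightarrow> f \<in> borel_measurable LOmega"
  for f :: "real \<Rightarrow> real"
  by (rule continuous_imp_measurable_on_sets_lebesgue) auto

lemma LOmega_AE_iff: "(AE x in LOmega. P x) \<longleftrightarrow> (AE x in lebesgue. x \<in> Omega \<longrightarrow> P x)"
  by (rule AE_restrict_space_iff) auto

lemma LOmega_interval:
  fixes f :: "real \<Rightarrow> real"
  assumes "0 \<le> a" "b \<le> 1" "continuous_on {a..b} f"
  shows "integrable LOmega (\<lambda>x. indicator {a<..<b} x * f x)"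
    and "(LINT x|LOmega. indicator {a<..<b} x * f x) = integral {a..b} f"
proof -
  have eq: "indicator Omega x * (indicator {a<..<b} x * f x) = indicator {a<..<b} x * f x" for x
    using assms(1,2) by (auto simp: indicator_def)
  have "f absolutely_integrable_on {a..b}"
    by (rule absolutely_integrable_continuous_real) fact
  then have "f absolutely_integrable_on {a<..<b}"
    by (rule set_integrable_subset) auto
  then have int: "integrable (lebesgue_on {a<..<b}) f"
    by (simp add: integrable_restrict_space set_integrable_def)
  then show "integrable LOmega (\<lambda>x. indicator {a<..<b} x * f x)"
    by (simp add: integrable_restrict_space eq)
  have "(LINT x|LOmega. indicator {a<..<b} x * f x) = (LINT x|lebesgue_on {a<..<b}. f x)"
    by (simp add: integral_restrict_space eq)
  also have "\<dots> = integral {a<..<b} f"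
    by (rule lebesgue_integral_eq_integral) (use int in auto)
  finally show "(LINT x|LOmega. indicator {a<..<b} x * f x) = integral {a..b} f"
    by (simp add: integral_open_interval_real)
qed

lemma LOmega_integral_continuous:
  fixes f :: "real \<Rightarrow> real"
  assumes "continuous_on {0..1} f"
  shows "integrable LOmega f" "(LINT x|LOmega. f x) = integral {0..1} f"
proof -
  have "integrable LOmega (\<lambda>x. indicator Omega x * f x) \<longleftrightarrow> integrable LOmega f"
    by (rule Bochner_Integration.integrable_cong) auto
  moreover have "(LINT x|LOmega. indicator Omega x * f x) = (LINT x|LOmega. f x)"
    by (rule Bochner_Integration.integral_cong) auto
  ultimately show "integrable LOmega f" "(LINT x|LOmega. f x) = integral {0..1} f"
    using LOmega_interval[of 0 1 f] assms by auto
qed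

lemma test_function_integrable: "test_function f \<Longrightarrow> integrable LOmega f"
  using LOmega_integral_continuous(1) smooth_fun_continuous test_function_alt by blast

lemma test_function_bounded:
  assumes "test_function f"
  obtains C where "\<And>x. x \<in> Omega \<Longrightarrow> \<bar>f x\<bar> \<le> C"
proof -
  have "bounded (f ` {0..1})"
    using assms smooth_fun_continuous test_function_alt
    by (intro compact_imp_bounded compact_continuous_image) auto
  then obtain C where "\<forall>x\<in>{0..1}. \<bar>f x\<bar> \<le> C"
    by (auto simp: bounded_iff)
  then show ?thesis using that by fastforce
qed

lemma integrable_mult_test:
  assumes "integrable LOmega k" "test_function f"
  shows "integrable LOmega (\<lambda>x. k x * f x)"
proof -
  obtain C where C: "\<And>x. x \<in> Omega \<Longrightarrow> \<bar>f x\<bar> \<le> C"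
    using test_function_bounded[OF assms(2)] by blast
  moreover have "f \<in> borel_measurable LOmega"
    using test_function_integrable[OF assms(2)] by auto
  moreover have "AE x in LOmega. norm (k x * f x) \<le> norm (C * k x)"
    using C by (intro AE_I2) (force simp: abs_mult mult.commute[of _ "\<bar>k _\<bar>"] intro!: mult_left_mono)
  ultimately show ?thesis
    using assms(1)
    by (intro Bochner_Integration.integrable_bound[of LOmega "\<lambda>x. C * k x" "\<lambda>x. k x * f x"]) auto
qed

section \<open>Antiderivatives of test functions, and functions determined by integrals over
  intervals\<close>

lemma smooth_antiderivative:
  assumes "smooth_fun f"
  obtains F where "smooth_fun F" "F 0 = 0" "\<And>x. (F has_real_derivative f x) (at x)"
proof -
  have "\<exists>F. \<forall>x. (-\<infinity>::ereal) < ereal x \<longrightarrow> ereal x < \<infinity> \<longrightarrow> (F has_vector_derivative f x) (at x)"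
    using smooth_fun_continuous[OF assms, of UNIV]
    by (intro einterval_antiderivative) (auto simp: continuous_on_eq_continuous_at)
  then obtain G where G: "\<And>x. (G has_real_derivative f x) (at x)"
    by (auto simp: has_real_derivative_iff_has_vector_derivative)
  define F where "F x = G x - G 0" for x
  have F: "(F has_real_derivative f x) (at x)" for x
    using G unfolding F_def by (auto intro!: derivative_eq_intros)
  have "ndiff n F" for n
    using F assms by (cases n) (auto simp: smooth_fun_def)
  then have "smooth_fun F" by (simp add: smooth_fun_def)
  then show ?thesis using that F by (simp add: F_def)
qed

lemma integral_DERIV:
  assumes "\<And>x. (F has_real_derivative f x) (at x)" "a \<le> b"
  shows "integral {a..b} f = F b - F a"
  using fundamental_theorem_of_calculus[of a b F f] assms
  by (intro integral_unique)
    (auto simp: has_real_derivative_iff_has_vector_derivative intro: has_vector_derivative_at_within)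

text \<open>An antiderivative is constant on either side of the support of \<open>f\<close>. The
  normalization at 0 makes the left constant 0, and the vanishing mean makes the right one
  0.\<close>

lemma test_function_antiderivative:
  assumes "test_function f" "(LINT x|LOmega. f x) = 0"
  obtains F where "test_function F" "nderiv_on UNIV 1 F = f"
proof -
  obtain a b where ab: "0 < a" "b < 1" "\<forall>x. x \<notin> {a..b} \<longrightarrow> f x = 0" and f: "smooth_fun f"
    using assms(1) by (auto simp: test_function_alt)
  obtain F where F: "smooth_fun F" "\<And>x. (F has_real_derivative f x) (at x)" and F0: "F 0 = 0"
    using smooth_antiderivative[OF f] by blast
  have left: "F x = 0" if "x < a" for x
  proof -
    have "(F has_real_derivative 0) (at y within {..<a})" if "y \<in> {..<a}" for y
    proof -
      have "f y = 0" using that ab(3) by auto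
      then show ?thesis using F(2)[of y] by (simp add: has_field_derivative_at_within)
    qed
    then have "\<exists>c. \<forall>x\<in>{..<a}. F x = c"
      by (intro has_field_derivative_zero_constant) auto
    with F0 show ?thesis using that ab by (metis lessThan_iff)
  qed
  have right: "F x = 0" if "x > b" for x
  proof -
    have "(F has_real_derivative 0) (at y within {b<..})" if "y \<in> {b<..}" for y
    proof -
      have "f y = 0" using that ab(3) by auto
      then show ?thesis using F(2)[of y] by (simp add: has_field_derivative_at_within)
    qed
    then have "\<exists>c. \<forall>x\<in>{b<..}. F x = c"
      by (intro has_field_derivative_zero_constant) auto
    moreover have "F 1 = 0"
      using integral_DERIV[OF F(2), of 0 1] assms(2) LOmega_integral_continuous(2)[of f]
        smooth_fun_continuous[OF f] F0 by simp
    ultimately show ?thesis using that ab by (metis greaterThan_iff)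
  qed
  have "test_function F"
    unfolding test_function_alt using F(1) ab left right
    by (intro conjI exI[of _ a] exI[of _ b]) (auto simp: not_le)
  moreover have "nderiv_on UNIV 1 F = f"
    using F smooth_fun_DERIV DERIV_unique by blast
  ultimately show ?thesis using that by blast
qed

text \<open>The positive and negative parts of a Borel representative \<open>h\<close> of
  \<open>k\<close> are densities of two finite measures on the line that agree on all half-lines
  \<open>{x<..}\<close>. Such measures are equal, hence so are their densities almost everywhere.
  The representative is introduced because \<open>k\<close> is only Lebesgue measurable.\<close>

lemma AE_zero_if_integral_intervals_zero:
  fixes k :: "real \<Rightarrow> real"
  assumes k: "integrable LOmega k"
    and zero: "\<And>a b. 0 < a \<Longrightarrow> b < 1 \<Longrightarrow> (LINT x|LOmega. indicator {a<..<b} x * k x) = 0"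
  shows "AE x in LOmega. k x = 0"
proof -
  have int1: "integrable lebesgue (\<lambda>x. indicator Omega x * k x)"
    using k by (simp add: integrable_restrict_space)
  obtain h where h: "h \<in> borel_measurable lborel" "AE x in lborel. indicator Omega x * k x = h x"
    using completion_ex_borel_measurable_real[of "\<lambda>x. indicator Omega x * k x" lborel] int1 by auto
  have hk: "AE x in lebesgue. indicator Omega x * k x = h x"
    using h(2) by (rule AE_completion)
  have hint: "integrable lborel h"
  proof -
    have "integrable lebesgue h"
      using int1 by (rule Bochner_Integration.integrable_cong_AE_imp[OF _ _ hk])
        (use h(1) measurable_completion in blast)
    then show ?thesis using integrable_completion[OF h(1)] by simp
  qed
  have tail: "(LINT t|lborel. indicator {x<..} t * h t) = 0" for x
  proof -
    have int_t: "(LINT t|lborel. indicator {x<..} t * h t) = (LINT t|LOmega. indicator {x<..} t * k t)"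
    proof -
      have "(LINT t|lborel. indicator {x<..} t * h t) = (LINT t|lebesgue. indicator {x<..} t * h t)"
        by (rule integral_completion[symmetric]) (use h(1) in measurable)
      also have "\<dots> = (LINT t|lebesgue. indicator {x<..} t * (indicator Omega t * k t))"
      proof (rule integral_cong_AE)
        show "(\<lambda>t. indicator {x<..} t * h t) \<in> borel_measurable lebesgue"
          by (rule measurable_completion) (use h(1) in measurable)
        have "(indicator {x<..} :: real \<Rightarrow> real) \<in> borel_measurable lebesgue"
          by (rule measurable_completion) measurable
        then show "(\<lambda>t. indicator {x<..} t * (indicator Omega t * k t)) \<in> borel_measurable lebesgue"
          using borel_measurable_times[OF _ borel_measurable_integrable[OF int1]] by blast
      qed (use hk in auto)
      also have "\<dots> = (LINT t|LOmega. indicator {x<..} t * k t)"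
        by (simp add: integral_restrict_space mult.left_commute)
      finally show ?thesis .
    qed
    \<comment> \<open>The hypothesis covers only intervals whose end points stay inside
      \<open>Omega\<close>; the half-line is exhausted from within by moving both ends inwards by
      \<open>e n\<close>.\<close>
    define e :: "nat \<Rightarrow> real" where "e n = inverse (real (Suc n))" for n
    have "(\<lambda>n. LINT t|LOmega. indicator {max x 0 + e n<..<1 - e n} t * k t)
        \<longlonglongrightarrow> (LINT t|LOmega. indicator {x<..} t * k t)"
    proof (rule integral_dominated_convergence[where w = "\<lambda>t. \<bar>k t\<bar>"])
      show "AE t in LOmega. (\<lambda>n. indicator {max x 0 + e n<..<1 - e n} t * k t)
          \<longlonglongrightarrow> indicator {x<..} t * k t"
      proof (rule AE_I2)
        fix t assume t: "t \<in> space LOmega"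
        have e0: "e \<longlonglongrightarrow> 0" unfolding e_def by (rule LIMSEQ_inverse_real_of_nat)
        have "\<forall>\<^sub>F n in sequentially. indicator {x<..} t * k t
            = indicator {max x 0 + e n<..<1 - e n} t * k t"
        proof (cases "t > x")
          case True
          have "\<forall>\<^sub>F n in sequentially. e n < min (t - max x 0) (1 - t)"
            using True t by (intro order_tendstoD[OF e0]) auto
          then show ?thesis by eventually_elim (use True in \<open>auto simp: indicator_def\<close>)
        next
          case False
          have "0 < e n" for n by (simp add: e_def)
          then have lt: "t < max x 0 + e n" for n using False by (smt (verit))
          have "indicator {x<..} t * k t = indicator {max x 0 + e n<..<1 - e n} t * k t" for n
            using False lt[of n] by (simp add: indicator_def)
          then show ?thesis by simp
        qed
        then show "(\<lambda>n. indicator {max x 0 + e n<..<1 - e n} t * k t)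
          \<longlonglongrightarrow> indicator {x<..} t * k t"
          by (rule tendsto_eventually[OF eventually_mono]) auto
      qed
      have ind: "(indicator A :: real \<Rightarrow> real) \<in> borel_measurable LOmega" if "A \<in> sets borel" for A
        by (rule borel_measurable_LOmegaI) (use that in measurable)
      show "(\<lambda>t. indicator {x<..} t * k t) \<in> borel_measurable LOmega"
        "(\<lambda>t. indicator {max x 0 + e n<..<1 - e n} t * k t) \<in> borel_measurable LOmega" for n
        using k by (auto intro!: borel_measurable_times ind)
    qed (use k in \<open>auto simp: indicator_def\<close>)
    moreover have "(LINT t|LOmega. indicator {max x 0 + e n<..<1 - e n} t * k t) = 0" for n
      by (rule zero) (auto simp: e_def add_nonneg_pos)
    ultimately show ?thesis using int_t by (simp add: LIMSEQ_const_iff)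
  qed
  define p where "p t = max (h t) 0" for t
  define m where "m t = max (- h t) 0" for t
  have pm: "p \<in> borel_measurable lborel" "m \<in> borel_measurable lborel"
    "integrable lborel p" "integrable lborel m" "\<And>t. 0 \<le> p t" "\<And>t. 0 \<le> m t"
    using h(1) hint unfolding p_def m_def by auto
  have em: "emeasure (density lborel (\<lambda>t. ennreal (g t))) {x<..}
      = ennreal (LINT t|lborel. indicator {x<..} t * g t)"
    if "integrable lborel g" "\<And>t. 0 \<le> g t" "g \<in> borel_measurable lborel" for g :: "real \<Rightarrow> real" and x
  proof -
    have "emeasure (density lborel (\<lambda>t. ennreal (g t))) {x<..}
        = (\<integral>\<^sup>+t. ennreal (indicator {x<..} t * g t) \<partial>lborel)"
      using that(3) by (subst emeasure_density)
        (auto intro!: nn_integral_cong simp: indicator_def)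
    also have "\<dots> = ennreal (LINT t|lborel. indicator {x<..} t * g t)"
      using that integrable_real_mult_indicator[of "{x<..}" lborel g]
      by (intro nn_integral_eq_integral) (auto simp: mult.commute)
    finally show ?thesis .
  qed
  have "density lborel p = density lborel m"
  proof (rule measure_eqI_lessThan)
    fix x :: real
    have "(LINT t|lborel. indicator {x<..} t * p t) - (LINT t|lborel. indicator {x<..} t * m t)
        = (LINT t|lborel. indicator {x<..} t * p t - indicator {x<..} t * m t)"
      using integrable_real_mult_indicator[of "{x<..}" lborel p] pm(3,4)
        integrable_real_mult_indicator[of "{x<..}" lborel m]
      by (subst Bochner_Integration.integral_diff) (auto simp: mult.commute)
    also have "\<dots> = (LINT t|lborel. indicator {x<..} t * h t)"
      by (rule Bochner_Integration.integral_cong) (auto simp: p_def m_def indicator_def)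
    finally have "(LINT t|lborel. indicator {x<..} t * p t) - (LINT t|lborel. indicator {x<..} t * m t)
        = (LINT t|lborel. indicator {x<..} t * h t)" .
    then show "emeasure (density lborel p) {x<..} = emeasure (density lborel m) {x<..}"
      using tail em[OF pm(3,5,1)] em[OF pm(4,6,2)] by simp
    show "emeasure (density lborel p) {x<..} < \<infinity>"
      using em[OF pm(3,5,1)] by simp
  qed auto
  then have "AE t in lborel. ennreal (p t) = ennreal (m t)"
    using sigma_finite_measure.density_unique_iff[OF sigma_finite_lborel, of p m] pm by auto
  then have "AE t in lborel. h t = 0"
    by eventually_elim (use pm in \<open>auto simp: p_def m_def max_def split: if_splits\<close>)
  then have "AE t in lebesgue. h t = 0" by (rule AE_completion)
  then show ?thesis
    unfolding LOmega_AE_iff using hk by eventually_elim auto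
qed

subsection \<open>Weak derivatives\<close>

text \<open>The bumps are test functions bounded by 1 that converge to the indicator of
  \<open>{a<..<b}\<close>, so dominated convergence carries the hypothesis over to
  intervals.\<close>

lemma AE_zero_if_test_zero:
  assumes kc: "integrable LOmega k"
    and test: "\<And>\<psi>. test_function \<psi> \<Longrightarrow> (LINT x|LOmega. k x * \<psi> x) = 0"
  shows "AE x in LOmega. k x = 0"
proof (rule AE_zero_if_integral_intervals_zero[OF kc])
  fix a b :: real assume ab: "0 < a" "b < 1"
  have bt: "test_function (bump (real n) a b)" for n
    using ab by (intro test_function_bump) auto
  have "(\<lambda>n. LINT x|LOmega. k x * bump (real n) a b x)
      \<longlonglongrightarrow> (LINT x|LOmega. k x * indicator {a<..<b} x)"
  proof (rule integral_dominated_convergence[where w = "\<lambda>x. \<bar>k x\<bar>"])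
    show "(\<lambda>x. k x * indicator {a<..<b} x) \<in> borel_measurable LOmega"
      by (intro borel_measurable_times borel_measurable_LOmegaI[of "indicator _"])
        (use kc in auto)
    show "(\<lambda>x. k x * bump (real n) a b x) \<in> borel_measurable LOmega" for n
      using integrable_mult_test[OF kc bt] by auto
    show "AE x in LOmega. (\<lambda>n. k x * bump (real n) a b x)
        \<longlonglongrightarrow> k x * indicator {a<..<b} x"
      by (intro AE_I2 tendsto_intros bump_tendsto)
    show "AE x in LOmega. norm (k x * bump (real n) a b x) \<le> \<bar>k x\<bar>" for n
      using bump_bounds by (intro AE_I2) (simp add: abs_mult mult_left_le)
  qed (use kc in auto)
  then show "(LINT x|LOmega. indicator {a<..<b} x * k x) = 0"
    using test[OF bt] by (simp add: LIMSEQ_const_iff mult.commute)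
qed

text \<open>The du Bois-Reymond argument: subtracting from \<open>\<psi>\<close> the multiple of a
  fixed bump \<open>r0\<close> with the same integral leaves a test function of mean zero, which is
  the derivative of a test function. Hence \<open>k\<close> pairs with \<open>\<psi>\<close> like
  the constant \<open>c\<close>, the mean of \<open>k\<close> weighted by \<open>r0\<close>.\<close>

lemma AE_const_if_weak_deriv_zero:
  assumes k: "integrable LOmega k"
    and zero: "\<And>\<phi>. test_function \<phi> \<Longrightarrow> (LINT x|LOmega. k x * nderiv_on UNIV 1 \<phi> x) = 0"
  obtains c where "AE x in LOmega. k x = c"
proof -
  define r0 where "r0 = bump 1 (1/4) (3/4)"
  have r0: "test_function r0"
    unfolding r0_def by (rule test_function_bump) auto
  have r0_pos: "(LINT x|LOmega. r0 x) > 0"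
  proof -
    have "(LINT x|LOmega. r0 x) \<noteq> 0"
    proof
      assume "(LINT x|LOmega. r0 x) = 0"
      then have "AE x in LOmega. r0 x = 0"
        using integral_nonneg_eq_0_iff_AE[of LOmega r0] test_function_integrable[OF r0]
        by (simp add: r0_def bump_bounds)
      then have "AE x in LOmega. x \<notin> {1/4<..<3/4}"
        by eventually_elim (auto simp: r0_def bump_def flat_def split: if_splits)
      then have "AE x in LOmega. indicator {1/4<..<3/4} x * 1 = (0::real)"
        by eventually_elim (auto simp: indicator_def)
      then have "(LINT x|LOmega. indicator {1/4<..<3/4::real} x * 1) = (0::real)"
        by (rule integral_eq_zero_AE)
      then show False
        using LOmega_interval(2)[of "1/4" "3/4" "\<lambda>x. 1"] by simp
    qed
    moreover have "(LINT x|LOmega. r0 x) \<ge> 0"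
      by (rule Bochner_Integration.integral_nonneg) (simp add: r0_def bump_bounds)
    ultimately show ?thesis by simp
  qed
  define c where "c = (LINT x|LOmega. k x * r0 x) / (LINT x|LOmega. r0 x)"
  have test: "(LINT x|LOmega. (k x - c) * \<psi> x) = 0" if \<psi>: "test_function \<psi>" for \<psi>
  proof -
    define d where "d = (LINT x|LOmega. \<psi> x) / (LINT x|LOmega. r0 x)"
    have ints: "integrable LOmega \<psi>" "integrable LOmega r0"
      "integrable LOmega (\<lambda>x. k x * \<psi> x)" "integrable LOmega (\<lambda>x. k x * r0 x)"
      using \<psi> r0 k test_function_integrable integrable_mult_test by auto
    have "test_function (\<lambda>x. \<psi> x + - d * r0 x)"
      by (rule test_function_lincomb) fact+
    moreover have "(LINT x|LOmega. \<psi> x + - d * r0 x) = 0"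
      using ints r0_pos by (simp add: d_def)
    ultimately obtain F where "test_function F" "nderiv_on UNIV 1 F = (\<lambda>x. \<psi> x + - d * r0 x)"
      using test_function_antiderivative by blast
    then have "(LINT x|LOmega. k x * (\<psi> x + - d * r0 x)) = 0"
      using zero[of F] by simp
    moreover have "(LINT x|LOmega. k x * (\<psi> x + - d * r0 x))
        = (LINT x|LOmega. k x * \<psi> x) - d * (LINT x|LOmega. k x * r0 x)"
      using ints by (simp add: right_diff_distrib mult.left_commute[of "k _"])
    ultimately have "(LINT x|LOmega. k x * \<psi> x) = d * (LINT x|LOmega. k x * r0 x)" by simp
    moreover have "(LINT x|LOmega. (k x - c) * \<psi> x)
        = (LINT x|LOmega. k x * \<psi> x) - c * (LINT x|LOmega. \<psi> x)"
      using ints by (simp add: left_diff_distrib)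
    ultimately show ?thesis using r0_pos by (simp add: c_def d_def)
  qed
  have "AE x in LOmega. k x - c = 0"
    by (rule AE_zero_if_test_zero[OF _ test]) (use k in auto)
  then show ?thesis using that[of c] by simp
qed

section \<open>Integrability of products and the Cauchy-Schwarz inequality in
  \<open>L2\<close>\<close>

lemma L2_integrable:
  assumes "f \<in> L2"
  shows "integrable LOmega f"
proof (rule Bochner_Integration.integrable_bound)
  show "integrable LOmega (\<lambda>x. 1 + (f x)\<^sup>2)"
    using assms by (auto simp: L2_def)
  have "\<bar>t\<bar> \<le> 1 + t\<^sup>2" for t :: real
    using sum_power2_ge_zero[of 0 "\<bar>t\<bar> - 1"] by (auto simp: power2_eq_square algebra_simps abs_if split: if_splits)
  then show "AE x in LOmega. norm (f x) \<le> norm (1 + (f x)\<^sup>2)"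
    by (intro AE_I2) (smt (verit) real_norm_def)
qed (use assms in \<open>auto simp: L2_def\<close>)

lemma abs_mult_le_squares: "\<bar>a * b\<bar> \<le> a\<^sup>2 + b\<^sup>2" for a b :: real
proof -
  have "2 * (\<bar>a\<bar> * \<bar>b\<bar>) \<le> a\<^sup>2 + b\<^sup>2"
    using sum_squares_bound[of "\<bar>a\<bar>" "\<bar>b\<bar>"] by (simp add: mult.assoc)
  moreover have "0 \<le> \<bar>a\<bar> * \<bar>b\<bar>" by simp
  ultimately show ?thesis unfolding abs_mult by linarith
qed

lemma L2_mult_integrable:
  assumes "f \<in> L2" "g \<in> L2"
  shows "integrable LOmega (\<lambda>x. f x * g x)"
proof (rule Bochner_Integration.integrable_bound)
  show "integrable LOmega (\<lambda>x. (f x)\<^sup>2 + (g x)\<^sup>2)"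
    using assms by (auto simp: L2_def)
  show "AE x in LOmega. norm (f x * g x) \<le> norm ((f x)\<^sup>2 + (g x)\<^sup>2)"
    using abs_mult_le_squares by (intro AE_I2) simp
qed (use assms in \<open>auto simp: L2_def\<close>)

lemma L2_norm_sq: "(L2_norm f)\<^sup>2 = (LINT x|LOmega. (f x)\<^sup>2)"
  unfolding L2_norm_def L2_inner_def
  by (subst real_sqrt_pow2) (auto simp: power2_eq_square intro!: Bochner_Integration.integral_nonneg)

lemma L2_norm_nonneg: "0 \<le> L2_norm f"
  unfolding L2_norm_def L2_inner_def by (auto intro!: Bochner_Integration.integral_nonneg)

text \<open>The common core of the Cauchy-Schwarz inequalities for \<open>L2\<close> and for the
  energy. The case \<open>A = 0\<close> has to be included, since a nonzero function may have norm
  or energy zero; there an affine function of \<open>t\<close> that is nonnegative everywhere must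
  have slope zero.\<close>

lemma nonneg_quadratic_discriminant:
  fixes A B C :: real
  assumes quad: "\<And>t. 0 \<le> A * t\<^sup>2 - 2 * C * t + B" and "0 \<le> A"
  shows "C\<^sup>2 \<le> A * B"
proof (cases "A = 0")
  case True
  have "C = 0"
  proof (rule ccontr)
    assume "C \<noteq> 0"
    define t where "t = (B + 1) / (2 * C)"
    have "2 * C * t = B + 1" using \<open>C \<noteq> 0\<close> by (simp add: t_def)
    then show False using quad[of t] True by simp
  qed
  then show ?thesis using True by simp
next
  case False
  then have "0 < A" using assms(2) by simp
  have "A * (C / A)\<^sup>2 - 2 * C * (C / A) + B = B - C\<^sup>2 / A"
    using \<open>0 < A\<close> by (simp add: field_simps power2_eq_square)
  then have "C\<^sup>2 / A \<le> B" using quad[of "C / A"] by simp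
  then show ?thesis using \<open>0 < A\<close> by (simp add: field_simps)
qed

lemma L2_Cauchy_Schwarz:
  assumes "f \<in> L2" "g \<in> L2"
  shows "(LINT x|LOmega. \<bar>f x * g x\<bar>) \<le> L2_norm f * L2_norm g"
proof -
  let ?A = "LINT x|LOmega. (f x)\<^sup>2" and ?B = "LINT x|LOmega. (g x)\<^sup>2"
    and ?C = "LINT x|LOmega. \<bar>f x * g x\<bar>"
  have ints: "integrable LOmega (\<lambda>x. (f x)\<^sup>2)" "integrable LOmega (\<lambda>x. (g x)\<^sup>2)"
    "integrable LOmega (\<lambda>x. \<bar>f x * g x\<bar>)"
    using assms L2_mult_integrable[OF assms] by (auto simp: L2_def)
  have "0 \<le> ?A * t\<^sup>2 - 2 * ?C * t + ?B" for t
  proof -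
    have "0 \<le> (LINT x|LOmega. (\<bar>f x\<bar> * t - \<bar>g x\<bar>)\<^sup>2)"
      by (intro Bochner_Integration.integral_nonneg) simp
    also have "\<dots> = (LINT x|LOmega. (f x)\<^sup>2 * t\<^sup>2 - 2 * t * \<bar>f x * g x\<bar> + (g x)\<^sup>2)"
      by (intro Bochner_Integration.integral_cong)
        (auto simp: power2_eq_square abs_mult algebra_simps)
    also have "\<dots> = ?A * t\<^sup>2 - 2 * ?C * t + ?B"
      using ints by simp
    finally show ?thesis .
  qed
  then have quad: "0 \<le> ?A * t\<^sup>2 - 2 * ?C * t + ?B" for t by blast
  have "?C\<^sup>2 \<le> ?A * ?B"
    by (rule nonneg_quadratic_discriminant[OF quad]) (auto intro!: Bochner_Integration.integral_nonneg)
  then have "?C\<^sup>2 \<le> (L2_norm f * L2_norm g)\<^sup>2"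
    by (simp add: power_mult_distrib L2_norm_sq)
  then show ?thesis
    by (rule power2_le_imp_le) (simp add: L2_norm_nonneg)
qed

text \<open>The primitive of \<open>h\<close> starting at 0. Encoding the upper limit by an
  indicator makes it a function on the whole line, constant to the left and to the right of
  \<open>Omega\<close>, and turns continuity and integration by parts into dominated convergence and
  Fubini.\<close>

definition prim :: "(real \<Rightarrow> real) \<Rightarrow> real \<Rightarrow> real" where
  "prim h x = (LINT t|LOmega. indicator {..x} t * h t)"

lemma indicator_LOmega: "A \<in> sets borel \<Longrightarrow> (indicator A :: real \<Rightarrow> real) \<in> borel_measurable LOmega"
  by (intro borel_measurable_LOmegaI borel_measurable_indicator)

lemma integrable_indicator_LOmega:
  fixes h :: "real \<Rightarrow> real"
  assumes "integrable LOmega h" "A \<in> sets borel"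
  shows "integrable LOmega (\<lambda>t. indicator A t * h t)"
proof (rule Bochner_Integration.integrable_bound[OF assms(1)])
  show "(\<lambda>t. indicator A t * h t) \<in> borel_measurable LOmega"
    by (rule borel_measurable_times[OF indicator_LOmega[OF assms(2)] borel_measurable_integrable[OF assms(1)]])
qed (auto simp: indicator_def)

lemma prim_diff:
  assumes "integrable LOmega h" "x \<le> y"
  shows "prim h y - prim h x = (LINT t|LOmega. indicator {x<..y} t * h t)"
proof -
  have "prim h y - prim h x = (LINT t|LOmega. indicator {..y} t * h t - indicator {..x} t * h t)"
    unfolding prim_def using assms integrable_indicator_LOmega by (subst Bochner_Integration.integral_diff) auto
  also have "\<dots> = (LINT t|LOmega. indicator {x<..y} t * h t)"
    by (rule Bochner_Integration.integral_cong) (use assms(2) in \<open>auto simp: indicator_def\<close>)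
  finally show ?thesis .
qed

lemma prim_diff_le:
  assumes "integrable LOmega h" "x \<le> y"
  shows "\<bar>prim h y - prim h x\<bar> \<le> (LINT t|LOmega. indicator {x<..y} t * \<bar>h t\<bar>)"
proof -
  have "\<bar>prim h y - prim h x\<bar> \<le> (LINT t|LOmega. \<bar>indicator {x<..y} t * h t\<bar>)"
    unfolding prim_diff[OF assms]
    using integral_norm_bound[of LOmega "\<lambda>t. indicator {x<..y} t * h t"] by simp
  then show ?thesis by (simp add: abs_mult)
qed

lemma LO2_integrable_bound:
  fixes F :: "real \<times> real \<Rightarrow> real"
  assumes F: "F \<in> borel_measurable (LOmega \<Otimes>\<^sub>M LOmega)"
    and g: "integrable LOmega g" and h: "integrable LOmega h"
    and le: "\<And>x t. x \<in> Omega \<Longrightarrow> t \<in> Omega \<Longrightarrow> \<bar>F (x, t)\<bar> \<le> \<bar>g x * h t\<bar>"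
  shows "integrable (LOmega \<Otimes>\<^sub>M LOmega) F"
proof (rule Bochner_Integration.integrable_bound)
  have [measurable]: "g \<in> borel_measurable LOmega" "h \<in> borel_measurable LOmega"
    using g h by auto
  have m: "(\<lambda>p. g (fst p) * h (snd p)) \<in> borel_measurable (LOmega \<Otimes>\<^sub>M LOmega)"
    by measurable
  show "integrable (LOmega \<Otimes>\<^sub>M LOmega) (\<lambda>p. g (fst p) * h (snd p))"
    by (rule LO2.Fubini_integrable[OF m]) (use g h in \<open>auto simp: abs_mult\<close>)
  show "AE p in LOmega \<Otimes>\<^sub>M LOmega. norm (F p) \<le> norm (g (fst p) * h (snd p))"
    using le by (intro AE_I2) (auto simp: space_pair_measure)
qed (rule F)

lemma measurable_LO2 [measurable]:
  "fst \<in> borel_measurable (LOmega \<Otimes>\<^sub>M LOmega)" "snd \<in> borel_measurable (LOmega \<Otimes>\<^sub>M LOmega)"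
proof -
  have "(\<lambda>x. x) \<in> borel_measurable LOmega"
    by (rule borel_measurable_LOmegaI) simp
  then show "fst \<in> borel_measurable (LOmega \<Otimes>\<^sub>M LOmega)" "snd \<in> borel_measurable (LOmega \<Otimes>\<^sub>M LOmega)"
    using measurable_compose[OF measurable_fst[of LOmega LOmega]]
      measurable_compose[OF measurable_snd[of LOmega LOmega]] by auto
qed

text \<open>Fubini on the triangle \<open>t \<le> x\<close> replaces integration by parts.\<close>

lemma prim_by_parts:
  assumes h: "integrable LOmega h" and \<phi>: "test_function \<phi>"
  shows "(LINT x|LOmega. prim h x * nderiv_on UNIV 1 \<phi> x) = - (LINT t|LOmega. h t * \<phi> t)"
proof -
  let ?d = "nderiv_on UNIV 1 \<phi>"
  have d: "test_function ?d" using \<phi> test_function_nderiv1 by blast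
  have sm: "smooth_fun \<phi>" "smooth_fun ?d" using \<phi> d by (auto simp: test_function_alt)
  have \<phi>1: "\<phi> 1 = 0" using \<phi> by (auto simp: test_function_alt)
  define K where "K p = (if snd p \<le> fst p then 1 else 0) * (h (snd p) * ?d (fst p))" for p
  have [measurable]: "?d \<in> borel_measurable LOmega" "h \<in> borel_measurable LOmega"
    using test_function_integrable[OF d] h by auto
  have "K \<in> borel_measurable (LOmega \<Otimes>\<^sub>M LOmega)"
    unfolding K_def by measurable
  then have Kint: "integrable (LOmega \<Otimes>\<^sub>M LOmega) K"
    by (rule LO2_integrable_bound[OF _ test_function_integrable[OF d] h])
      (auto simp: K_def abs_mult)
  have "(LINT x|LOmega. prim h x * ?d x) = (LINT x|LOmega. LINT t|LOmega. K (x, t))"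
  proof (rule Bochner_Integration.integral_cong)
    fix x
    have "(LINT t|LOmega. K (x, t)) = (LINT t|LOmega. (indicator {..x} t * h t) * ?d x)"
      by (rule Bochner_Integration.integral_cong) (auto simp: K_def indicator_def)
    then show "prim h x * ?d x = (LINT t|LOmega. K (x, t))"
      by (simp add: prim_def)
  qed simp
  also have "\<dots> = (LINT t|LOmega. LINT x|LOmega. K (x, t))"
    using LO2.Fubini_integral[of "\<lambda>x t. K (x, t)"] Kint by simp
  also have "\<dots> = (LINT t|LOmega. - (h t * \<phi> t))"
  proof (rule Bochner_Integration.integral_cong)
    fix t assume "t \<in> space LOmega"
    then have t: "0 < t" "t < 1" by auto
    have "(LINT x|LOmega. K (x, t)) = (LINT x|LOmega. h t * (indicator {t..1} x * ?d x))"
      by (rule Bochner_Integration.integral_cong) (auto simp: K_def indicator_def)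
    also have "\<dots> = h t * (LINT x|LOmega. indicator {t..1} x * ?d x)"
      by simp
    also have "(LINT x|LOmega. indicator {t..1} x * ?d x) = (LINT x|LOmega. indicator {t<..<1} x * ?d x)"
    proof (rule integral_cong_AE)
      have "AE x in LOmega. x \<noteq> t"
        unfolding LOmega_AE_iff by (rule AE_mp[OF AE_completion[OF AE_lborel_singleton[of t]]]) auto
      then show "AE x in LOmega. indicator {t..1} x * ?d x = indicator {t<..<1} x * ?d x"
        by (rule AE_mp[OF _ AE_I2]) (auto simp: indicator_def)
    qed (intro borel_measurable_times indicator_LOmega; measurable)+
    also have "\<dots> = integral {t..1} ?d"
      using t smooth_fun_continuous[OF sm(2)] by (intro LOmega_interval(2)) auto
    also have "\<dots> = - \<phi> t"
      using integral_DERIV[OF smooth_fun_DERIV[OF sm(1)], of t 1] t \<phi>1 by simp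
    finally show "(LINT x|LOmega. K (x, t)) = - (h t * \<phi> t)" by simp
  qed simp
  finally show ?thesis by simp
qed

lemma prim_continuous:
  assumes h: "integrable LOmega h"
  shows "continuous_on Omega (prim h)"
proof (rule continuous_on_sequentiallyI)
  fix u :: "nat \<Rightarrow> real" and a assume u: "\<forall>n. u n \<in> Omega" "a \<in> Omega" "u \<longlonglongrightarrow> a"
  show "(\<lambda>n. prim h (u n)) \<longlonglongrightarrow> prim h a"
    unfolding prim_def
  proof (rule integral_dominated_convergence[where w = "\<lambda>x. \<bar>h x\<bar>"])
    have "AE t in LOmega. t \<noteq> a"
      unfolding LOmega_AE_iff by (rule AE_mp[OF AE_completion[OF AE_lborel_singleton[of a]]]) auto
    then show "AE t in LOmega. (\<lambda>n. indicator {..u n} t * h t) \<longlonglongrightarrow> indicator {..a} t * h t"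
    proof eventually_elim
      fix t assume "t \<noteq> a"
      have "\<forall>\<^sub>F n in sequentially. indicator {..u n} t = (indicator {..a} t :: real)"
      proof (cases "t < a")
        case True
        show ?thesis
          using order_tendstoD(1)[OF u(3) True] by eventually_elim (use True in auto)
      next
        case False
        then have "a < t" using \<open>t \<noteq> a\<close> by simp
        show ?thesis
          using order_tendstoD(2)[OF u(3) \<open>a < t\<close>] by eventually_elim (use \<open>a < t\<close> in auto)
      qed
      then show "(\<lambda>n. indicator {..u n} t * h t) \<longlonglongrightarrow> indicator {..a} t * h t"
        by (intro tendsto_intros tendsto_eventually)
    qed
    show "(\<lambda>t. indicator {..a} t * h t) \<in> borel_measurable LOmega"
      "(\<lambda>t. indicator {..u n} t * h t) \<in> borel_measurable LOmega" for n
      using integrable_indicator_LOmega[OF h] by (intro borel_measurable_integrable; simp)+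
  qed (use h in \<open>auto simp: indicator_def\<close>)
qed

text \<open>The representative \<open>k\<close> is continuous on the open interval only, so the
  fundamental theorem is applied on a compact subinterval \<open>{a..b}\<close> around
  \<open>x\<close>, with \<open>prim h a\<close> as additive constant.\<close>

lemma prim_DERIV:
  assumes h: "integrable LOmega h" and k: "continuous_on Omega k" "AE t in LOmega. h t = k t"
    and x: "x \<in> Omega"
  shows "(prim h has_real_derivative k x) (at x)"
proof -
  define a where "a = x / 2"
  define b where "b = (1 + x) / 2"
  have ab: "0 < a" "a < x" "x < b" "b < 1" using x by (auto simp: a_def b_def)
  have kc: "continuous_on {a..b} k" using k(1) by (rule continuous_on_subset) (use ab in auto)
  have eq: "prim h y = prim h a + integral {a..y} k" if y: "a \<le> y" "y \<le> b" for y
  proof -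
    have kc': "continuous_on {a..y} k" using kc by (rule continuous_on_subset) (use y in auto)
    have "prim h y - prim h a = (LINT t|LOmega. indicator {a<..y} t * h t)"
      by (rule prim_diff[OF h y(1)])
    also have "\<dots> = (LINT t|LOmega. indicator {a<..<y} t * k t)"
    proof (rule integral_cong_AE)
      have "AE t in LOmega. t \<noteq> y"
        unfolding LOmega_AE_iff by (rule AE_mp[OF AE_completion[OF AE_lborel_singleton[of y]]]) auto
      with k(2) show "AE t in LOmega. indicator {a<..y} t * h t = indicator {a<..<y} t * k t"
        by eventually_elim (auto simp: indicator_def)
    qed (use h continuous_on_LOmega[OF k(1)] in \<open>auto intro!: borel_measurable_times indicator_LOmega\<close>)
    also have "\<dots> = integral {a..y} k"
      using ab y kc' by (intro LOmega_interval(2)) auto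
    finally show ?thesis by simp
  qed
  have "((\<lambda>y. integral {a..y} k) has_vector_derivative k x) (at x within {a..b})"
    by (rule integral_has_vector_derivative[OF kc]) (use ab in auto)
  then have "((\<lambda>y. integral {a..y} k) has_vector_derivative k x) (at x within {a<..<b})"
    by (rule has_vector_derivative_within_subset) auto
  then have "((\<lambda>y. integral {a..y} k) has_real_derivative k x) (at x)"
    using ab by (simp add: at_within_open[of x "{a<..<b}"] has_real_derivative_iff_has_vector_derivative)
  then have "((\<lambda>y. prim h a + integral {a..y} k) has_real_derivative k x) (at x)"
    by (auto intro!: derivative_eq_intros)
  then show ?thesis
    by (rule has_field_derivative_transform_within_open[of _ _ _ "{a<..<b}"]) (use ab in \<open>auto simp: eq[symmetric]\<close>)
qed

text \<open>By \<open>prim_by_parts\<close>, \<open>prim h\<close> also has weak derivative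
  \<open>h\<close>; the difference \<open>g - prim h\<close> has weak derivative zero and is
  therefore constant.\<close>

lemma weak_deriv_prim:
  assumes g: "integrable LOmega g" and h: "integrable LOmega h"
    and weak: "\<And>\<phi>. test_function \<phi> \<Longrightarrow>
      (LINT x|LOmega. g x * nderiv_on UNIV 1 \<phi> x) = - (LINT x|LOmega. h x * \<phi> x)"
  obtains c where "AE x in LOmega. g x = c + prim h x"
proof -
  have bound: "\<bar>prim h x\<bar> \<le> (LINT t|LOmega. \<bar>h t\<bar>)" for x
  proof -
    have "\<bar>prim h x\<bar> \<le> (LINT t|LOmega. \<bar>indicator {..x} t * h t\<bar>)"
      unfolding prim_def using integral_norm_bound[of LOmega "\<lambda>t. indicator {..x} t * h t"] by simp
    also have "\<dots> \<le> (LINT t|LOmega. \<bar>h t\<bar>)"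
      by (rule Bochner_Integration.integral_mono)
        (use h integrable_abs[OF integrable_indicator_LOmega[OF h, of "{..x}"]] in
          \<open>auto simp: abs_mult mult_left_le_one_le\<close>)
    finally show ?thesis .
  qed
  have pm: "prim h \<in> borel_measurable LOmega"
    by (rule continuous_on_LOmega[OF prim_continuous[OF h]])
  have pint: "integrable LOmega (prim h)"
    by (rule LO.integrable_const_bound[OF AE_I2 pm]) (use bound in auto)
  have int: "integrable LOmega (\<lambda>x. g x - prim h x)" using g pint by simp
  have "(LINT x|LOmega. (g x - prim h x) * nderiv_on UNIV 1 \<phi> x) = 0" if "test_function \<phi>" for \<phi>
    using weak[OF that] prim_by_parts[OF h that]
      integrable_mult_test[OF g test_function_nderiv1[OF that]]
      integrable_mult_test[OF pint test_function_nderiv1[OF that]]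
    by (simp add: left_diff_distrib)
  then obtain c where "AE x in LOmega. g x - prim h x = c"
    using AE_const_if_weak_deriv_zero[OF int] by blast
  then have "AE x in LOmega. g x = c + prim h x" by eventually_elim simp
  then show ?thesis by (rule that)
qed

section \<open>Classical representatives of functions in \<open>Hk 4\<close>\<close>

lemma weak_deriv_spec:
  assumes "u \<in> Hk k" "j \<le> k"
  shows "weak_deriv j u \<in> L2" "has_weak_deriv j u (weak_deriv j u)"
proof -
  have "\<exists>g. g \<in> L2 \<and> has_weak_deriv j u g" using assms by (auto simp: Hk_def)
  then have "weak_deriv j u \<in> L2 \<and> has_weak_deriv j u (weak_deriv j u)"
    unfolding weak_deriv_def by (rule someI_ex)
  then show "weak_deriv j u \<in> L2" "has_weak_deriv j u (weak_deriv j u)" by auto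
qed

text \<open>Each \<open>weak_deriv j u\<close> is chosen separately, directly from \<open>u\<close>.
  Testing the relation of order \<open>j\<close> with the derivative of \<open>\<phi>\<close>, and
  the one of order \<open>j + 1\<close> with \<open>\<phi>\<close>, shows that consecutive choices
  are nevertheless weak derivatives of one another.\<close>

lemma weak_deriv_step:
  assumes u: "u \<in> Hk k" "Suc j \<le> k" and \<phi>: "test_function \<phi>"
  shows "(LINT x|LOmega. weak_deriv j u x * nderiv_on UNIV 1 \<phi> x)
    = - (LINT x|LOmega. weak_deriv (Suc j) u x * \<phi> x)"
proof -
  have "(LINT x|LOmega. u x * nderiv_on UNIV j (nderiv_on UNIV 1 \<phi>) x)
      = (-1) ^ j * (LINT x|LOmega. weak_deriv j u x * nderiv_on UNIV 1 \<phi> x)"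
    using weak_deriv_spec(2)[of u k j] u test_function_nderiv1[OF \<phi>]
    unfolding has_weak_deriv_def by fastforce
  moreover have "(LINT x|LOmega. u x * nderiv_on UNIV (Suc j) \<phi> x)
      = (-1) ^ Suc j * (LINT x|LOmega. weak_deriv (Suc j) u x * \<phi> x)"
    using weak_deriv_spec(2)[of u k "Suc j"] u \<phi> unfolding has_weak_deriv_def by blast
  ultimately have "(-1) ^ j * (LINT x|LOmega. weak_deriv j u x * nderiv_on UNIV 1 \<phi> x)
      = (-1) ^ j * - (LINT x|LOmega. weak_deriv (Suc j) u x * \<phi> x)"
    by (simp add: nderiv_on_add del: One_nat_def) simp
  then show ?thesis by (subst (asm) mult_cancel_left) simp
qed

lemma weak_deriv_0_AE:
  assumes u: "u \<in> Hk k"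
  shows "AE x in LOmega. weak_deriv 0 u x = u x"
proof -
  have int: "integrable LOmega (weak_deriv 0 u)" "integrable LOmega u"
    using weak_deriv_spec(1)[OF u, of 0] u by (auto simp: Hk_def intro: L2_integrable)
  have "(LINT x|LOmega. (weak_deriv 0 u x - u x) * \<phi> x) = 0" if \<phi>: "test_function \<phi>" for \<phi>
    using weak_deriv_spec(2)[OF u, of 0] \<phi> integrable_mult_test[OF int(1) \<phi>]
      integrable_mult_test[OF int(2) \<phi>]
    by (simp add: has_weak_deriv_def nderiv_on_def left_diff_distrib)
  then have "AE x in LOmega. weak_deriv 0 u x - u x = 0"
    by (intro AE_zero_if_test_zero) (use int in auto)
  then show ?thesis by eventually_elim simp
qed

lemma const_L2: "(\<lambda>x. c) \<in> L2"
  by (simp add: L2_def)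

lemma L1_le_L2:
  assumes "f \<in> L2"
  shows "(LINT x|LOmega. \<bar>f x\<bar>) \<le> L2_norm f"
  using L2_Cauchy_Schwarz[OF assms const_L2[of 1]] by (simp add: L2_norm_def L2_inner_def)

lemma L2_norm_weak_deriv_le: "j \<le> k \<Longrightarrow> L2_norm (weak_deriv j u) \<le> Hk_norm k u"
  unfolding Hk_norm_def
  by (intro real_le_rsqrt) (rule member_le_sum, auto)

lemma Hk_norm_nonneg: "0 \<le> Hk_norm k u"
  by (simp add: Hk_norm_def sum_nonneg)

lemma prim_diff_le_L1:
  assumes h: "integrable LOmega h"
  shows "\<bar>prim h x - prim h y\<bar> \<le> (LINT t|LOmega. \<bar>h t\<bar>)"
proof -
  have *: "\<bar>prim h y - prim h x\<bar> \<le> (LINT t|LOmega. \<bar>h t\<bar>)" if "x \<le> y" for x y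
  proof -
    have "(LINT t|LOmega. indicator {x<..y} t * \<bar>h t\<bar>) \<le> (LINT t|LOmega. \<bar>h t\<bar>)"
      by (rule Bochner_Integration.integral_mono)
        (use h integrable_indicator_LOmega[OF integrable_abs[OF h], of "{x<..y}"] in
          \<open>auto simp: mult_left_le_one_le\<close>)
    then show ?thesis using prim_diff_le[OF h that] by linarith
  qed
  show ?thesis using *[of x y] *[of y x] by (cases "x \<le> y") (auto simp: abs_minus_commute)
qed

text \<open>One-dimensional Sobolev embedding: the value at \<open>x\<close> differs from the value
  at any \<open>y\<close> by at most the integral of \<open>\<bar>h\<bar>\<close>. Averaging over
  \<open>y\<close> in \<open>Omega\<close>, which has measure 1, replaces the value at
  \<open>y\<close> by the \<open>L2\<close> norm of \<open>f\<close>.\<close>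

lemma prim_representative_bound:
  assumes f: "f \<in> L2" and h: "h \<in> L2" and eq: "AE x in LOmega. f x = c + prim h x"
  shows "\<bar>c + prim h x\<bar> \<le> L2_norm f + L2_norm h"
proof -
  let ?H = "LINT t|LOmega. \<bar>h t\<bar>"
  have "\<bar>c + prim h x\<bar> = (LINT y|LOmega. \<bar>c + prim h x\<bar>)" by simp
  also have "\<dots> \<le> (LINT y|LOmega. \<bar>f y\<bar> + ?H)"
  proof (rule integral_mono_AE)
    show "AE y in LOmega. \<bar>c + prim h x\<bar> \<le> \<bar>f y\<bar> + ?H"
      using eq
    proof eventually_elim
      fix y assume "f y = c + prim h y"
      then show "\<bar>c + prim h x\<bar> \<le> \<bar>f y\<bar> + ?H"
        using prim_diff_le_L1[OF L2_integrable[OF h], of x y] by linarith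
    qed
  qed (use L2_integrable[OF f] in auto)
  also have "\<dots> = (LINT y|LOmega. \<bar>f y\<bar>) + ?H"
    using L2_integrable[OF f] by simp
  finally show ?thesis using L1_le_L2[OF f] L1_le_L2[OF h] by linarith
qed

text \<open>\<open>U j\<close> is the continuous representative of the \<open>j\<close>-th
  derivative and \<open>g\<close> the weak fourth derivative. Each order is a primitive of the next
  one, and is classically differentiable as long as the next one is continuous; at order 3 only the
  increment bound through \<open>g\<close> remains. The factor 2 collects the \<open>L2\<close>
  norms of orders \<open>j\<close> and \<open>j + 1\<close>.\<close>

lemma H4_representative:
  assumes u: "u \<in> Hk 4"
  obtains U :: "nat \<Rightarrow> real \<Rightarrow> real" and g :: "real \<Rightarrow> real" where
    "\<And>j x. j < 3 \<Longrightarrow> x \<in> Omega \<Longrightarrow> (U j has_real_derivative U (Suc j) x) (at x)"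
    "continuous_on Omega (U 3)"
    "\<And>x y. x \<le> y \<Longrightarrow> \<bar>U 3 y - U 3 x\<bar> \<le> (LINT t|LOmega. indicator {x<..y} t * \<bar>g t\<bar>)"
    "\<And>j x. j \<le> 3 \<Longrightarrow> \<bar>U j x\<bar> \<le> 2 * Hk_norm 4 u"
    "AE x in LOmega. u x = U 0 x" "AE x in LOmega. weak_deriv 2 u x = U 2 x"
    "g \<in> L2" "L2_norm g \<le> Hk_norm 4 u"
proof -
  let ?g = "\<lambda>j. weak_deriv j u"
  have gL2: "?g j \<in> L2" if "j \<le> 4" for j
    using weak_deriv_spec(1)[OF u that] .
  have gint: "integrable LOmega (?g j)" if "j \<le> 4" for j
    using L2_integrable[OF gL2[OF that]] .
  have "\<exists>c. AE x in LOmega. ?g j x = c + prim (?g (Suc j)) x" if "j < 4" for j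
    using weak_deriv_prim[OF gint gint weak_deriv_step[OF u], of j] that by force
  then obtain c where c: "\<And>j. j < 4 \<Longrightarrow> AE x in LOmega. ?g j x = c j + prim (?g (Suc j)) x"
    by metis
  define U where "U j x = c j + prim (?g (Suc j)) x" for j x
  have gU: "AE x in LOmega. ?g j x = U j x" if "j < 4" for j
    using c[OF that] by (simp add: U_def)
  have cont: "continuous_on Omega (U j)" if "j < 4" for j
    unfolding U_def using that by (intro continuous_intros prim_continuous gint) auto
  show ?thesis
  proof (rule that[of U "?g 4"])
    fix j :: nat and x :: real assume "j < 3" "x \<in> Omega"
    then have "(prim (?g (Suc j)) has_real_derivative U (Suc j) x) (at x)"
      by (intro prim_DERIV gint cont gU) auto
    then show "(U j has_real_derivative U (Suc j) x) (at x)"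
      unfolding U_def[of j, abs_def] by (auto intro!: derivative_eq_intros)
  next
    fix x y :: real assume "x \<le> y"
    then show "\<bar>U 3 y - U 3 x\<bar> \<le> (LINT t|LOmega. indicator {x<..y} t * \<bar>?g 4 t\<bar>)"
      using prim_diff_le[OF gint[of 4]] by (simp add: U_def)
  next
    fix j :: nat and x :: real assume "j \<le> 3"
    then show "\<bar>U j x\<bar> \<le> 2 * Hk_norm 4 u"
      using prim_representative_bound[OF gL2 gL2 c, of j x]
        L2_norm_weak_deriv_le[of j 4 u] L2_norm_weak_deriv_le[of "Suc j" 4 u]
      by (simp add: U_def)
  next
    show "AE x in LOmega. u x = U 0 x"
      using weak_deriv_0_AE[OF u] gU[of 0] by (auto elim: eventually_elim2)
  qed (use cont gU gL2 L2_norm_weak_deriv_le in auto)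
qed

subsection \<open>Regularity of the horizon function\<close>

text \<open>The third derivative of \<open>\<eta>\<close> may blow up like \<open>\<delta> / d\<close> at the boundary; only its product with \<open>\<eta>\<close>
  is controlled.\<close>

locale horizon =
  fixes \<eta> \<eta>1 \<eta>2 \<eta>3 :: "real \<Rightarrow> real" and K \<delta> :: real
  assumes \<delta>_pos: "0 < \<delta>" and K_ge_1: "1 \<le> K" and \<delta>_le_1: "\<delta> \<le> 1"
    and \<eta>_pos: "x \<in> Omega \<Longrightarrow> 0 < \<eta> x"
    and \<eta>_le_left: "x \<in> Omega \<Longrightarrow> \<eta> x \<le> x / 3"
    and \<eta>_le_right: "x \<in> Omega \<Longrightarrow> \<eta> x \<le> (1 - x) / 3"
    and \<eta>_le: "x \<in> Omega \<Longrightarrow> \<eta> x \<le> K * \<delta>"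
    and \<eta>_DERIV: "x \<in> Omega \<Longrightarrow> (\<eta> has_real_derivative \<eta>1 x) (at x)"
    and \<eta>1_DERIV: "x \<in> Omega \<Longrightarrow> (\<eta>1 has_real_derivative \<eta>2 x) (at x)"
    and \<eta>2_DERIV: "x \<in> Omega \<Longrightarrow> (\<eta>2 has_real_derivative \<eta>3 x) (at x)"
    and \<eta>1_le_third: "x \<in> Omega \<Longrightarrow> \<bar>\<eta>1 x\<bar> \<le> 1 / 3"
    and \<eta>1_le: "x \<in> Omega \<Longrightarrow> \<bar>\<eta>1 x\<bar> \<le> K * \<delta>"
    and \<eta>2_le: "x \<in> Omega \<Longrightarrow> \<bar>\<eta>2 x\<bar> \<le> K * \<delta>"
    and \<eta>3_le: "x \<in> Omega \<Longrightarrow> \<eta> x * \<bar>\<eta>3 x\<bar> \<le> K * \<delta>\<^sup>2"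

lemma bdist_eq: "x \<in> Omega \<Longrightarrow> bdist x = min x (1 - x)"
proof -
  assume x: "x \<in> Omega"
  have "frontier Omega = {0, 1::real}"
    by (auto simp: frontier_def)
  then show ?thesis
    using x unfolding bdist_def by (simp add: infdist_notempty cInf_eq_Min dist_real_def)
qed

lemma DERIV_within_Omega:
  "x \<in> Omega \<Longrightarrow> (f has_real_derivative c) (at x within Omega) \<Longrightarrow> (f has_real_derivative c) (at x)"
  by (simp add: at_within_open[of x Omega])

lemma real_MVT_bound:
  fixes f :: "real \<Rightarrow> real"
  assumes "\<And>x. a < x \<Longrightarrow> x < b \<Longrightarrow> (f has_real_derivative f' x) (at x)"
    and "continuous_on {a..b} f" and "\<And>x. a < x \<Longrightarrow> x < b \<Longrightarrow> \<bar>f' x\<bar> \<le> B" and "a \<le> b"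
  shows "\<bar>f b - f a\<bar> \<le> B * (b - a)"
proof (cases "a = b")
  case False
  then have "a < b" using assms(4) by simp
  then obtain z where z: "a < z" "z < b" "f b - f a = f' z * (b - a)"
    using mvt[OF \<open>a < b\<close> assms(2), of "\<lambda>x h. f' x * h"] assms(1)
    by (auto simp: has_field_derivative_def)
  then show ?thesis
    using assms(3)[of z] \<open>a < b\<close> by (simp add: abs_mult mult_right_mono)
qed simp

text \<open>The maximum in \<open>delta0\<close> dominates both 1 and \<open>\<kappa> 1\<close>. The
  second bound is what makes the horizon Lipschitz with constant 1/3.\<close>

lemma delta_star_less:
  assumes "\<delta> < delta_star Cq \<kappa>" "0 < \<delta>" "0 < \<kappa> 1"
  shows "\<delta> \<le> 1" "\<delta> * \<kappa> 1 \<le> 1 / 3"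
proof -
  let ?m = "Max {1, \<kappa> 1, Cq * \<kappa> 0 powr log 2 Cq}"
  have m: "1 \<le> ?m" "\<kappa> 1 \<le> ?m" by auto
  have "\<delta> < inverse (3 * ?m)"
    using assms(1) by (simp add: delta_star_def delta0_def)
  then have "\<delta> * (3 * ?m) < 1"
    using m by (simp add: inverse_eq_divide pos_less_divide_eq)
  moreover have "\<delta> * (3 * 1) \<le> \<delta> * (3 * ?m)" "\<delta> * (3 * \<kappa> 1) \<le> \<delta> * (3 * ?m)"
    using m assms(2) by (intro mult_left_mono; simp)+
  ultimately show "\<delta> \<le> 1" "\<delta> * \<kappa> 1 \<le> 1 / 3" by linarith+
qed

text \<open>The derivatives of \<open>q \<circ> lam\<close> do not depend on
  \<open>\<delta>\<close>, and multiplying them by \<open>\<delta>\<close> gives one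
  \<open>K\<close> for all admissible \<open>\<delta>\<close>. The bounds on \<open>lam''\<close>
  and \<open>lam'''\<close> grow like \<open>1/d\<close> and \<open>1/d\<^sup>2\<close>. One power
  of \<open>d\<close> is regained from \<open>q'(lam) \<le> lam\<close>, which bounds the second
  derivative; in the third a factor \<open>1/d\<close> is left over and is absorbed by
  \<open>\<eta> \<le> \<delta> * lam\<close>.\<close>

lemma smooth_localization_pair_horizon:
  assumes slp: "smooth_localization_pair q lam Cq \<kappa>"
  obtains K where "\<And>\<delta>. 0 < \<delta> \<Longrightarrow> \<delta> < delta_star Cq \<kappa> \<Longrightarrow>
    \<exists>\<eta>1 \<eta>2 \<eta>3. horizon (eta_delta q lam \<delta>) \<eta>1 \<eta>2 \<eta>3 K \<delta>"
proof -
  define Q where "Q j = nderiv_on {0..} j q" for j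
  define L where "L j = nderiv_on Omega j lam" for j
  have Q0: "Q 0 = q" and L0: "L 0 = lam" by (simp_all add: Q_def L_def nderiv_on_def)
  have lp: "localization_pair q lam Cq \<kappa>" using slp by (simp add: smooth_localization_pair_def)
  have \<kappa>: "1 \<le> \<kappa> 0" "0 < \<kappa> 1" "0 < \<kappa> 2" "0 < \<kappa> 3"
    using slp by (auto simp: smooth_localization_pair_def localization_pair_def)
  have q_pos: "0 < q r" "q r \<le> r" if "r > 0" for r
    using lp that by (auto simp: localization_pair_def)
  have q1: "Q 1 0 = 0" "0 \<le> r \<Longrightarrow> 0 \<le> Q 1 r" "0 \<le> r \<Longrightarrow> Q 1 r \<le> 1" for r
    using lp by (auto simp: localization_pair_def Q_def)
  have q2: "0 \<le> r \<Longrightarrow> 0 \<le> Q 2 r" "0 \<le> r \<Longrightarrow> Q 2 r \<le> 1" for r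
    using lp by (auto simp: localization_pair_def Q_def)
  have "bounded (Q 3 ` {0..})"
    using lp by (auto simp: localization_pair_def Q_def)
  then obtain B where B: "\<And>r. 0 \<le> r \<Longrightarrow> \<bar>Q 3 r\<bar> \<le> B"
    by (auto simp: bounded_iff)
  have B0: "0 \<le> B" using B[of 0] by simp
  have QD: "(Q j has_real_derivative Q (Suc j) r) (at r within {0..})" if "j < 3" "0 \<le> r" for j r
    using nderiv_on_has_derivative[of 3 "{0..}" q j r] lp that
    by (simp add: localization_pair_def Q_def)
  have QD': "(Q j has_real_derivative Q (Suc j) r) (at r)" if "j < 3" "0 < r" for j r
  proof -
    have "(Q j has_real_derivative Q (Suc j) r) (at r within {0<..})"
      using QD[OF that(1), of r] that(2) by (auto intro: DERIV_subset)
    then show ?thesis using that(2) by (simp add: at_within_open[of r "{0<..}"])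
  qed
  \<comment> \<open>The gain of one power of the distance: \<open>q'\<close> vanishes at 0 and
    \<open>q''\<close> is at most 1.\<close>
  have Q1_le: "Q 1 r \<le> r" if "0 \<le> r" for r
  proof -
    have "\<bar>Q 1 r - Q 1 0\<bar> \<le> 1 * (r - 0)"
    proof (rule real_MVT_bound[where f' = "Q 2"])
      show "continuous_on {0..r} (Q 1)"
      proof (rule DERIV_continuous_on)
        fix x assume "x \<in> {0..r}"
        then have "(Q 1 has_real_derivative Q (Suc 1) x) (at x within {0..})"
          by (intro QD) auto
        then show "(Q 1 has_real_derivative Q (Suc 1) x) (at x within {0..r})"
          by (rule DERIV_subset) auto
      qed
      show "(Q 1 has_real_derivative Q 2 x) (at x)" if "0 < x" for x
        using QD'[of 1 x] that by (simp add: numeral_2_eq_2)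
    qed (use q2 that in \<open>auto simp: abs_le_iff\<close>)
    then show ?thesis using q1(1) by simp
  qed
  have LD: "(L j has_real_derivative L (Suc j) x) (at x)" if "j < 3" "x \<in> Omega" for j x
    using nderiv_on_has_derivative[of 3 Omega lam j x] slp that
    by (intro DERIV_within_Omega) (auto simp: smooth_localization_pair_def L_def)
  have d: "0 < bdist x" "bdist x \<le> 1" "bdist x \<le> x" "bdist x \<le> 1 - x" if "x \<in> Omega" for x
    using bdist_eq[OF that] that by auto
  have lam: "bdist x / \<kappa> 0 \<le> lam x" "lam x \<le> \<kappa> 0 * bdist x" if "x \<in> Omega" for x
    using lp that by (auto simp: localization_pair_def)
  have lam_pos: "0 < lam x" if "x \<in> Omega" for x
  proof -
    have "0 < bdist x / \<kappa> 0" using d(1)[OF that] \<kappa> by simp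
    then show ?thesis using lam(1)[OF that] by linarith
  qed
  have L_le: "\<bar>L j x\<bar> \<le> \<kappa> j * bdist x powi (1 - int j)" if "j \<le> 2" "x \<in> Omega" for j x
    using lp that by (auto simp: localization_pair_def L_def)
  have L1: "\<bar>L 1 x\<bar> \<le> \<kappa> 1" if "x \<in> Omega" for x
    using L_le[of 1 x] that by simp
  have L2: "\<bar>L 2 x\<bar> \<le> \<kappa> 2 / bdist x" if "x \<in> Omega" for x
    using L_le[of 2 x] that by (simp add: power_int_minus field_simps)
  have L3: "\<bar>L 3 x\<bar> \<le> \<kappa> 3 / (bdist x)\<^sup>2" if "x \<in> Omega" for x
    using slp that by (simp add: smooth_localization_pair_def L_def power_int_minus field_simps)
  \<comment> \<open>One constant for four estimates: its summands bound
    \<open>q \<circ> lam\<close>, its first and second derivatives, and the product of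
    \<open>q \<circ> lam\<close> with the third.\<close>
  define K where "K = 1 + \<kappa> 0 + \<kappa> 1 + (\<kappa> 1)\<^sup>2 + \<kappa> 0 * \<kappa> 2
    + (\<kappa> 0 * (B * \<kappa> 1 ^ 3) + 3 * \<kappa> 0 * \<kappa> 1 * \<kappa> 2 + (\<kappa> 0)\<^sup>2 * \<kappa> 3)"
  have K_terms: "0 \<le> \<kappa> 0" "0 \<le> \<kappa> 1" "0 \<le> (\<kappa> 1)\<^sup>2" "0 \<le> \<kappa> 0 * \<kappa> 2" "0 \<le> \<kappa> 0 * (B * \<kappa> 1 ^ 3)"
    "0 \<le> 3 * \<kappa> 0 * \<kappa> 1 * \<kappa> 2" "0 \<le> (\<kappa> 0)\<^sup>2 * \<kappa> 3"
    using \<kappa> B0 by auto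
  have K_ge: "1 \<le> K" "\<kappa> 0 \<le> K" "\<kappa> 1 \<le> K" "(\<kappa> 1)\<^sup>2 + \<kappa> 0 * \<kappa> 2 \<le> K"
    "\<kappa> 0 * (B * \<kappa> 1 ^ 3) + 3 * \<kappa> 0 * \<kappa> 1 * \<kappa> 2 + (\<kappa> 0)\<^sup>2 * \<kappa> 3 \<le> K"
    using K_terms unfolding K_def by linarith+
  define E1 where "E1 x = Q 1 (lam x) * L 1 x" for x
  define E2 where "E2 x = Q 2 (lam x) * (L 1 x)\<^sup>2 + Q 1 (lam x) * L 2 x" for x
  define E3 where "E3 x = Q 3 (lam x) * L 1 x ^ 3 + 3 * Q 2 (lam x) * L 1 x * L 2 x
    + Q 1 (lam x) * L 3 x" for x
  have QlD: "((\<lambda>x. Q j (lam x)) has_real_derivative Q (Suc j) (lam x) * L 1 x) (at x)"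
    if "j < 3" "x \<in> Omega" for j x
  proof -
    have "(lam has_real_derivative L 1 x) (at x)" using LD[of 0 x] that by (simp add: L0)
    from DERIV_chain2[OF QD'[OF that(1) lam_pos[OF that(2)]] this] show ?thesis .
  qed
  have E1D: "((\<lambda>x. q (lam x)) has_real_derivative E1 x) (at x)" if "x \<in> Omega" for x
    using QlD[of 0 x] that by (simp add: Q0 E1_def)
  have E2D: "(E1 has_real_derivative E2 x) (at x)" if "x \<in> Omega" for x
    unfolding E1_def[abs_def] E2_def
    using QlD[of 1 x] LD[of 1 x] that
    by (auto intro!: derivative_eq_intros simp: numeral_2_eq_2 algebra_simps power2_eq_square)
  have E3D: "(E2 has_real_derivative E3 x) (at x)" if "x \<in> Omega" for x
    unfolding E2_def[abs_def] E3_def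
    using QlD[of 1 x] QlD[of 2 x] LD[of 1 x] LD[of 2 x] that
    by (auto intro!: derivative_eq_intros
        simp: numeral_2_eq_2 numeral_3_eq_3 algebra_simps power2_eq_square power3_eq_cube)
  have lamd: "lam x * (\<kappa> 2 / bdist x) \<le> \<kappa> 0 * \<kappa> 2" if "x \<in> Omega" for x
  proof -
    have "lam x * (\<kappa> 2 / bdist x) \<le> (\<kappa> 0 * bdist x) * (\<kappa> 2 / bdist x)"
      using lam[OF that] \<kappa> d[OF that] by (intro mult_right_mono) auto
    then show ?thesis using d[OF that] by simp
  qed
  have lam_le: "lam x \<le> \<kappa> 0" if "x \<in> Omega" for x
  proof -
    have "\<kappa> 0 * bdist x \<le> \<kappa> 0" using d[OF that] \<kappa> by (intro mult_left_le) auto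
    then show ?thesis using lam(2)[OF that] by linarith
  qed
  have E1_le: "\<bar>E1 x\<bar> \<le> \<kappa> 1" if "x \<in> Omega" for x
  proof -
    have "\<bar>E1 x\<bar> \<le> 1 * \<kappa> 1"
      unfolding E1_def abs_mult
      using q1(2,3)[of "lam x"] lam_pos[OF that] L1[OF that] by (intro mult_mono) auto
    then show ?thesis by simp
  qed
  have Q1L2: "\<bar>Q 1 (lam x) * L 2 x\<bar> \<le> \<kappa> 0 * \<kappa> 2" if "x \<in> Omega" for x
  proof -
    have "\<bar>Q 1 (lam x) * L 2 x\<bar> \<le> lam x * (\<kappa> 2 / bdist x)"
      unfolding abs_mult
      using q1(2,3)[of "lam x"] Q1_le[of "lam x"] lam_pos[OF that] L2[OF that] by (intro mult_mono) auto
    then show ?thesis using lamd[OF that] by linarith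
  qed
  have E2_le: "\<bar>E2 x\<bar> \<le> (\<kappa> 1)\<^sup>2 + \<kappa> 0 * \<kappa> 2" if "x \<in> Omega" for x
  proof -
    have "(L 1 x)\<^sup>2 \<le> (\<kappa> 1)\<^sup>2"
      using power_mono[OF L1[OF that], of 2] by simp
    then have "\<bar>Q 2 (lam x) * (L 1 x)\<^sup>2\<bar> \<le> 1 * (\<kappa> 1)\<^sup>2"
      unfolding abs_mult using q2[of "lam x"] lam_pos[OF that] by (intro mult_mono) auto
    then show ?thesis unfolding E2_def using Q1L2[OF that] by linarith
  qed
  have E3_le: "q (lam x) * \<bar>E3 x\<bar> \<le> K" if "x \<in> Omega" for x
  proof -
    have l: "0 < lam x" by (rule lam_pos[OF that])
    have t1: "lam x * \<bar>Q 3 (lam x) * L 1 x ^ 3\<bar> \<le> \<kappa> 0 * (B * \<kappa> 1 ^ 3)"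
      unfolding abs_mult power_abs
      using lam_le[OF that] B[of "lam x"] l L1[OF that] B0
      by (intro mult_mono power_mono) (auto simp: mult_nonneg_nonneg)
    have t2: "lam x * \<bar>3 * Q 2 (lam x) * L 1 x * L 2 x\<bar> \<le> 3 * \<kappa> 0 * \<kappa> 1 * \<kappa> 2"
    proof -
      have "\<bar>3 * Q 2 (lam x) * L 1 x * L 2 x\<bar> \<le> 3 * 1 * \<kappa> 1 * (\<kappa> 2 / bdist x)"
        unfolding abs_mult using q2[of "lam x"] l L1[OF that] L2[OF that] \<kappa>
        by (intro mult_mono) auto
      then have "lam x * \<bar>3 * Q 2 (lam x) * L 1 x * L 2 x\<bar> \<le> lam x * (3 * 1 * \<kappa> 1 * (\<kappa> 2 / bdist x))"
        using l by (intro mult_left_mono) auto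
      also have "\<dots> = 3 * \<kappa> 1 * (lam x * (\<kappa> 2 / bdist x))" by simp
      also have "\<dots> \<le> 3 * \<kappa> 1 * (\<kappa> 0 * \<kappa> 2)"
        using lamd[OF that] \<kappa> by (intro mult_left_mono) auto
      finally show ?thesis by (simp add: mult_ac)
    qed
    have t3: "lam x * \<bar>Q 1 (lam x) * L 3 x\<bar> \<le> (\<kappa> 0)\<^sup>2 * \<kappa> 3"
    proof -
      have "\<bar>Q 1 (lam x) * L 3 x\<bar> \<le> (\<kappa> 0 * bdist x) * (\<kappa> 3 / (bdist x)\<^sup>2)"
        unfolding abs_mult using q1(2,3)[of "lam x"] Q1_le[of "lam x"] l L3[OF that] lam(2)[OF that] \<kappa> d[OF that]
        by (intro mult_mono) auto
      then have "lam x * \<bar>Q 1 (lam x) * L 3 x\<bar> \<le> (\<kappa> 0 * bdist x) * ((\<kappa> 0 * bdist x) * (\<kappa> 3 / (bdist x)\<^sup>2))"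
        using l lam(2)[OF that] \<kappa> d[OF that] by (intro mult_mono) auto
      also have "\<dots> = (\<kappa> 0)\<^sup>2 * \<kappa> 3"
        using d(1)[OF that] by (simp add: power2_eq_square)
      finally show ?thesis .
    qed
    have "q (lam x) * \<bar>E3 x\<bar> \<le> lam x * \<bar>E3 x\<bar>"
      using q_pos[OF l] by (intro mult_right_mono) auto
    also have "\<dots> \<le> lam x * (\<bar>Q 3 (lam x) * L 1 x ^ 3\<bar> + \<bar>3 * Q 2 (lam x) * L 1 x * L 2 x\<bar>
        + \<bar>Q 1 (lam x) * L 3 x\<bar>)"
      unfolding E3_def using l by (intro mult_left_mono) linarith+
    finally show ?thesis using t1 t2 t3 K_ge(5) by (simp add: distrib_left)
  qed
  have q_le: "q (lam x) \<le> \<kappa> 0 * bdist x" if "x \<in> Omega" for x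
    using q_pos[OF lam_pos[OF that]] lam(2)[OF that] by linarith
  show ?thesis
  proof (rule that)
    fix \<delta> assume \<delta>: "0 < \<delta>" "\<delta> < delta_star Cq \<kappa>"
    have \<delta>1: "\<delta> \<le> 1" and \<delta>3: "\<delta> * \<kappa> 1 \<le> 1 / 3"
      using delta_star_less[OF \<delta>(2,1) \<kappa>(2)] by auto
    let ?e = "eta_delta q lam \<delta>"
    have e_eq: "?e x = \<delta> * q (lam x)" for x by (simp add: eta_delta_def)
    have eD: "(?e has_real_derivative \<delta> * E1 x) (at x)" if "x \<in> Omega" for x
      unfolding eta_delta_def[abs_def] using E1D[OF that] by (rule DERIV_cmult)
    have third: "\<bar>\<delta> * E1 x\<bar> \<le> 1 / 3" if "x \<in> Omega" for x
    proof -
      have "\<bar>\<delta> * E1 x\<bar> \<le> \<delta> * \<kappa> 1"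
        unfolding abs_mult using E1_le[OF that] \<delta> by (intro mult_mono) auto
      then show ?thesis using \<delta>3 by linarith
    qed
    have lip: "\<bar>?e y - ?e x\<bar> \<le> 1 / 3 * (y - x)" if "x \<in> Omega" "y \<in> Omega" "x \<le> y" for x y
    proof (rule real_MVT_bound[where f' = "\<lambda>x. \<delta> * E1 x"])
      show "continuous_on {x..y} ?e"
        using that by (intro continuous_at_imp_continuous_on ballI DERIV_isCont[OF eD]) auto
    qed (use that eD third in auto)
    have e_small: "?e x \<le> \<kappa> 0 * bdist x" if "x \<in> Omega" for x
    proof -
      have "\<delta> * q (lam x) \<le> 1 * (\<kappa> 0 * bdist x)"
        using \<delta>1 \<delta> q_le[OF that] q_pos[OF lam_pos[OF that]] by (intro mult_mono) auto
      then show ?thesis by (simp add: e_eq)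
    qed
    \<comment> \<open>The end point itself is avoided: at some \<open>t\<close> close to 0 the
      horizon is below \<open>\<epsilon>\<close>, being at most \<open>\<kappa> 0 * bdist t\<close>,
      and from \<open>t\<close> to \<open>x\<close> it grows with slope at most 1/3.\<close>
    have e_left: "?e x \<le> x / 3" if x: "x \<in> Omega" for x
    proof (rule field_le_epsilon)
      fix \<epsilon> :: real assume "0 < \<epsilon>"
      define t where "t = min (x / 2) (\<epsilon> / \<kappa> 0)"
      have t: "0 < t" "t < x" "t \<in> Omega" "t \<le> \<epsilon> / \<kappa> 0"
        using x \<open>0 < \<epsilon>\<close> \<kappa> by (auto simp: t_def)
      have "\<kappa> 0 * bdist t \<le> \<kappa> 0 * (\<epsilon> / \<kappa> 0)"
        using d(3)[OF t(3)] t(4) \<kappa> by (intro mult_left_mono) auto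
      then have "?e t \<le> \<epsilon>" using e_small[OF t(3)] \<kappa> by simp
      moreover have "\<bar>?e x - ?e t\<bar> \<le> 1 / 3 * (x - t)" using lip[OF t(3) x] t by simp
      moreover have "1 / 3 * (x - t) \<le> x / 3" using t(1) by simp
      ultimately show "?e x \<le> x / 3 + \<epsilon>" by linarith
    qed
    have e_right: "?e x \<le> (1 - x) / 3" if x: "x \<in> Omega" for x
    proof (rule field_le_epsilon)
      fix \<epsilon> :: real assume "0 < \<epsilon>"
      define s where "s = min ((1 - x) / 2) (\<epsilon> / \<kappa> 0)"
      define t where "t = 1 - s"
      have s: "0 < s" "s \<le> \<epsilon> / \<kappa> 0"
        using x \<open>0 < \<epsilon>\<close> \<kappa> by (auto simp: s_def)
      have "s \<le> (1 - x) / 2" unfolding s_def by (rule min.cobounded1)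
      then have t: "x < t" "t \<in> Omega" using x s by (auto simp: t_def)
      have "\<kappa> 0 * bdist t \<le> \<kappa> 0 * (\<epsilon> / \<kappa> 0)"
        using d(4)[OF t(2)] s(2) \<kappa> by (intro mult_left_mono) (auto simp: t_def)
      then have "?e t \<le> \<epsilon>" using e_small[OF t(2)] \<kappa> by simp
      moreover have "\<bar>?e t - ?e x\<bar> \<le> 1 / 3 * (t - x)" using lip[OF x t(2)] t by simp
      moreover have "1 / 3 * (t - x) \<le> (1 - x) / 3" using t by simp
      ultimately show "?e x \<le> (1 - x) / 3 + \<epsilon>" by linarith
    qed
    have mul: "\<delta> * a \<le> K * \<delta>" if "a \<le> K" for a
      using that \<delta> by (simp add: mult.commute)
    have "horizon ?e (\<lambda>x. \<delta> * E1 x) (\<lambda>x. \<delta> * E2 x) (\<lambda>x. \<delta> * E3 x) K \<delta>"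
    proof
      fix x :: real assume x: "x \<in> Omega"
      show "0 < ?e x" using \<delta> q_pos[OF lam_pos[OF x]] by (simp add: e_eq)
      show "?e x \<le> K * \<delta>"
        unfolding e_eq using q_pos[OF lam_pos[OF x]] lam_le[OF x] K_ge(2) by (intro mul) linarith
      show "\<bar>\<delta> * E1 x\<bar> \<le> K * \<delta>"
        using mul[of "\<bar>E1 x\<bar>"] E1_le[OF x] K_ge \<delta> by (simp add: abs_mult)
      show "\<bar>\<delta> * E2 x\<bar> \<le> K * \<delta>"
        using mul[of "\<bar>E2 x\<bar>"] E2_le[OF x] K_ge \<delta> by (simp add: abs_mult)
      show "?e x * \<bar>\<delta> * E3 x\<bar> \<le> K * \<delta>\<^sup>2"
        using mult_left_mono[OF E3_le[OF x], of "\<delta>\<^sup>2"] \<delta>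
        by (simp add: e_eq abs_mult power2_eq_square mult_ac)
    qed (use \<delta> \<delta>1 K_ge e_left e_right eD third DERIV_cmult[OF E2D] DERIV_cmult[OF E3D] in auto)
    then show "\<exists>\<eta>1 \<eta>2 \<eta>3. horizon ?e \<eta>1 \<eta>2 \<eta>3 K \<delta>" by blast
  qed
qed

subsection \<open>Pointwise consistency of the slices\<close>

lemma DERIV_bound_interval:
  fixes f :: "real \<Rightarrow> real"
  assumes "\<And>x. x \<in> {p..r} \<Longrightarrow> (f has_real_derivative f' x) (at x)"
    and "\<And>x. x \<in> {p..r} \<Longrightarrow> \<bar>f' x\<bar> \<le> B" and "a \<in> {p..r}" "x \<in> {p..r}"
  shows "\<bar>f x - f a\<bar> \<le> B * \<bar>x - a\<bar>"
proof -
  have *: "\<bar>f y - f b\<bar> \<le> B * (y - b)" if "b \<le> y" "b \<in> {p..r}" "y \<in> {p..r}" for b y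
  proof (rule real_MVT_bound[where f' = f'])
    show "continuous_on {b..y} f"
      using that by (intro continuous_at_imp_continuous_on ballI DERIV_isCont[OF assms(1)]) auto
  qed (use that assms in auto)
  show ?thesis
  proof (cases "a \<le> x")
    case True
    then show ?thesis using *[of a x] assms by simp
  next
    case False
    then show ?thesis using *[of x a] assms by (simp add: abs_minus_commute)
  qed
qed

text \<open>Each remainder has the remainder of next lower order as its derivative, so every mean
  value estimate contributes one factor \<open>r - p\<close>. Sharp factorial constants are given
  up.\<close>

lemma taylor_bounds:
  fixes f0 f1 f2 f3 :: "real \<Rightarrow> real"
  assumes f0: "\<And>x. x \<in> {p..r} \<Longrightarrow> (f0 has_real_derivative f1 x) (at x)"
    and f1: "\<And>x. x \<in> {p..r} \<Longrightarrow> (f1 has_real_derivative f2 x) (at x)"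
    and f2: "\<And>x. x \<in> {p..r} \<Longrightarrow> (f2 has_real_derivative f3 x) (at x)"
    and B: "\<And>x. x \<in> {p..r} \<Longrightarrow> \<bar>f3 x\<bar> \<le> B" and a: "a \<in> {p..r}" and x: "x \<in> {p..r}"
  shows "\<bar>f1 x - f1 a - (x - a) * f2 a\<bar> \<le> B * (r - p)\<^sup>2"
    and "\<bar>f0 x - f0 a - (x - a) * f1 a - (x - a)\<^sup>2 / 2 * f2 a\<bar> \<le> B * (r - p) ^ 3"
proof -
  let ?h = "r - p"
  have B0: "0 \<le> B" using B[OF a] by linarith
  have h: "\<bar>y - a\<bar> \<le> ?h" if "y \<in> {p..r}" for y using that a by auto
  have b2: "\<bar>f2 y - f2 a\<bar> \<le> B * ?h" if "y \<in> {p..r}" for y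
    using DERIV_bound_interval[OF f2 B a that] mult_left_mono[OF h[OF that] B0] by linarith
  have b1: "\<bar>f1 y - f1 a - (y - a) * f2 a\<bar> \<le> B * ?h\<^sup>2" if y: "y \<in> {p..r}" for y
  proof -
    have "\<bar>(f1 y - y * f2 a) - (f1 a - a * f2 a)\<bar> \<le> (B * ?h) * \<bar>y - a\<bar>"
      by (rule DERIV_bound_interval[where f' = "\<lambda>y. f2 y - f2 a", OF _ b2 a y])
        (auto intro!: derivative_eq_intros f1)
    also have "\<dots> \<le> (B * ?h) * ?h"
      using h[OF y] B0 a by (intro mult_left_mono) auto
    finally show ?thesis by (simp add: algebra_simps power2_eq_square)
  qed
  show "\<bar>f1 x - f1 a - (x - a) * f2 a\<bar> \<le> B * ?h\<^sup>2" by (rule b1[OF x])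
  have "\<bar>(f0 x - x * f1 a - (x - a)\<^sup>2 / 2 * f2 a) - (f0 a - a * f1 a - (a - a)\<^sup>2 / 2 * f2 a)\<bar>
      \<le> (B * ?h\<^sup>2) * \<bar>x - a\<bar>"
    by (rule DERIV_bound_interval[where f' = "\<lambda>y. f1 y - f1 a - (y - a) * f2 a", OF _ b1 a x])
      (auto intro!: derivative_eq_intros f0)
  also have "\<dots> \<le> (B * ?h\<^sup>2) * ?h"
    using h[OF x] B0 by (intro mult_left_mono) auto
  finally show "\<bar>f0 x - f0 a - (x - a) * f1 a - (x - a)\<^sup>2 / 2 * f2 a\<bar> \<le> B * ?h ^ 3"
    by (simp add: algebra_simps power2_eq_square power3_eq_cube)
qed

text \<open>Subtracting the cubic term at \<open>a\<close> from \<open>f0\<close> leaves a function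
  with third derivative \<open>f3 - f3 a\<close>. This trades a fourth derivative for the
  oscillation of the third, which is what is available for \<open>u\<close> in
  \<open>Hk 4\<close>.\<close>

lemma taylor3_bound:
  fixes f0 f1 f2 f3 :: "real \<Rightarrow> real"
  assumes f0: "\<And>x. x \<in> {p..r} \<Longrightarrow> (f0 has_real_derivative f1 x) (at x)"
    and f1: "\<And>x. x \<in> {p..r} \<Longrightarrow> (f1 has_real_derivative f2 x) (at x)"
    and f2: "\<And>x. x \<in> {p..r} \<Longrightarrow> (f2 has_real_derivative f3 x) (at x)"
    and B: "\<And>x. x \<in> {p..r} \<Longrightarrow> \<bar>f3 x - f3 a\<bar> \<le> B" and a: "a \<in> {p..r}" and x: "x \<in> {p..r}"
  shows "\<bar>f0 x - f0 a - (x - a) * f1 a - (x - a)\<^sup>2 / 2 * f2 a - (x - a) ^ 3 / 6 * f3 a\<bar> \<le> B * (r - p) ^ 3"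
proof -
  define g0 where "g0 x = f0 x - (x - a) ^ 3 / 6 * f3 a" for x
  define g1 where "g1 x = f1 x - (x - a)\<^sup>2 / 2 * f3 a" for x
  define g2 where "g2 x = f2 x - (x - a) * f3 a" for x
  have "\<bar>g0 x - g0 a - (x - a) * g1 a - (x - a)\<^sup>2 / 2 * g2 a\<bar> \<le> B * (r - p) ^ 3"
  proof (rule taylor_bounds(2)[OF _ _ _ B a x])
    fix y assume y: "y \<in> {p..r}"
    show "(g0 has_real_derivative g1 y) (at y)"
      unfolding g0_def[abs_def] g1_def using f0[OF y]
      by (auto intro!: derivative_eq_intros simp: power2_eq_square field_simps)
    show "(g1 has_real_derivative g2 y) (at y)"
      unfolding g1_def[abs_def] g2_def using f1[OF y]
      by (auto intro!: derivative_eq_intros simp: field_simps)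
    show "(g2 has_real_derivative f3 y - f3 a) (at y)"
      unfolding g2_def[abs_def] using f2[OF y]
      by (auto intro!: derivative_eq_intros)
  qed
  then show ?thesis by (simp add: g0_def g1_def g2_def algebra_simps)
qed

context horizon
begin

lemma K\<delta>_pos: "0 < K * \<delta>"
  using K_ge_1 \<delta>_pos by simp

lemma \<eta>_lipschitz:
  assumes "x \<in> Omega" "y \<in> Omega"
  shows "\<bar>\<eta> y - \<eta> x\<bar> \<le> \<bar>y - x\<bar> / 3" "\<bar>\<eta> y - \<eta> x\<bar> \<le> K * \<delta> * \<bar>y - x\<bar>"
    "\<bar>\<eta>1 y - \<eta>1 x\<bar> \<le> K * \<delta> * \<bar>y - x\<bar>"
proof -
  have sub: "t \<in> Omega" if "t \<in> {min x y..max x y}" for t using that assms by auto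
  show "\<bar>\<eta> y - \<eta> x\<bar> \<le> \<bar>y - x\<bar> / 3"
    using DERIV_bound_interval[of "min x y" "max x y" \<eta> \<eta>1 "1/3" x y] sub \<eta>_DERIV \<eta>1_le_third by simp
  show "\<bar>\<eta> y - \<eta> x\<bar> \<le> K * \<delta> * \<bar>y - x\<bar>"
    using DERIV_bound_interval[of "min x y" "max x y" \<eta> \<eta>1 "K * \<delta>" x y] sub \<eta>_DERIV \<eta>1_le by simp
  show "\<bar>\<eta>1 y - \<eta>1 x\<bar> \<le> K * \<delta> * \<bar>y - x\<bar>"
    using DERIV_bound_interval[of "min x y" "max x y" \<eta>1 \<eta>2 "K * \<delta>" x y] sub \<eta>1_DERIV \<eta>2_le by simp
qed

lemma near_in_Omega:
  assumes "x \<in> Omega" "\<bar>y - x\<bar> \<le> \<eta> x"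
  shows "y \<in> Omega"
  using assms \<eta>_le_left[OF assms(1)] \<eta>_le_right[OF assms(1)] by auto

text \<open>Because the slope of \<open>\<eta>\<close> is at most 1/3, it changes little over its
  own radius. This allows expansions around \<open>y\<close> to be measured at \<open>x\<close>, and
  the roles of centre and point to be exchanged in \<open>avg_L2\<close>.\<close>

lemma \<eta>_comparable:
  assumes "x \<in> Omega" "\<bar>y - x\<bar> \<le> \<eta> x"
  shows "2 / 3 * \<eta> x \<le> \<eta> y" "\<eta> y \<le> 4 / 3 * \<eta> x"
proof -
  have "\<bar>\<eta> y - \<eta> x\<bar> \<le> \<eta> x / 3"
    by (rule order_trans[OF \<eta>_lipschitz(1)[OF assms(1) near_in_Omega[OF assms]]]) (use assms in simp)
  then show "2 / 3 * \<eta> x \<le> \<eta> y" "\<eta> y \<le> 4 / 3 * \<eta> x" by linarith+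
qed

lemma shift_near: "x \<in> Omega \<Longrightarrow> \<bar>s\<bar> \<le> 1 \<Longrightarrow> \<bar>(x + s * \<eta> x) - x\<bar> \<le> \<eta> x"
  using \<eta>_pos[of x] by (auto simp: abs_mult mult_left_le_one_le)

end

text \<open>The data supplied by \<open>H4_representative\<close>, with \<open>g\<close> in the role
  of the fourth derivative and one constant \<open>M\<close> for all bounds. No derivative of
  \<open>U 3\<close> is assumed: its increments are controlled by \<open>g\<close>.\<close>

locale horizon_H4 = horizon +
  fixes U :: "nat \<Rightarrow> real \<Rightarrow> real" and g :: "real \<Rightarrow> real" and M :: real
  assumes U_DERIV: "j < 3 \<Longrightarrow> x \<in> Omega \<Longrightarrow> (U j has_real_derivative U (Suc j) x) (at x)"
    and U3_cont: "continuous_on Omega (U 3)"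
    and U3_diff: "x \<le> y \<Longrightarrow> \<bar>U 3 y - U 3 x\<bar> \<le> (LINT t|LOmega. indicator {x<..y} t * \<bar>g t\<bar>)"
    and U_le: "j \<le> 3 \<Longrightarrow> \<bar>U j x\<bar> \<le> M"
    and g_L2: "g \<in> L2" and g_le: "L2_norm g \<le> M"
begin

text \<open>Up to a factor 2, the mean of \<open>\<bar>g\<bar>\<close> over the horizon ball of
  \<open>x\<close>: the substitute for a pointwise bound on the fourth derivative of
  \<open>u\<close>.\<close>

definition avg :: "real \<Rightarrow> real" where
  "avg x = (LINT t|LOmega. indicator {x - \<eta> x..x + \<eta> x} t * \<bar>g t\<bar>) / \<eta> x"

definition quot :: "real \<Rightarrow> real \<Rightarrow> real" where
  "quot s x = (U 0 x - U 0 (x + s * \<eta> x)) / (\<eta> x)\<^sup>2"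

text \<open>The Taylor polynomial in \<open>s\<close> of \<open>\<Sum>\<^sub>k (-s)\<^sup>k / k! (\<eta>\<^sup>k quot s)\<^sup>(\<^sup>k\<^sup>)\<close>, the density obtained by
  formally expanding \<open>v (x + s \<eta> x)\<close> around \<open>x\<close> and integrating by parts.\<close>

definition adj :: "real \<Rightarrow> real \<Rightarrow> real" where
  "adj s y = - s * U 1 y / \<eta> y + s\<^sup>2 * U 2 y / 2
     - s ^ 3 * (\<eta> y * U 3 y / 6 + \<eta>1 y * U 2 y / 2 + \<eta>2 y * U 1 y / 2)"

lemma M_nonneg: "0 \<le> M"
  using g_le L2_norm_nonneg[of g] by linarith

lemma avg_nonneg: "x \<in> Omega \<Longrightarrow> 0 \<le> avg x"
  unfolding avg_def using \<eta>_pos[of x]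
  by (intro divide_nonneg_pos Bochner_Integration.integral_nonneg) auto

lemma U3_diff_avg:
  assumes x: "x \<in> Omega" and "\<bar>y - x\<bar> \<le> \<eta> x" "\<bar>y' - x\<bar> \<le> \<eta> x"
  shows "\<bar>U 3 y - U 3 y'\<bar> \<le> \<eta> x * avg x"
proof -
  have int: "integrable LOmega (\<lambda>t. \<bar>g t\<bar>)" using L2_integrable[OF g_L2] by simp
  have *: "\<bar>U 3 b - U 3 a\<bar> \<le> \<eta> x * avg x"
    if "a \<le> b" "\<bar>a - x\<bar> \<le> \<eta> x" "\<bar>b - x\<bar> \<le> \<eta> x" for a b
  proof -
    have "(LINT t|LOmega. indicator {a<..b} t * \<bar>g t\<bar>)
        \<le> (LINT t|LOmega. indicator {x - \<eta> x..x + \<eta> x} t * \<bar>g t\<bar>)"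
      by (intro Bochner_Integration.integral_mono integrable_indicator_LOmega[OF int])
        (use that in \<open>auto simp: indicator_def\<close>)
    also have "\<dots> = \<eta> x * avg x" using \<eta>_pos[OF x] by (simp add: avg_def)
    finally show ?thesis using U3_diff[OF that(1)] by linarith
  qed
  show ?thesis using *[of y' y] *[of y y'] assms by (cases "y' \<le> y") (auto simp: abs_minus_commute)
qed

lemma U_DERIV': "x \<in> Omega \<Longrightarrow> (U 0 has_real_derivative U 1 x) (at x)"
  "x \<in> Omega \<Longrightarrow> (U 1 has_real_derivative U 2 x) (at x)"
  "x \<in> Omega \<Longrightarrow> (U 2 has_real_derivative U 3 x) (at x)"
  using U_DERIV[of 0 x] U_DERIV[of 1 x] U_DERIV[of 2 x] by (simp_all add: numeral_2_eq_2 numeral_3_eq_3)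

text \<open>Both centres occur: \<open>x\<close> for the even part of \<open>quot\<close>, and the
  shifted point for the comparison with \<open>adj\<close>, which is evaluated there. In either case
  the segment lies in the horizon ball of \<open>x\<close>, so the remainder is measured by
  \<open>avg x\<close>.\<close>

lemma U_taylor:
  assumes x: "x \<in> Omega" and y: "\<bar>y - x\<bar> \<le> \<eta> x" and ab: "a = x \<and> b = y \<or> a = y \<and> b = x"
  shows "\<bar>U 0 b - U 0 a - (b - a) * U 1 a - (b - a)\<^sup>2 / 2 * U 2 a - (b - a) ^ 3 / 6 * U 3 a\<bar>
    \<le> \<eta> x * avg x * \<bar>y - x\<bar> ^ 3"
proof -
  let ?p = "min x y" and ?r = "max x y"
  have near: "\<bar>t - x\<bar> \<le> \<eta> x" if "t \<in> {?p..?r}" for t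
    using that y by (auto simp: min_def max_def split: if_splits)
  have "\<bar>U 0 b - U 0 a - (b - a) * U 1 a - (b - a)\<^sup>2 / 2 * U 2 a - (b - a) ^ 3 / 6 * U 3 a\<bar>
      \<le> \<eta> x * avg x * (?r - ?p) ^ 3"
  proof (rule taylor3_bound)
    fix t assume t: "t \<in> {?p..?r}"
    show "\<bar>U 3 t - U 3 a\<bar> \<le> \<eta> x * avg x"
      using U3_diff_avg[OF x near[OF t]] near[of a] ab by auto
  qed (use ab near_in_Omega[OF x near] U_DERIV' in auto)
  moreover have "?r - ?p = \<bar>y - x\<bar>" by auto
  ultimately show ?thesis by simp
qed

text \<open>The linear and the cubic Taylor terms are odd in \<open>s\<close> and cancel, and with
  them the singular term of order \<open>1/\<eta>\<close>. What is left is a fourth-order remainder,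
  of size \<open>\<eta>\<^sup>4\<close> before the division by
  \<open>\<eta>\<^sup>2\<close>.\<close>

lemma quot_even_bound:
  assumes x: "x \<in> Omega" and s: "\<bar>s\<bar> \<le> 1"
  shows "\<bar>quot s x + quot (- s) x + s\<^sup>2 * U 2 x\<bar> \<le> 2 * (K * \<delta>)\<^sup>2 * s\<^sup>2 * avg x"
proof -
  define E where "E = \<eta> x"
  have E: "0 < E" "E \<le> K * \<delta>" using \<eta>_pos[OF x] \<eta>_le[OF x] by (auto simp: E_def)
  define R where "R t = U 0 (x + t * E) - U 0 x - t * E * U 1 x - (t * E)\<^sup>2 / 2 * U 2 x
    - (t * E) ^ 3 / 6 * U 3 x" for t
  have R: "\<bar>R t\<bar> \<le> E ^ 2 * (E ^ 2 * s\<^sup>2 * avg x)" if "\<bar>t\<bar> = \<bar>s\<bar>" for t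
  proof -
    have "\<bar>R t\<bar> \<le> E * avg x * \<bar>t * E\<bar> ^ 3"
      using U_taylor[OF x shift_near[OF x, of t], of x "x + t * \<eta> x"] that s
      by (simp add: R_def E_def)
    also have "\<dots> = E ^ 2 * (E ^ 2 * \<bar>s\<bar> ^ 3 * avg x)"
      using that E by (simp add: abs_mult power_mult_distrib power2_eq_square power3_eq_cube)
    also have "\<dots> \<le> E ^ 2 * (E ^ 2 * s\<^sup>2 * avg x)"
    proof -
      \<comment> \<open>The power is lowered to \<open>s\<^sup>2\<close> because the errors are
        later integrated against \<open>ref_ker\<close>, whose second moment is 1.\<close>
      have "\<bar>s\<bar> ^ 3 \<le> s\<^sup>2"
        using power_decreasing[of 2 3 "\<bar>s\<bar>"] s by simp
      then show ?thesis
        using avg_nonneg[OF x] by (intro mult_left_mono mult_right_mono) auto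
    qed
    finally show ?thesis .
  qed
  have "quot s x + quot (- s) x + s\<^sup>2 * U 2 x = - (R s + R (- s)) / E\<^sup>2"
    using E(1) unfolding quot_def R_def E_def[symmetric]
    by (simp add: field_simps power2_eq_square power3_eq_cube)
  then have "\<bar>quot s x + quot (- s) x + s\<^sup>2 * U 2 x\<bar> = \<bar>R s + R (- s)\<bar> / E\<^sup>2"
    by (simp only: abs_divide abs_minus_cancel abs_power2)
  also have "\<dots> \<le> (2 * (E ^ 2 * (E ^ 2 * s\<^sup>2 * avg x))) / E\<^sup>2"
    using R[of s] R[of "- s"] by (intro divide_right_mono) auto
  also have "\<dots> = 2 * E ^ 2 * s\<^sup>2 * avg x" using E(1) by simp
  also have "\<dots> \<le> 2 * (K * \<delta>)\<^sup>2 * s\<^sup>2 * avg x"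
    using E avg_nonneg[OF x] by (intro mult_right_mono mult_left_mono power_mono) auto
  finally show ?thesis .
qed

lemma adj_even: "adj s y + adj (- s) y = s\<^sup>2 * U 2 y"
  by (simp add: adj_def)

text \<open>Everything is expanded around \<open>y = x + s * \<eta> x\<close>, the point at which
  \<open>adj\<close> is evaluated, and sorted by \<open>U 1\<close>, \<open>U 2\<close> and
  \<open>U 3\<close> at \<open>y\<close>. For \<open>U 2\<close> and \<open>U 3\<close> it suffices
  that \<open>\<eta>\<close> and \<open>\<eta>1\<close> vary by \<open>O(\<delta> \<eta>)\<close>
  between \<open>x\<close> and \<open>y\<close>, and that the Jacobian differs from 1 by
  \<open>O(\<delta>)\<close>. The coefficient of \<open>U 1\<close> contains the singular terms
  \<open>s / \<eta> x\<close> and \<open>s / \<eta> y\<close>; their cancellation is seen by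
  expanding \<open>\<eta>\<close> and \<open>\<eta>1\<close> with remainders in
  \<open>\<eta>3\<close>, and here the bound on \<open>\<eta> * \<bar>\<eta>3\<bar>\<close> is used.
  In \<open>8 * M\<close>, the share of \<open>U 2\<close> and \<open>U 3\<close> is 2 and that of
  \<open>U 1\<close> is 6.\<close>

lemma adj_defect_bound:
  assumes x: "x \<in> Omega" and s: "\<bar>s\<bar> \<le> 1"
  shows "\<bar>quot s x - adj s (x + s * \<eta> x) * (1 + s * \<eta>1 x)\<bar> \<le> (K * \<delta>)\<^sup>2 * s\<^sup>2 * (8 * M + avg x)"
proof -
  define E where "E = \<eta> x"
  define h1 where "h1 = \<eta>1 x"
  define y where "y = x + s * E"
  define e where "e = \<eta> y"
  define e1 where "e1 = \<eta>1 y"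
  define e2 where "e2 = \<eta>2 y"
  define k where "k = K * \<delta>"
  have k: "0 < k" using K\<delta>_pos by (simp add: k_def)
  have E: "0 < E" "E \<le> k" using \<eta>_pos[OF x] \<eta>_le[OF x] by (auto simp: E_def k_def)
  have near_y: "\<bar>y - x\<bar> \<le> \<eta> x" using shift_near[OF x s] by (simp add: y_def E_def)
  have y: "y \<in> Omega" by (rule near_in_Omega[OF x near_y])
  have e: "2 / 3 * E \<le> e" "e \<le> 4 / 3 * E" "0 < e"
    using \<eta>_comparable[OF x near_y] \<eta>_pos[OF y] by (auto simp: e_def E_def)
  have sE: "\<bar>s * E\<bar> \<le> E" using s E by (simp add: abs_mult mult_left_le_one_le)
  have yx: "\<bar>y - x\<bar> = \<bar>s * E\<bar>" by (simp add: y_def)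
  have eE: "\<bar>e - E\<bar> \<le> k * E"
    using \<eta>_lipschitz(2)[OF x y] mult_left_mono[OF sE, of k] k unfolding yx
    by (simp add: e_def E_def k_def)
  have e1h1: "\<bar>e1 - h1\<bar> \<le> k * E"
    using \<eta>_lipschitz(3)[OF x y] mult_left_mono[OF sE, of k] k unfolding yx
    by (simp add: e1_def h1_def k_def)
  have small: "\<bar>h1\<bar> \<le> k" "\<bar>e1\<bar> \<le> k" "\<bar>e2\<bar> \<le> k"
    using \<eta>1_le[OF x] \<eta>1_le[OF y] \<eta>2_le[OF y] by (auto simp: h1_def e1_def e2_def k_def)
  let ?p = "min x y" and ?r = "max x y"
  have rp: "?r - ?p = \<bar>s * E\<bar>" using yx by auto
  \<comment> \<open>From \<open>\<eta> t * \<bar>\<eta>3 t\<bar> \<le> K * \<delta>\<^sup>2\<close>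
    and \<open>\<eta> t \<ge> 2 / 3 * E\<close> for \<open>t\<close> between \<open>x\<close> and
    \<open>y\<close>.\<close>
  define B where "B = 3 / 2 * k * \<delta> / E"
  have near: "\<bar>t - x\<bar> \<le> \<eta> x" if "t \<in> {?p..?r}" for t
    using that near_y by (auto simp: min_def max_def split: if_splits)
  have \<eta>3B: "\<bar>\<eta>3 t\<bar> \<le> B" if "t \<in> {?p..?r}" for t
  proof -
    have "2 / 3 * E * \<bar>\<eta>3 t\<bar> \<le> \<eta> t * \<bar>\<eta>3 t\<bar>"
      using \<eta>_comparable(1)[OF x near[OF that]] by (intro mult_right_mono) (auto simp: E_def)
    also have "\<dots> \<le> k * \<delta>"
      using \<eta>3_le[OF near_in_Omega[OF x near[OF that]]] by (simp add: k_def power2_eq_square mult.assoc)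
    finally show ?thesis using E(1) by (simp add: B_def field_simps)
  qed
  note tb = taylor_bounds[where p = ?p and r = ?r and a = y and x = x, OF \<eta>_DERIV \<eta>1_DERIV \<eta>2_DERIV \<eta>3B,
      OF near_in_Omega[OF x near] near_in_Omega[OF x near] near_in_Omega[OF x near]]
  \<comment> \<open>Taylor remainders, at \<open>x\<close> and around \<open>y\<close>, of
    \<open>\<eta>\<close> and of \<open>\<eta>1\<close>; here
    \<open>x - y = - s * E\<close>.\<close>
  define \<rho> where "\<rho> = E - e + s * E * e1 - (s * E)\<^sup>2 / 2 * e2"
  define \<rho>1 where "\<rho>1 = h1 - e1 + s * E * e2"
  have \<rho>: "\<bar>\<rho>\<bar> \<le> B * \<bar>s * E\<bar> ^ 3"
    using tb(2) unfolding rp by (simp add: \<rho>_def E_def e_def e1_def e2_def y_def)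
  have \<rho>1: "\<bar>\<rho>1\<bar> \<le> B * \<bar>s * E\<bar>\<^sup>2"
    using tb(1) unfolding rp by (simp add: \<rho>1_def E_def h1_def e1_def e2_def y_def)
  define R where "R = U 0 x - U 0 y + s * E * U 1 y - (s * E)\<^sup>2 / 2 * U 2 y + (s * E) ^ 3 / 6 * U 3 y"
  have R: "\<bar>R\<bar> \<le> E * avg x * \<bar>s * E\<bar> ^ 3"
    using U_taylor[OF x near_y, of y x] unfolding yx
    by (simp add: R_def E_def y_def power2_eq_square power3_eq_cube)
  \<comment> \<open>The coefficient of \<open>U 1 y\<close>, divided by \<open>s\<close> and
    rearranged by means of \<open>\<rho>\<close> and \<open>\<rho>1\<close>, so that every summand
    is of order \<open>k\<^sup>2\<close> although \<open>1 / E\<close> and \<open>1 / e\<close> are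
    not.\<close>
  define T where "T = s\<^sup>2 * e2 * ((e - E) / e) / 2 + (\<rho> + s * E * \<rho>1) / (E * e) + s ^ 3 * h1 * e2 / 2"
  have T_eq: "s * T = - s / E + (1 + s * h1) * (s / e + s ^ 3 * e2 / 2)"
  proof -
    have "E * e * T = s\<^sup>2 * e2 * (e - E) * E / 2 + (\<rho> + s * E * \<rho>1) + E * e * (s ^ 3 * h1 * e2 / 2)"
      using E(1) e(3) by (simp add: T_def field_simps)
    also have "\<dots> = - e + (1 + s * h1) * (E + s\<^sup>2 * e2 * e * E / 2)"
      unfolding \<rho>_def \<rho>1_def by (simp add: field_simps power2_eq_square power3_eq_cube)
    finally have "T = (- e + (1 + s * h1) * (E + s\<^sup>2 * e2 * e * E / 2)) / (E * e)"
      using E(1) e(3) by (simp add: field_simps)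
    then have "s * T = s * ((- e + (1 + s * h1) * (E + s\<^sup>2 * e2 * e * E / 2)) / (E * e))"
      by simp
    also have "\<dots> = - s / E + (1 + s * h1) * (s / e + s ^ 3 * e2 / 2)"
      using E(1) e(3) by (simp add: field_simps power2_eq_square power3_eq_cube)
    finally show ?thesis .
  qed
  have split: "quot s x - adj s y * (1 + s * h1) = R / E\<^sup>2
      + s ^ 3 * (((1 + s * h1) * e - E) * U 3 y / 6 + (e1 - h1 + s * h1 * e1) * U 2 y / 2) + s * T * U 1 y"
  proof -
    have q: "quot s x = R / E\<^sup>2 - s / E * U 1 y + s\<^sup>2 / 2 * U 2 y - s ^ 3 * E / 6 * U 3 y"
      using E(1) unfolding quot_def R_def E_def[symmetric] y_def[symmetric]
      by (simp add: field_simps power2_eq_square power3_eq_cube)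
    have a: "adj s y = - (s / e) * U 1 y + s\<^sup>2 * U 2 y / 2
        - s ^ 3 * (e * U 3 y / 6 + e1 * U 2 y / 2 + e2 * U 1 y / 2)"
      by (simp add: adj_def e_def e1_def e2_def)
    show ?thesis unfolding T_eq q a
      by (simp add: algebra_simps add_divide_distrib diff_divide_distrib power2_eq_square power3_eq_cube)
  qed
  have s2: "\<bar>s\<bar> ^ 3 \<le> s\<^sup>2" using power_decreasing[of 2 3 "\<bar>s\<bar>"] s by simp
  have \<delta>k: "\<delta> \<le> k" using K_ge_1 \<delta>_pos by (simp add: k_def)
  have b1: "\<bar>R / E\<^sup>2\<bar> \<le> s\<^sup>2 * (k\<^sup>2 * avg x)"
  proof -
    have "\<bar>R / E\<^sup>2\<bar> \<le> E * avg x * \<bar>s * E\<bar> ^ 3 / E\<^sup>2"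
      using R E(1) by (simp add: divide_right_mono)
    also have "\<dots> = \<bar>s\<bar> ^ 3 * (E\<^sup>2 * avg x)"
      using E(1) by (simp add: abs_mult power_mult_distrib power2_eq_square power3_eq_cube)
    also have "\<dots> \<le> s\<^sup>2 * (k\<^sup>2 * avg x)"
      using s2 E avg_nonneg[OF x] by (intro mult_mono power_mono) auto
    finally show ?thesis .
  qed
  have Uy: "\<bar>U j y\<bar> \<le> M" if "j \<le> 3" for j using U_le[OF that] .
  have b2: "\<bar>((1 + s * h1) * e - E) * U 3 y / 6 + (e1 - h1 + s * h1 * e1) * U 2 y / 2\<bar> \<le> 2 * k\<^sup>2 * M"
  proof -
    have "\<bar>s * h1\<bar> \<le> 1 * k" unfolding abs_mult using s small k by (intro mult_mono) auto
    then have sh: "\<bar>s * h1\<bar> \<le> k" by simp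
    have "\<bar>s * h1 * e\<bar> \<le> k * (4 / 3 * k)"
      unfolding abs_mult[of "s * h1"] using sh e E by (intro mult_mono) auto
    moreover have "k * E \<le> k * k" using E k by (intro mult_left_mono) auto
    moreover have "\<bar>(1 + s * h1) * e - E\<bar> \<le> \<bar>e - E\<bar> + \<bar>s * h1 * e\<bar>"
      using abs_triangle_ineq[of "e - E" "s * h1 * e"] by (simp add: algebra_simps)
    moreover have "k * (4 / 3 * k) = 4 / 3 * (k * k)" "0 \<le> k * k" by simp_all
    ultimately have "\<bar>(1 + s * h1) * e - E\<bar> \<le> 3 * (k * k)"
      using eE by linarith
    then have 1: "\<bar>((1 + s * h1) * e - E) * U 3 y\<bar> \<le> 3 * k\<^sup>2 * M"
      unfolding abs_mult using Uy[of 3] by (intro mult_mono) (auto simp: power2_eq_square)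
    have "\<bar>s * h1 * e1\<bar> \<le> k * k"
      unfolding abs_mult[of "s * h1"] using sh small k by (intro mult_mono) auto
    then have "\<bar>e1 - h1 + s * h1 * e1\<bar> \<le> 2 * k\<^sup>2"
      using e1h1 \<open>k * E \<le> k * k\<close> by (simp add: power2_eq_square)
    then have 2: "\<bar>(e1 - h1 + s * h1 * e1) * U 2 y\<bar> \<le> 2 * k\<^sup>2 * M"
      unfolding abs_mult using Uy[of 2] by (intro mult_mono) auto
    have "0 \<le> k\<^sup>2 * M" using M_nonneg by simp
    then show ?thesis using 1 2 by linarith
  qed
  have b3: "\<bar>s * T\<bar> \<le> s\<^sup>2 * (6 * k\<^sup>2)"
  proof -
    have eE': "\<bar>(e - E) / e\<bar> \<le> 3 / 2 * k"
    proof -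
      have "\<bar>e - E\<bar> \<le> 3 / 2 * k * e"
        using eE mult_left_mono[OF e(1), of k] k by linarith
      then show ?thesis using e(3) by (simp add: field_simps)
    qed
    define q where "q = (e - E) / e"
    have q: "\<bar>q\<bar> \<le> 3 / 2 * k" using eE' by (simp add: q_def)
    have "\<bar>s\<bar> * \<bar>s\<^sup>2 * e2 * q / 2\<bar> = \<bar>s\<bar> * s\<^sup>2 * (\<bar>e2\<bar> * \<bar>q\<bar>) / 2"
      by (simp add: abs_mult)
    also have "\<dots> \<le> 1 * s\<^sup>2 * (k * (3 / 2 * k)) / 2"
      using s small(3) q k by (intro divide_right_mono mult_mono) auto
    finally have t1: "\<bar>s\<bar> * \<bar>s\<^sup>2 * e2 * ((e - E) / e) / 2\<bar> \<le> 3 / 4 * (s\<^sup>2 * k\<^sup>2)"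
      by (simp add: power2_eq_square q_def)
    have t2: "\<bar>s\<bar> * \<bar>(\<rho> + s * E * \<rho>1) / (E * e)\<bar> \<le> 9 / 2 * (s\<^sup>2 * k\<^sup>2)"
    proof -
      have "\<bar>s * E * \<rho>1\<bar> \<le> \<bar>s * E\<bar> * (B * \<bar>s * E\<bar>\<^sup>2)"
        unfolding abs_mult[of "s * E"] using \<rho>1 by (intro mult_left_mono) auto
      also have "\<dots> = B * \<bar>s * E\<bar> ^ 3"
        by (simp only: power2_eq_square power3_eq_cube mult_ac)
      finally have "\<bar>\<rho> + s * E * \<rho>1\<bar> \<le> 2 * B * \<bar>s * E\<bar> ^ 3"
        using \<rho> abs_triangle_ineq[of \<rho> "s * E * \<rho>1"] by linarith
      \<comment> \<open>The factor \<open>1 / E\<close> hidden in \<open>B\<close> is paid for by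
        one of the three powers of \<open>E\<close>; the other two cancel against the denominator
        \<open>E * e\<close>.\<close>
      also have "\<dots> = 3 * k * \<delta> * \<bar>s\<bar> ^ 3 * E\<^sup>2"
        using E(1) by (simp add: B_def abs_mult power_mult_distrib power2_eq_square power3_eq_cube)
      also have "\<dots> \<le> 3 * k * k * s\<^sup>2 * E\<^sup>2"
        using s2 k \<delta>k \<delta>_pos by (intro mult_mono) auto
      finally have num: "\<bar>\<rho> + s * E * \<rho>1\<bar> \<le> 3 * k * k * s\<^sup>2 * E\<^sup>2" .
      have "E * (2 / 3 * E) \<le> E * e" using e E by (intro mult_left_mono) auto
      then have den: "E\<^sup>2 \<le> 3 / 2 * (E * e)" by (simp add: power2_eq_square)
      have "\<bar>\<rho> + s * E * \<rho>1\<bar> \<le> 3 * k * k * s\<^sup>2 * (3 / 2 * (E * e))"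
        by (rule order_trans[OF num mult_left_mono[OF den]]) (use k in simp)
      then have quotient: "\<bar>\<rho> + s * E * \<rho>1\<bar> / (E * e) \<le> 9 / 2 * (s\<^sup>2 * k\<^sup>2)"
        using E(1) e(3) by (simp add: field_simps power2_eq_square)
      have "\<bar>s\<bar> * \<bar>(\<rho> + s * E * \<rho>1) / (E * e)\<bar> \<le> \<bar>(\<rho> + s * E * \<rho>1) / (E * e)\<bar>"
        using s by (intro mult_left_le_one_le) auto
      also have "\<dots> = \<bar>\<rho> + s * E * \<rho>1\<bar> / (E * e)"
        using E(1) e(3) by simp
      also note quotient
      finally show ?thesis .
    qed
    have "\<bar>s\<bar> * \<bar>s ^ 3 * h1 * e2 / 2\<bar> = \<bar>s\<bar> * \<bar>s\<bar> ^ 3 * (\<bar>h1\<bar> * \<bar>e2\<bar>) / 2"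
      by (simp add: abs_mult power_abs)
    also have "\<dots> \<le> 1 * s\<^sup>2 * (k * k) / 2"
      using s s2 small k by (intro divide_right_mono mult_mono) auto
    finally have t3: "\<bar>s\<bar> * \<bar>s ^ 3 * h1 * e2 / 2\<bar> \<le> 1 / 2 * (s\<^sup>2 * k\<^sup>2)"
      by (simp add: power2_eq_square)
    have "\<bar>s * T\<bar> = \<bar>s\<bar> * \<bar>T\<bar>" by (rule abs_mult)
    also have "\<dots> \<le> \<bar>s\<bar> * (\<bar>s\<^sup>2 * e2 * ((e - E) / e) / 2\<bar> + \<bar>(\<rho> + s * E * \<rho>1) / (E * e)\<bar> + \<bar>s ^ 3 * h1 * e2 / 2\<bar>)"
      unfolding T_def by (intro mult_left_mono order_trans[OF abs_triangle_ineq] add_right_mono) auto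
    also have "\<dots> \<le> 3 / 4 * (s\<^sup>2 * k\<^sup>2) + 9 / 2 * (s\<^sup>2 * k\<^sup>2) + 1 / 2 * (s\<^sup>2 * k\<^sup>2)"
      unfolding distrib_left using t1 t2 t3 by (intro add_mono)
    also have "\<dots> = 23 / 4 * (s\<^sup>2 * k\<^sup>2)" by simp
    also have "\<dots> \<le> 6 * (s\<^sup>2 * k\<^sup>2)" by (intro mult_right_mono) auto
    finally show ?thesis by simp
  qed
  have m1: "\<bar>s ^ 3 * (((1 + s * h1) * e - E) * U 3 y / 6 + (e1 - h1 + s * h1 * e1) * U 2 y / 2)\<bar> \<le> s\<^sup>2 * (2 * k\<^sup>2 * M)"
    unfolding abs_mult[of "s ^ 3"] power_abs using s2 b2 by (intro mult_mono) auto
  have m2: "\<bar>s * T * U 1 y\<bar> \<le> (s\<^sup>2 * (6 * k\<^sup>2)) * M"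
    unfolding abs_mult[of "s * T"] using b3 Uy[of 1] by (intro mult_mono) auto
  have "\<bar>quot s x - adj s y * (1 + s * h1)\<bar>
      \<le> s\<^sup>2 * (k\<^sup>2 * avg x) + s\<^sup>2 * (2 * k\<^sup>2 * M) + (s\<^sup>2 * (6 * k\<^sup>2)) * M"
    unfolding split
    by (intro order_trans[OF abs_triangle_ineq] add_mono b1 m1 m2)
  then show ?thesis
    by (simp add: y_def E_def h1_def k_def algebra_simps)
qed

end

section \<open>The local average of the fourth derivative in \<open>L2\<close>\<close>

lemma emeasure_LOmega_le: "A \<in> sets borel \<Longrightarrow> emeasure LOmega (A \<inter> Omega) \<le> emeasure lborel A"
proof -
  assume A: "A \<in> sets borel"
  have "emeasure LOmega (A \<inter> Omega) = emeasure lebesgue (A \<inter> Omega)"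
    by (rule emeasure_restrict_space) auto
  also have "\<dots> \<le> emeasure lebesgue A"
    by (rule emeasure_mono) (use A in auto)
  also have "\<dots> = emeasure lborel A" using A by simp
  finally show ?thesis .
qed

lemma indicator_mult_L2:
  assumes f: "f \<in> L2" and A: "A \<in> sets borel"
  shows "(\<lambda>t. indicator A t * f t) \<in> L2"
proof -
  have eq: "(indicator A t * f t)\<^sup>2 = indicator A t * (f t)\<^sup>2" for t
    by (simp add: indicator_def)
  have "(\<lambda>t. indicator A t * f t) \<in> borel_measurable LOmega"
    using f by (intro borel_measurable_times indicator_LOmega[OF A]) (simp add: L2_def)
  moreover have "integrable LOmega (\<lambda>t. indicator A t * (f t)\<^sup>2)"
    using f by (intro integrable_indicator_LOmega[OF _ A]) (simp add: L2_def)
  ultimately show ?thesis unfolding L2_def mem_Collect_eq eq by blast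
qed

lemma (in horizon) \<eta>_measurable: "\<eta> \<in> borel_measurable LOmega"
  by (intro continuous_on_LOmega continuous_at_imp_continuous_on ballI DERIV_isCont[OF \<eta>_DERIV])

context horizon_H4
begin

lemma g_measurable: "g \<in> borel_measurable LOmega"
  using g_L2 by (simp add: L2_def)

lemma avg_measurable: "avg \<in> borel_measurable LOmega"
proof -
  note [measurable] = \<eta>_measurable g_measurable
  have "(\<lambda>(x, t). (if x - \<eta> x \<le> t \<and> t \<le> x + \<eta> x then 1 else 0) * \<bar>g t\<bar>)
      \<in> borel_measurable (LOmega \<Otimes>\<^sub>M LOmega)"
    unfolding split_beta' by measurable
  then have "(\<lambda>x. LINT t|LOmega. (if x - \<eta> x \<le> t \<and> t \<le> x + \<eta> x then 1 else 0) * \<bar>g t\<bar>)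
      \<in> borel_measurable LOmega"
    by (rule LO.borel_measurable_lebesgue_integral)
  moreover have "indicator {x - \<eta> x..x + \<eta> x} t = (if x - \<eta> x \<le> t \<and> t \<le> x + \<eta> x then 1 else 0 :: real)"
    for x t by (simp add: indicator_def)
  ultimately show ?thesis unfolding avg_def[abs_def] by simp
qed

text \<open>Cauchy-Schwarz against the indicator of the horizon ball, which lies in
  \<open>Omega\<close> and has length \<open>2 * \<eta> x\<close>.\<close>

lemma avg_sq_le:
  assumes x: "x \<in> Omega"
  shows "(avg x)\<^sup>2 \<le> 2 / \<eta> x * (LINT t|LOmega. indicator {x - \<eta> x..x + \<eta> x} t * (g t)\<^sup>2)"
proof -
  let ?I = "{x - \<eta> x..x + \<eta> x}"
  have e: "0 < \<eta> x" by (rule \<eta>_pos[OF x])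
  have sub: "?I \<subseteq> Omega" using \<eta>_le_left[OF x] \<eta>_le_right[OF x] x by auto
  have i1: "(indicator ?I) \<in> L2"
    using indicator_mult_L2[OF const_L2[of 1], of ?I] by simp
  have i2: "(\<lambda>t. indicator ?I t * g t) \<in> L2"
    by (rule indicator_mult_L2[OF g_L2]) simp
  have n1: "(L2_norm (indicator ?I))\<^sup>2 = 2 * \<eta> x"
  proof -
    have "(L2_norm (indicator ?I))\<^sup>2 = (LINT t|LOmega. indicator ?I t)"
      unfolding L2_norm_sq
      by (rule Bochner_Integration.integral_cong) (auto simp: indicator_def)
    also have "\<dots> = measure LOmega (?I \<inter> space LOmega)"
      by (rule Bochner_Integration.integral_indicator) 
    also have "\<dots> = measure lebesgue ?I"
      using sub by (simp add: Int_absorb2 measure_restrict_space)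
    also have "\<dots> = 2 * \<eta> x" using e by simp
    finally show ?thesis .
  qed
  have n2: "(L2_norm (\<lambda>t. indicator ?I t * g t))\<^sup>2 = (LINT t|LOmega. indicator ?I t * (g t)\<^sup>2)"
    unfolding L2_norm_sq
    by (rule Bochner_Integration.integral_cong) (auto simp: indicator_def)
  have "(LINT t|LOmega. indicator ?I t * \<bar>g t\<bar>)
      = (LINT t|LOmega. \<bar>indicator ?I t * (indicator ?I t * g t)\<bar>)"
    by (rule Bochner_Integration.integral_cong) (auto simp: indicator_def)
  also have "\<dots> \<le> L2_norm (indicator ?I) * L2_norm (\<lambda>t. indicator ?I t * g t)"
    by (rule L2_Cauchy_Schwarz[OF i1 i2])
  finally have "(LINT t|LOmega. indicator ?I t * \<bar>g t\<bar>)\<^sup>2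
      \<le> (L2_norm (indicator ?I) * L2_norm (\<lambda>t. indicator ?I t * g t))\<^sup>2"
    by (intro power_mono Bochner_Integration.integral_nonneg) auto
  also have "\<dots> = 2 * \<eta> x * (LINT t|LOmega. indicator ?I t * (g t)\<^sup>2)"
    unfolding power_mult_distrib n1 n2 ..
  finally have "(LINT t|LOmega. indicator ?I t * \<bar>g t\<bar>)\<^sup>2 / (\<eta> x)\<^sup>2
      \<le> 2 * \<eta> x * (LINT t|LOmega. indicator ?I t * (g t)\<^sup>2) / (\<eta> x)\<^sup>2"
    by (rule divide_right_mono) simp
  then show ?thesis
    using e by (simp add: avg_def power_divide power2_eq_square)
qed

text \<open>Tonelli takes the place of a maximal inequality. A point \<open>t\<close> is seen from
  those \<open>x\<close> with \<open>\<bar>t - x\<bar> \<le> \<eta> x\<close>; comparability puts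
  them into an interval of length \<open>3 * \<eta> t\<close> and bounds the weight
  \<open>2 / \<eta> x\<close> by \<open>8 / 3 / \<eta> t\<close>. The product is 8, and
  \<open>8 \<le> 3\<^sup>2\<close> gives the constant 3.\<close>

lemma avg_L2: "avg \<in> L2" and avg_norm: "L2_norm avg \<le> 3 * M"
proof -
  note [measurable] = \<eta>_measurable g_measurable avg_measurable
  let ?I = "\<lambda>x. {x - \<eta> x..x + \<eta> x}"
  define h where "h p = ennreal ((if fst p - \<eta> (fst p) \<le> snd p \<and> snd p \<le> fst p + \<eta> (fst p) then 1 else 0)
      * (2 / \<eta> (fst p)) * (g (snd p))\<^sup>2)" for p
  have h_meas: "h \<in> borel_measurable (LOmega \<Otimes>\<^sub>M LOmega)"
    unfolding h_def by measurable
  have gint: "integrable LOmega (\<lambda>t. (g t)\<^sup>2)" using g_L2 by (simp add: L2_def)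
  have le: "ennreal ((avg x)\<^sup>2) \<le> (\<integral>\<^sup>+t. h (x, t) \<partial>LOmega)" if x: "x \<in> Omega" for x
  proof -
    have int: "integrable LOmega (\<lambda>t. 2 / \<eta> x * (indicator (?I x) t * (g t)\<^sup>2))"
      using integrable_indicator_LOmega[OF gint] by simp
    have "ennreal ((avg x)\<^sup>2) \<le> ennreal (LINT t|LOmega. 2 / \<eta> x * (indicator (?I x) t * (g t)\<^sup>2))"
      using avg_sq_le[OF x] by (intro ennreal_leI) simp
    also have "\<dots> = (\<integral>\<^sup>+t. ennreal (2 / \<eta> x * (indicator (?I x) t * (g t)\<^sup>2)) \<partial>LOmega)"
      by (rule nn_integral_eq_integral[symmetric, OF int]) (use \<eta>_pos[OF x] in auto)
    also have "\<dots> = (\<integral>\<^sup>+t. h (x, t) \<partial>LOmega)"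
      by (rule nn_integral_cong) (simp add: h_def indicator_def)
    finally show ?thesis .
  qed
  have inner: "(\<integral>\<^sup>+x. h (x, t) \<partial>LOmega) \<le> ennreal (8 * (g t)\<^sup>2)" if t: "t \<in> Omega" for t
  proof -
    have et: "0 < \<eta> t" by (rule \<eta>_pos[OF t])
    let ?J = "{t - 3 / 2 * \<eta> t..t + 3 / 2 * \<eta> t}"
    have "(\<integral>\<^sup>+x. h (x, t) \<partial>LOmega)
        \<le> (\<integral>\<^sup>+x. ennreal (8 / 3 / \<eta> t * (g t)\<^sup>2) * indicator (?J \<inter> Omega) x \<partial>LOmega)"
    proof (rule nn_integral_mono)
      fix x assume "x \<in> space LOmega"
      then have x: "x \<in> Omega" by simp
      show "h (x, t) \<le> ennreal (8 / 3 / \<eta> t * (g t)\<^sup>2) * indicator (?J \<inter> Omega) x"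
      proof (cases "\<bar>t - x\<bar> \<le> \<eta> x")
        case True
        have c: "2 / 3 * \<eta> x \<le> \<eta> t" "\<eta> t \<le> 4 / 3 * \<eta> x"
          using \<eta>_comparable[OF x True] by auto
        have J: "x \<in> ?J \<inter> Omega" using x True c by (auto simp: abs_le_iff)
        have "2 / \<eta> x \<le> 8 / 3 / \<eta> t"
          using c(2) et \<eta>_pos[OF x] by (simp add: field_simps)
        then have "2 / \<eta> x * (g t)\<^sup>2 \<le> 8 / 3 / \<eta> t * (g t)\<^sup>2"
          by (rule mult_right_mono) simp
        then show ?thesis using True J by (auto simp: h_def intro!: ennreal_leI)
      next
        case False
        then have "h (x, t) = 0" by (auto simp: h_def)
        then show ?thesis by simp
      qed
    qed
    also have "\<dots> = ennreal (8 / 3 / \<eta> t * (g t)\<^sup>2) * emeasure LOmega (?J \<inter> Omega)"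
      by (rule nn_integral_cmult_indicator) (auto simp: sets_restrict_space)
    also have "\<dots> \<le> ennreal (8 / 3 / \<eta> t * (g t)\<^sup>2) * emeasure lborel ?J"
      by (intro mult_left_mono emeasure_LOmega_le) auto
    also have "\<dots> = ennreal (8 / 3 / \<eta> t * (g t)\<^sup>2) * ennreal (3 * \<eta> t)"
      using et by simp
    also have "\<dots> = ennreal (8 / 3 / \<eta> t * (g t)\<^sup>2 * (3 * \<eta> t))"
      using et by (intro ennreal_mult[symmetric]) auto
    also have "8 / 3 / \<eta> t * (g t)\<^sup>2 * (3 * \<eta> t) = 8 * (g t)\<^sup>2"
      using et by simp
    finally show ?thesis .
  qed
  have "(\<integral>\<^sup>+x. ennreal ((avg x)\<^sup>2) \<partial>LOmega) \<le> (\<integral>\<^sup>+x. \<integral>\<^sup>+t. h (x, t) \<partial>LOmega \<partial>LOmega)"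
    by (rule nn_integral_mono) (use le in simp)
  also have "\<dots> = (\<integral>\<^sup>+t. \<integral>\<^sup>+x. h (x, t) \<partial>LOmega \<partial>LOmega)"
    using LO2.Fubini[OF h_meas] by simp
  also have "\<dots> \<le> (\<integral>\<^sup>+t. ennreal (8 * (g t)\<^sup>2) \<partial>LOmega)"
    by (rule nn_integral_mono) (use inner in simp)
  also have "\<dots> = ennreal (LINT t|LOmega. 8 * (g t)\<^sup>2)"
    by (rule nn_integral_eq_integral) (use gint in auto)
  also have "(LINT t|LOmega. 8 * (g t)\<^sup>2) = 8 * (L2_norm g)\<^sup>2"
    by (simp add: L2_norm_sq)
  finally have bound: "(\<integral>\<^sup>+x. ennreal ((avg x)\<^sup>2) \<partial>LOmega) \<le> ennreal (8 * (L2_norm g)\<^sup>2)" .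
  have int: "integrable LOmega (\<lambda>x. (avg x)\<^sup>2)"
    by (rule integrableI_nonneg) (use bound in \<open>auto simp: less_top[symmetric] top_unique\<close>)
  then show "avg \<in> L2" by (simp add: L2_def avg_measurable)
  have "ennreal ((L2_norm avg)\<^sup>2) \<le> ennreal (8 * (L2_norm g)\<^sup>2)"
    using bound nn_integral_eq_integral[OF int] by (simp add: L2_norm_sq)
  then have "(L2_norm avg)\<^sup>2 \<le> 8 * (L2_norm g)\<^sup>2"
    by (subst (asm) ennreal_le_iff) auto
  also have "\<dots> \<le> (3 * M)\<^sup>2"
  proof -
    have "(3 * M)\<^sup>2 = 9 * M\<^sup>2" by (simp add: power_mult_distrib)
    then show ?thesis
      using power_mono[OF g_le L2_norm_nonneg, of 2] zero_le_power2[of M] by linarith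
  qed
  finally show "L2_norm avg \<le> 3 * M"
    by (rule power2_le_imp_le) (simp add: M_nonneg)
qed

end

subsection \<open>Change of variables in a slice\<close>

text \<open>Integrands such as \<open>quot s x * f x\<close> are continuous on the open interval
  only, with a factor that may be singular at its ends. The support condition reduces them to a
  compact interval, where the substitution rule is available.\<close>

lemma compact_support_integral:
  fixes h :: "real \<Rightarrow> real"
  assumes h: "continuous_on Omega h" and p: "0 < p" and r: "r < 1"
    and zero: "\<And>x. x \<in> Omega \<Longrightarrow> x \<le> p \<or> r \<le> x \<Longrightarrow> h x = 0"
  shows "integrable LOmega h" "(LINT x|LOmega. h x) = integral {p..r} h"
proof -
  have cont: "continuous_on {p..r} h" by (rule continuous_on_subset[OF h]) (use p r in auto)
  have eq: "indicator {p<..<r} x * h x = h x" if "x \<in> Omega" for x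
    using zero[OF that] by (cases "x \<le> p \<or> r \<le> x") auto
  have "integrable LOmega (\<lambda>x. indicator {p<..<r} x * h x) \<longleftrightarrow> integrable LOmega h"
    by (rule Bochner_Integration.integrable_cong) (use eq in auto)
  moreover have "(LINT x|LOmega. indicator {p<..<r} x * h x) = (LINT x|LOmega. h x)"
    by (rule Bochner_Integration.integral_cong) (use eq in auto)
  ultimately show "integrable LOmega h" "(LINT x|LOmega. h x) = integral {p..r} h"
    using LOmega_interval[of p r h] p r cont by auto
qed

context horizon
begin

definition shift :: "real \<Rightarrow> real \<Rightarrow> real" where
  "shift s x = x + s * \<eta> x"

lemma \<eta>_continuous: "continuous_on Omega \<eta>" "continuous_on Omega \<eta>1" "continuous_on Omega \<eta>2"
  using \<eta>_DERIV \<eta>1_DERIV \<eta>2_DERIV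
  by (intro continuous_at_imp_continuous_on ballI DERIV_isCont; blast)+

lemma shift_in_Omega: "x \<in> Omega \<Longrightarrow> \<bar>s\<bar> \<le> 1 \<Longrightarrow> shift s x \<in> Omega"
  unfolding shift_def using near_in_Omega shift_near by blast

lemma shift_continuous: "continuous_on Omega (shift s)"
  unfolding shift_def by (intro continuous_intros \<eta>_continuous)

lemma shift_compose_continuous:
  "continuous_on Omega h \<Longrightarrow> \<bar>s\<bar> \<le> 1 \<Longrightarrow> continuous_on Omega (\<lambda>x. h (shift s x))"
  by (rule continuous_on_compose2[OF _ shift_continuous]) (auto dest: shift_in_Omega)

lemma shift_bounds:
  assumes "x \<in> Omega" "\<bar>s\<bar> \<le> 1"
  shows "3 * shift s x \<le> 4 * x" "3 * (1 - shift s x) \<le> 4 * (1 - x)"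
proof -
  have *: "\<bar>s * \<eta> x\<bar> \<le> \<eta> x" using shift_near[OF assms] by simp
  show "3 * shift s x \<le> 4 * x"
    using abs_le_D1[OF *] \<eta>_le_left[OF assms(1)] unfolding shift_def by argo
  show "3 * (1 - shift s x) \<le> 4 * (1 - x)"
  proof -
    have "3 * \<eta> x \<le> 1 - x" using \<eta>_le_right[OF assms(1)] by simp
    then show ?thesis using abs_le_D2[OF *] unfolding shift_def by simp
  qed
qed

lemma shift_deriv_ge: "x \<in> Omega \<Longrightarrow> \<bar>s\<bar> \<le> 1 \<Longrightarrow> 2 / 3 \<le> 1 + s * \<eta>1 x"
proof -
  assume *: "x \<in> Omega" "\<bar>s\<bar> \<le> 1"
  have "\<bar>s * \<eta>1 x\<bar> \<le> 1 * (1 / 3)"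
    unfolding abs_mult using * \<eta>1_le_third[OF *(1)] by (intro mult_mono) auto
  then show ?thesis unfolding abs_le_iff by linarith
qed

text \<open>A shift increases the distance to an end point by a factor of at most 4/3, so a point
  within \<open>a / 2\<close> of it ends up within \<open>2 / 3 * a\<close>, where \<open>h\<close>
  still vanishes.\<close>

lemma shift_support:
  assumes zero: "\<And>x. x \<notin> {a..1 - a} \<Longrightarrow> h x = 0" and "0 < a" and x: "x \<in> Omega" and s: "\<bar>s\<bar> \<le> 1"
    and "x \<le> a / 2 \<or> 1 - a / 2 \<le> x"
  shows "h (shift s x) = (0 :: real)"
proof -
  have "shift s x < a \<or> 1 - a < shift s x"
    using assms(5)
  proof
    assume "x \<le> a / 2"
    then show ?thesis using shift_bounds(1)[OF x s] assms(2) by (intro disjI1) argo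
  next
    assume "1 - a / 2 \<le> x"
    then show ?thesis using shift_bounds(2)[OF x s] assms(2) by (intro disjI2) argo
  qed
  then show ?thesis using zero by auto
qed

text \<open>The increasing map \<open>shift s\<close> sends \<open>{a / 2..1 - a / 2}\<close> onto
  an interval that covers \<open>{a..1 - a}\<close>, outside of which \<open>h\<close> vanishes. The
  one-dimensional substitution rule between these intervals is then a statement about
  \<open>Omega\<close>.\<close>

lemma shift_substitution:
  assumes h: "continuous_on Omega h" and zero: "\<And>x. x \<notin> {a..1 - a} \<Longrightarrow> h x = 0"
    and a: "0 < a" "a < 1 / 2" and s: "\<bar>s\<bar> \<le> 1"
  shows "integrable LOmega (\<lambda>x. h (shift s x) * (1 + s * \<eta>1 x))"
    and "(LINT x|LOmega. h (shift s x) * (1 + s * \<eta>1 x)) = (LINT x|LOmega. h x)"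
proof -
  let ?p = "a / 2" and ?r = "1 - a / 2"
  have pr: "?p \<in> Omega" "?r \<in> Omega" "?p < ?r" using a by auto
  have cont: "continuous_on Omega (\<lambda>x. h (shift s x) * (1 + s * \<eta>1 x))"
    by (intro continuous_intros shift_compose_continuous[OF h s] \<eta>_continuous)
  have z: "h (shift s x) * (1 + s * \<eta>1 x) = 0" if "x \<in> Omega" "x \<le> ?p \<or> ?r \<le> x" for x
    using shift_support[of a h, OF zero a(1) that(1) s that(2)] by simp
  note cs = compact_support_integral[OF cont, of ?p ?r, OF _ _ z]
  show "integrable LOmega (\<lambda>x. h (shift s x) * (1 + s * \<eta>1 x))"
    by (rule cs(1)) (use a in auto)
  have D: "(shift s has_real_derivative 1 + s * \<eta>1 x) (at x)" if "x \<in> Omega" for x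
    unfolding shift_def[abs_def] using \<eta>_DERIV[OF that] by (auto intro!: derivative_eq_intros)
  have mono: "shift s x \<le> shift s y" if "x \<le> y" "x \<in> Omega" "y \<in> Omega" for x y
  proof (rule DERIV_nonneg_imp_nondecreasing[OF that(1)])
    fix t assume "x \<le> t" "t \<le> y"
    then have t: "t \<in> Omega" using that by auto
    have "0 \<le> 1 + s * \<eta>1 t" using shift_deriv_ge[OF t s] by linarith
    with D[OF t] show "\<exists>d. DERIV (shift s) t :> d \<and> 0 \<le> d" by blast
  qed
  have sp: "shift s ?p \<in> Omega" "shift s ?r \<in> Omega" by (rule shift_in_Omega[OF pr(1) s], rule shift_in_Omega[OF pr(2) s])
  have spr: "shift s ?p \<le> shift s ?r" using mono pr by simp
  have "(LINT x|LOmega. h (shift s x) * (1 + s * \<eta>1 x)) = integral {?p..?r} (\<lambda>x. h (shift s x) * (1 + s * \<eta>1 x))"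
    by (rule cs(2)) (use a in auto)
  also have "\<dots> = integral {shift s ?p..shift s ?r} h"
  proof -
    have "((\<lambda>x. (1 + s * \<eta>1 x) *\<^sub>R h (shift s x)) has_integral integral {shift s ?p..shift s ?r} h) {?p..?r}"
    proof (rule has_integral_substitution[where c = "shift s ?p" and d = "shift s ?r"])
      show "shift s ` {?p..?r} \<subseteq> {shift s ?p..shift s ?r}"
        using pr a by (auto intro!: mono)
      show "continuous_on {shift s ?p..shift s ?r} h"
        by (rule continuous_on_subset[OF h]) (use sp in auto)
      show "(shift s has_real_derivative 1 + s * \<eta>1 x) (at x within {?p..?r})" if "x \<in> {?p..?r}" for x
        by (rule has_field_derivative_at_within[OF D]) (use that a in auto)
    qed (use pr spr in auto)
    then show ?thesis by (simp add: integral_unique mult.commute)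
  qed
  also have "\<dots> = (LINT x|LOmega. h x)"
  proof (rule compact_support_integral(2)[symmetric, OF h])
    have "shift s ?p < a" "1 - a < shift s ?r"
      using shift_bounds(1)[OF pr(1) s] shift_bounds(2)[OF pr(2) s] a by argo+
    then show "h x = 0" if "x \<in> Omega" "x \<le> shift s ?p \<or> shift s ?r \<le> x" for x
      using that by (intro zero) auto
  qed (use sp in auto)
  finally show "(LINT x|LOmega. h (shift s x) * (1 + s * \<eta>1 x)) = (LINT x|LOmega. h x)" .
qed

text \<open>The Jacobian is at least 2/3, so inserting it costs a factor 3/2, which is rounded up to
  4 for the sake of the square root 2.\<close>

lemma shift_compose_L2:
  assumes f: "continuous_on Omega f" and zero: "\<And>x. x \<notin> {a..1 - a} \<Longrightarrow> f x = 0"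
    and a: "0 < a" "a < 1 / 2" and s: "\<bar>s\<bar> \<le> 1"
  shows "f \<in> L2" "(\<lambda>x. f (shift s x)) \<in> L2" "L2_norm (\<lambda>x. f (shift s x)) \<le> 2 * L2_norm f"
proof -
  have f2: "continuous_on Omega (\<lambda>x. (f x)\<^sup>2)" by (intro continuous_intros f)
  have f2z: "(f x)\<^sup>2 = 0" if "x \<notin> {a..1 - a}" for x using zero[OF that] by simp
  have "integrable LOmega (\<lambda>x. (f x)\<^sup>2)"
  proof (rule compact_support_integral(1)[OF f2])
    show "(f x)\<^sup>2 = 0" if "x \<le> a / 2 \<or> 1 - a / 2 \<le> x" for x
      by (rule f2z) (use that a in auto)
  qed (use a in auto)
  then show "f \<in> L2" by (simp add: L2_def continuous_on_LOmega[OF f])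
  have c: "continuous_on Omega (\<lambda>x. f (shift s x))" by (rule shift_compose_continuous[OF f s])
  note sub = shift_substitution[OF f2 f2z a s]
  have int: "integrable LOmega (\<lambda>x. (f (shift s x))\<^sup>2)"
    by (rule compact_support_integral(1)[of _ "a / 2" "1 - a / 2"])
      (use a c shift_support[of a f, OF zero a(1) _ s] in \<open>auto intro!: continuous_intros\<close>)
  then show "(\<lambda>x. f (shift s x)) \<in> L2" by (simp add: L2_def continuous_on_LOmega[OF c])
  have "(LINT x|LOmega. (f (shift s x))\<^sup>2) \<le> (LINT x|LOmega. 3 / 2 * ((f (shift s x))\<^sup>2 * (1 + s * \<eta>1 x)))"
  proof (rule Bochner_Integration.integral_mono)
    fix x assume "x \<in> space LOmega"
    then have "1 \<le> 3 / 2 * (1 + s * \<eta>1 x)" using shift_deriv_ge[of x s] s by simp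
    then show "(f (shift s x))\<^sup>2 \<le> 3 / 2 * ((f (shift s x))\<^sup>2 * (1 + s * \<eta>1 x))"
      using mult_right_mono[of 1 "3 / 2 * (1 + s * \<eta>1 x)" "(f (shift s x))\<^sup>2"]
      by (simp only: mult_1_left mult_ac zero_le_power2)
  qed (use int sub(1) in auto)
  also have "\<dots> = 3 / 2 * (LINT x|LOmega. (f x)\<^sup>2)" using sub(2) by simp
  also have "\<dots> \<le> 4 * (LINT x|LOmega. (f x)\<^sup>2)"
    by (intro mult_right_mono Bochner_Integration.integral_nonneg) auto
  finally have "(L2_norm (\<lambda>x. f (shift s x)))\<^sup>2 \<le> (2 * L2_norm f)\<^sup>2"
    by (simp add: L2_norm_sq power_mult_distrib)
  then show "L2_norm (\<lambda>x. f (shift s x)) \<le> 2 * L2_norm f"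
    by (rule power2_le_imp_le) (simp add: L2_norm_nonneg)
qed

end

section \<open>The triangle inequality in \<open>L2\<close> and the estimate of a symmetric pair of
  slices\<close>

lemma L2_add: "f \<in> L2 \<Longrightarrow> g \<in> L2 \<Longrightarrow> (\<lambda>x. f x + g x) \<in> L2"
proof -
  assume *: "f \<in> L2" "g \<in> L2"
  have "integrable LOmega (\<lambda>x. (f x)\<^sup>2 + (g x)\<^sup>2 + 2 * (f x * g x))"
    using * L2_mult_integrable[OF *] by (auto simp: L2_def)
  then show ?thesis using * by (auto simp: L2_def power2_sum mult.assoc)
qed

lemma L2_bound_integral:
  assumes h: "h \<in> borel_measurable LOmega" and g: "g \<in> L2" and f: "f \<in> L2"
    and le: "\<And>x. x \<in> Omega \<Longrightarrow> \<bar>h x\<bar> \<le> g x"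
  shows "integrable LOmega (\<lambda>x. h x * f x)"
    and "\<bar>LINT x|LOmega. h x * f x\<bar> \<le> L2_norm g * L2_norm f"
proof -
  have pw: "\<bar>h x * f x\<bar> \<le> \<bar>g x * f x\<bar>" if "x \<in> Omega" for x
    unfolding abs_mult using le[OF that] by (intro mult_right_mono) auto
  have gf: "integrable LOmega (\<lambda>x. \<bar>g x * f x\<bar>)" using L2_mult_integrable[OF g f] by simp
  show int: "integrable LOmega (\<lambda>x. h x * f x)"
    by (rule Bochner_Integration.integrable_bound[OF gf])
      (use pw h f in \<open>auto simp: L2_def\<close>)
  have "\<bar>LINT x|LOmega. h x * f x\<bar> \<le> (LINT x|LOmega. \<bar>h x * f x\<bar>)"
    using integral_norm_bound[of LOmega "\<lambda>x. h x * f x"] by simp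
  also have "\<dots> \<le> (LINT x|LOmega. \<bar>g x * f x\<bar>)"
    by (rule Bochner_Integration.integral_mono) (use int gf pw in auto)
  also have "\<dots> \<le> L2_norm g * L2_norm f" by (rule L2_Cauchy_Schwarz[OF g f])
  finally show "\<bar>LINT x|LOmega. h x * f x\<bar> \<le> L2_norm g * L2_norm f" .
qed

lemma L2_norm_cmult: "0 \<le> c \<Longrightarrow> L2_norm (\<lambda>x. c * f x) = c * L2_norm f"
proof -
  assume "0 \<le> c"
  have "(LINT x|LOmega. (c * f x) * (c * f x)) = (LINT x|LOmega. c\<^sup>2 * (f x * f x))"
    by (rule Bochner_Integration.integral_cong) (auto simp: power2_eq_square)
  with \<open>0 \<le> c\<close> show ?thesis unfolding L2_norm_def L2_inner_def by (simp add: real_sqrt_mult)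
qed

lemma L2_norm_triangle:
  assumes "f \<in> L2" "g \<in> L2"
  shows "L2_norm (\<lambda>x. f x + g x) \<le> L2_norm f + L2_norm g"
proof -
  have "(LINT x|LOmega. f x * g x) \<le> (LINT x|LOmega. \<bar>f x * g x\<bar>)"
    using L2_mult_integrable[OF assms] by (intro Bochner_Integration.integral_mono) auto
  also have "\<dots> \<le> L2_norm f * L2_norm g" by (rule L2_Cauchy_Schwarz[OF assms])
  finally have fg: "(LINT x|LOmega. f x * g x) \<le> L2_norm f * L2_norm g" .
  have "(L2_norm (\<lambda>x. f x + g x))\<^sup>2 = (LINT x|LOmega. (f x)\<^sup>2 + (g x)\<^sup>2 + 2 * (f x * g x))"
    by (simp add: L2_norm_sq power2_sum mult.assoc)
  also have "\<dots> = (L2_norm f)\<^sup>2 + (L2_norm g)\<^sup>2 + 2 * (LINT x|LOmega. f x * g x)"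
    using assms L2_mult_integrable[OF assms] by (simp add: L2_norm_sq L2_def)
  also have "\<dots> \<le> (L2_norm f + L2_norm g)\<^sup>2"
    using fg by (simp add: power2_sum)
  finally show ?thesis
    by (rule power2_le_imp_le) (simp add: L2_norm_nonneg)
qed

context horizon_H4
begin

lemma U_continuous: "j \<le> 3 \<Longrightarrow> continuous_on Omega (U j)"
proof (cases "j = 3")
  case False
  assume "j \<le> 3"
  with False show ?thesis
    by (intro continuous_at_imp_continuous_on ballI DERIV_isCont[OF U_DERIV]) auto
qed (use U3_cont in simp)

lemma quot_continuous: "\<bar>s\<bar> \<le> 1 \<Longrightarrow> continuous_on Omega (quot s)"
  unfolding quot_def[abs_def]
  using shift_compose_continuous[OF U_continuous[of 0], of s] \<eta>_pos
  by (intro continuous_intros U_continuous \<eta>_continuous) (force simp: shift_def)+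

lemma adj_continuous: "continuous_on Omega (adj s)"
  unfolding adj_def[abs_def] using \<eta>_pos
  by (intro continuous_intros U_continuous \<eta>_continuous) force+

text \<open>In the part with \<open>f (shift t x)\<close>, \<open>quot\<close> is replaced by the
  pullback of \<open>adj\<close>, which the substitution turns into \<open>adj t x * f x\<close>,
  plus a defect paired with \<open>f \<circ> shift t\<close> in \<open>L2\<close>. Compact support
  ensures that the separate integrals of \<open>quot t x * f x\<close> and
  \<open>adj t x * f x\<close> exist despite factors of order \<open>1/\<eta>\<close>. The constant
  is \<open>50 = 6 + 22 + 22\<close>: \<open>2 * 3\<close> from the even part of \<open>quot\<close>
  and \<open>11 * 2\<close> from each defect, with \<open>11 = 8 + 3\<close> by
  \<open>avg_norm\<close>.\<close>

lemma slice_estimate: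
  assumes f: "continuous_on Omega f" and zero: "\<And>x. x \<notin> {a..1 - a} \<Longrightarrow> f x = 0"
    and a: "0 < a" "a < 1 / 2" and s: "\<bar>s\<bar> \<le> 1"
  shows "\<bar>(LINT x|LOmega. quot s x * (f x - f (shift s x)))
      + (LINT x|LOmega. quot (- s) x * (f x - f (shift (- s) x)))
      + 2 * s\<^sup>2 * (LINT x|LOmega. U 2 x * f x)\<bar>
    \<le> 50 * (K * \<delta>)\<^sup>2 * s\<^sup>2 * M * L2_norm f"
proof -
  have cs: "integrable LOmega h" if "continuous_on Omega h"
    "\<And>x. x \<in> Omega \<Longrightarrow> x \<le> a / 2 \<or> 1 - a / 2 \<le> x \<Longrightarrow> h x = 0" for h :: "real \<Rightarrow> real"
    by (rule compact_support_integral(1)[of h "a / 2" "1 - a / 2"]) (use that a in auto)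
  have fz: "f x = 0" if "x \<le> a / 2 \<or> 1 - a / 2 \<le> x" for x
    using zero[of x] that a by auto
  define D where "D s x = quot s x - adj s (shift s x) * (1 + s * \<eta>1 x)" for s x
  define c where "c = (K * \<delta>)\<^sup>2 * s\<^sup>2"
  have c: "0 \<le> c" by (simp add: c_def)
  have fL2: "f \<in> L2" by (rule shift_compose_L2(1)[OF f zero a s])
  have slice: "(LINT x|LOmega. quot t x * (f x - f (shift t x)))
      = (LINT x|LOmega. quot t x * f x) - (LINT x|LOmega. D t x * f (shift t x)) - (LINT x|LOmega. adj t x * f x)"
    and int1: "integrable LOmega (\<lambda>x. quot t x * f x)"
    and int2: "integrable LOmega (\<lambda>x. adj t x * f x)"
    and D_le: "\<bar>LINT x|LOmega. D t x * f (shift t x)\<bar> \<le> c * (11 * M) * (2 * L2_norm f)"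
    if t: "\<bar>t\<bar> = \<bar>s\<bar>" for t
  proof -
    have t1: "\<bar>t\<bar> \<le> 1" using t s by simp
    have fs: "f (shift t x) = 0" if "x \<in> Omega" "x \<le> a / 2 \<or> 1 - a / 2 \<le> x" for x
      by (rule shift_support[of a f, OF zero a(1) that(1) t1 that(2)])
    note conts = quot_continuous[OF t1] adj_continuous[of t] f shift_compose_continuous[OF f t1]
      shift_compose_continuous[OF adj_continuous t1] \<eta>_continuous
    show i1: "integrable LOmega (\<lambda>x. quot t x * f x)"
      by (rule cs) (use fz in \<open>auto intro!: continuous_intros conts\<close>)
    show i2: "integrable LOmega (\<lambda>x. adj t x * f x)"
      by (rule cs) (use fz in \<open>auto intro!: continuous_intros conts\<close>)
    have D_cont: "continuous_on Omega (D t)"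
      unfolding D_def by (intro continuous_intros conts)
    have i3: "integrable LOmega (\<lambda>x. D t x * f (shift t x))"
      by (rule cs) (use fs in \<open>auto intro!: continuous_intros conts D_cont\<close>)
    have adjf: "continuous_on Omega (\<lambda>x. adj t x * f x)" "\<And>x. x \<notin> {a..1 - a} \<Longrightarrow> adj t x * f x = 0"
      using zero by (auto intro!: continuous_intros conts)
    note sub = shift_substitution[OF adjf a t1]
    have "(LINT x|LOmega. quot t x * (f x - f (shift t x)))
        = (LINT x|LOmega. quot t x * f x - D t x * f (shift t x)
            - (adj t (shift t x) * f (shift t x)) * (1 + t * \<eta>1 x))"
      by (rule Bochner_Integration.integral_cong) (auto simp: D_def algebra_simps)
    also have "\<dots> = (LINT x|LOmega. quot t x * f x) - (LINT x|LOmega. D t x * f (shift t x))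
        - (LINT x|LOmega. (adj t (shift t x) * f (shift t x)) * (1 + t * \<eta>1 x))"
      using i1 i3 sub(1) by simp
    finally show "(LINT x|LOmega. quot t x * (f x - f (shift t x)))
      = (LINT x|LOmega. quot t x * f x) - (LINT x|LOmega. D t x * f (shift t x)) - (LINT x|LOmega. adj t x * f x)"
      using sub(2) by simp
    have bL2: "(\<lambda>x. 8 * M + avg x) \<in> L2" by (rule L2_add[OF const_L2 avg_L2])
    have cbL2: "(\<lambda>x. c * (8 * M + avg x)) \<in> L2"
      using bL2 by (auto simp: L2_def power_mult_distrib)
    have "L2_norm (\<lambda>x. 8 * M + avg x) \<le> L2_norm (\<lambda>x. 8 * M) + L2_norm avg"
      by (rule L2_norm_triangle[OF const_L2 avg_L2])
    also have "\<dots> \<le> 11 * M"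
    proof -
      have "L2_norm (\<lambda>x. 8 * M) = 8 * M"
        using L2_norm_cmult[of "8 * M" "\<lambda>x. 1"] M_nonneg
        by (simp add: L2_norm_def[of "\<lambda>x. 1"] L2_inner_def)
      then show ?thesis using avg_norm by linarith
    qed
    finally have "L2_norm (\<lambda>x. c * (8 * M + avg x)) \<le> c * (11 * M)"
      unfolding L2_norm_cmult[OF c] using c by (rule mult_left_mono)
    moreover have "\<bar>LINT x|LOmega. D t x * f (shift t x)\<bar>
        \<le> L2_norm (\<lambda>x. c * (8 * M + avg x)) * L2_norm (\<lambda>x. f (shift t x))"
    proof (rule L2_bound_integral(2)[OF continuous_on_LOmega[OF D_cont] cbL2 shift_compose_L2(2)[OF f zero a t1]])
      fix x assume x: "x \<in> Omega"
      have "t\<^sup>2 = s\<^sup>2" using t by (metis power2_abs)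
      then show "\<bar>D t x\<bar> \<le> c * (8 * M + avg x)"
        using adj_defect_bound[OF x t1] by (simp add: D_def c_def shift_def)
    qed
    moreover have "L2_norm (\<lambda>x. f (shift t x)) \<le> 2 * L2_norm f"
      by (rule shift_compose_L2(3)[OF f zero a t1])
    ultimately show "\<bar>LINT x|LOmega. D t x * f (shift t x)\<bar> \<le> c * (11 * M) * (2 * L2_norm f)"
      using c M_nonneg L2_norm_nonneg
      by (meson mult_mono mult_nonneg_nonneg order_trans zero_le_numeral)
  qed
  have U2f: "integrable LOmega (\<lambda>x. U 2 x * f x)"
    by (rule cs) (use fz f U_continuous[of 2] in \<open>auto intro!: continuous_intros\<close>)
  define S where "S x = quot s x + quot (- s) x + s\<^sup>2 * U 2 x" for x
  have "(LINT x|LOmega. adj s x * f x) + (LINT x|LOmega. adj (- s) x * f x)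
      = (LINT x|LOmega. adj s x * f x + adj (- s) x * f x)"
    using int2[of s] int2[of "- s"] by simp
  also have "\<dots> = (LINT x|LOmega. s\<^sup>2 * (U 2 x * f x))"
    by (rule Bochner_Integration.integral_cong)
      (use adj_even[of s] in \<open>auto simp flip: distrib_right mult.assoc\<close>)
  also have "\<dots> = s\<^sup>2 * (LINT x|LOmega. U 2 x * f x)" by simp
  finally have adj_sum: "(LINT x|LOmega. adj s x * f x) + (LINT x|LOmega. adj (- s) x * f x)
      = s\<^sup>2 * (LINT x|LOmega. U 2 x * f x)" .
  have "(LINT x|LOmega. S x * f x) = (LINT x|LOmega. quot s x * f x + quot (- s) x * f x + s\<^sup>2 * (U 2 x * f x))"
    by (rule Bochner_Integration.integral_cong) (auto simp: S_def algebra_simps)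
  also have "\<dots> = (LINT x|LOmega. quot s x * f x) + (LINT x|LOmega. quot (- s) x * f x)
      + s\<^sup>2 * (LINT x|LOmega. U 2 x * f x)"
    using int1[of s] int1[of "- s"] U2f by simp
  finally have quot_sum: "(LINT x|LOmega. S x * f x) = (LINT x|LOmega. quot s x * f x)
      + (LINT x|LOmega. quot (- s) x * f x) + s\<^sup>2 * (LINT x|LOmega. U 2 x * f x)" .
  have S_le: "\<bar>LINT x|LOmega. S x * f x\<bar> \<le> (2 * c) * (3 * M) * L2_norm f"
  proof -
    have caL2: "(\<lambda>x. 2 * c * avg x) \<in> L2"
      using avg_L2 by (auto simp: L2_def power_mult_distrib)
    have "S \<in> borel_measurable LOmega"
      unfolding S_def[abs_def]
      by (intro continuous_on_LOmega continuous_intros quot_continuous U_continuous) (use s in auto)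
    then have "\<bar>LINT x|LOmega. S x * f x\<bar> \<le> L2_norm (\<lambda>x. 2 * c * avg x) * L2_norm f"
      by (rule L2_bound_integral(2)[OF _ caL2 fL2])
        (use quot_even_bound s in \<open>auto simp: S_def c_def mult.assoc\<close>)
    also have "\<dots> \<le> (2 * c) * (3 * M) * L2_norm f"
    proof (rule mult_right_mono[OF _ L2_norm_nonneg])
      have "L2_norm (\<lambda>x. 2 * c * avg x) = 2 * c * L2_norm avg"
        using c by (intro L2_norm_cmult) simp
      also have "\<dots> \<le> 2 * c * (3 * M)"
        using c by (intro mult_left_mono avg_norm) simp
      finally show "L2_norm (\<lambda>x. 2 * c * avg x) \<le> 2 * c * (3 * M)" .
    qed
    finally show ?thesis .
  qed
  have total: "(LINT x|LOmega. quot s x * (f x - f (shift s x)))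
      + (LINT x|LOmega. quot (- s) x * (f x - f (shift (- s) x)))
      + 2 * s\<^sup>2 * (LINT x|LOmega. U 2 x * f x)
    = (LINT x|LOmega. S x * f x) - (LINT x|LOmega. D s x * f (shift s x))
      - (LINT x|LOmega. D (- s) x * f (shift (- s) x))"
    using slice[of s] slice[of "- s"] adj_sum quot_sum by simp
  show ?thesis
  proof -
    have "\<bar>(LINT x|LOmega. S x * f x) - (LINT x|LOmega. D s x * f (shift s x))
      - (LINT x|LOmega. D (- s) x * f (shift (- s) x))\<bar>
      \<le> (2 * c) * (3 * M) * L2_norm f + c * (11 * M) * (2 * L2_norm f) + c * (11 * M) * (2 * L2_norm f)"
      using S_le D_le[of s] D_le[of "- s"] by linarith
    also have "\<dots> = 50 * (K * \<delta>)\<^sup>2 * s\<^sup>2 * M * L2_norm f"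
      by (simp add: c_def)
    finally show ?thesis unfolding total .
  qed
qed

end

subsection \<open>The energy form\<close>

abbreviation LOmega2 :: "(real \<times> real) measure" where
  "LOmega2 \<equiv> LOmega \<Otimes>\<^sub>M LOmega"

lemma abs_lipschitz_continuous_on:
  fixes f :: "real \<Rightarrow> real"
  assumes "\<And>x y. x \<in> S \<Longrightarrow> y \<in> S \<Longrightarrow> \<bar>f x - f y\<bar> \<le> L * \<bar>x - y\<bar>"
  shows "continuous_on S f"
proof -
  have "(max L 0)-lipschitz_on S f"
  proof (rule lipschitz_onI)
    fix x y assume "x \<in> S" "y \<in> S"
    then show "dist (f x) (f y) \<le> max L 0 * dist x y"
      using assms[of x y] mult_right_mono[of L "max L 0" "\<bar>x - y\<bar>"] by (simp add: dist_real_def)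
  qed simp
  then show ?thesis by (rule lipschitz_on_continuous_on)
qed

lemma bounded_L2:
  assumes f: "f \<in> borel_measurable LOmega" and le: "\<And>x. x \<in> Omega \<Longrightarrow> \<bar>f x\<bar> \<le> B"
  shows "f \<in> L2"
proof -
  have "integrable LOmega (\<lambda>x. (f x)\<^sup>2)"
  proof (rule LO.integrable_const_bound)
    show "AE x in LOmega. norm ((f x)\<^sup>2) \<le> B\<^sup>2"
      using power_mono[OF le, of _ 2] by (intro AE_I2) simp
  qed (use f in simp)
  then show ?thesis using f by (simp add: L2_def)
qed

lemma LOmega_integral_lborel:
  fixes h :: "real \<Rightarrow> real"
  assumes h: "h \<in> borel_measurable borel"
  shows "(LINT x|LOmega. h x) = (LINT x|lborel. indicator Omega x * h x)"
proof -
  have "(LINT x|LOmega. h x) = (LINT x|lebesgue. indicator Omega x * h x)"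
    by (simp add: integral_restrict_space)
  also have "\<dots> = (LINT x|lborel. indicator Omega x * h x)"
    by (rule integral_completion) (use h in measurable)
  finally show ?thesis .
qed

lemma LOmega_nn_integral_lborel:
  fixes h :: "real \<Rightarrow> ennreal"
  shows "(\<integral>\<^sup>+x. h x \<partial>LOmega) = (\<integral>\<^sup>+x. h x * indicator Omega x \<partial>lborel)"
  by (simp add: nn_integral_restrict_space nn_integral_completion)

text \<open>The reference kernel: \<open>ker x\<close> below is its rescaling to the ball of radius \<open>\<eta> x\<close> around \<open>x\<close>,
  normalized so that the second moment is \<open>1\<close>.\<close>

definition ref_ker :: "real \<Rightarrow> real \<Rightarrow> real" where
  "ref_ker \<beta> s = (3 - \<beta>) / 2 * \<bar>s\<bar> powr (- \<beta>) * indicator {-1<..<1} s"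

lemma ref_ker_measurable [measurable]: "ref_ker \<beta> \<in> borel_measurable borel"
  unfolding ref_ker_def by measurable

lemma ref_ker_nonneg: "\<beta> < 3 \<Longrightarrow> 0 \<le> ref_ker \<beta> s"
  by (simp add: ref_ker_def)

lemma ref_ker_even: "ref_ker \<beta> (- s) = ref_ker \<beta> s"
  by (auto simp: ref_ker_def indicator_def)

text \<open>The integral of \<open>\<bar>s\<bar> powr (2 - \<beta>)\<close> over
  \<open>{-1<..<1}\<close> is \<open>2 / (3 - \<beta>)\<close>, whence the normalizing factor. The
  condition \<open>\<beta> < 3\<close> makes it finite, whereas \<open>ref_ker\<close> itself is not
  integrable once \<open>\<beta> \<ge> 1\<close>.\<close>

lemma ref_ker_second_moment:
  assumes "\<beta> < 3"
  shows "integrable lborel (\<lambda>s. ref_ker \<beta> s * s\<^sup>2)" "(LINT s|lborel. ref_ker \<beta> s * s\<^sup>2) = 1"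
proof -
  \<comment> \<open>One half of the integrand: the power rule starts at 0, and the reflected copy
    supplies the other half.\<close>
  define h where "h s = indicator {0..<1} s * s powr (2 - \<beta>)" for s :: real
  have h_meas: "h \<in> borel_measurable borel" unfolding h_def by measurable
  have "(\<integral>\<^sup>+s. ennreal (h s) \<partial>lborel) = (\<integral>\<^sup>+s. ennreal (indicator {0..1} s * s powr (2 - \<beta>)) \<partial>lborel)"
  proof (rule nn_integral_cong_AE)
    show "AE s in lborel. ennreal (h s) = ennreal (indicator {0..1} s * s powr (2 - \<beta>))"
      using AE_lborel_singleton[of 1] by eventually_elim (auto simp: h_def indicator_def)
  qed
  also have "\<dots> = ennreal (1 powr (2 - \<beta> + 1) / (2 - \<beta> + 1))"
    by (rule nn_integral_has_integral_lebesgue[OF _ has_integral_powr_from_0]) (use assms in auto)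
  also have "1 powr (2 - \<beta> + 1) / (2 - \<beta> + 1) = 1 / (3 - \<beta>)" by simp
  finally have "has_bochner_integral lborel h (1 / (3 - \<beta>))"
    using h_meas assms by (intro has_bochner_integral_nn_integral) (auto simp: h_def)
  then have h: "integrable lborel h" "(LINT s|lborel. h s) = 1 / (3 - \<beta>)"
    by (auto simp: has_bochner_integral_iff)
  have h': "integrable lborel (\<lambda>s. h (- s))" "(LINT s|lborel. h (- s)) = 1 / (3 - \<beta>)"
    using lborel_integrable_real_affine[OF h(1), of "-1" 0] lborel_integral_real_affine[of "-1" h 0] h(2)
    by auto
  have eq: "ref_ker \<beta> s * s\<^sup>2 = (3 - \<beta>) / 2 * (h s + h (- s))" for s
  proof (cases "s = 0")
    case False
    have "\<bar>s\<bar> powr (- \<beta>) * s\<^sup>2 = \<bar>s\<bar> powr (- \<beta>) * \<bar>s\<bar> powr 2"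
      using False by (simp add: powr_numeral)
    also have "\<dots> = \<bar>s\<bar> powr (- \<beta> + 2)" by (rule powr_add[symmetric])
    also have "- \<beta> + 2 = 2 - \<beta>" by simp
    finally have "\<bar>s\<bar> powr (- \<beta>) * s\<^sup>2 = \<bar>s\<bar> powr (2 - \<beta>)" .
    moreover have "h s + h (- s) = indicator {-1<..<1} s * \<bar>s\<bar> powr (2 - \<beta>)"
      using False by (auto simp: h_def indicator_def)
    ultimately show ?thesis by (simp add: ref_ker_def mult_ac)
  qed (simp add: h_def)
  show "integrable lborel (\<lambda>s. ref_ker \<beta> s * s\<^sup>2)"
    unfolding eq using h(1) h'(1) by simp
  show "(LINT s|lborel. ref_ker \<beta> s * s\<^sup>2) = 1"
    unfolding eq using h h' assms by (simp add: field_simps)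
qed

section \<open>The rescaled kernel and the energy as an integral over the product space\<close>

locale horizon_form = horizon +
  fixes \<beta> :: real
  assumes \<beta>_less_3: "\<beta> < 3"
begin

text \<open>On the diagonal \<open>0 powr \<beta> = 0\<close> and division by zero gives 0, so
  \<open>ker x x = 0\<close>. In the same way \<open>ref_ker \<beta> 0 = 0\<close>, and
  \<open>ker_shift\<close> includes \<open>s = 0\<close>.\<close>

definition ker :: "real \<Rightarrow> real \<Rightarrow> real" where
  "ker x y = (3 - \<beta>) / 2 * \<eta> x powr (- (3 - \<beta>)) * indicator {y. \<bar>y - x\<bar> < \<eta> x} y / \<bar>x - y\<bar> powr \<beta>"

lemma ker_nonneg: "0 \<le> ker x y"
  using \<beta>_less_3 by (simp add: ker_def)

text \<open>The scaling behind the exponent \<open>3 - \<beta>\<close>: for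
  \<open>y = x + \<eta> x * s\<close>, the powers of \<open>\<eta> x\<close> coming from the weight,
  the kernel and \<open>dy\<close> multiply to \<open>\<eta>\<^sup>-\<^sup>2\<close>, and the
  remaining factor depends on \<open>s\<close> alone.\<close>

lemma ker_shift:
  assumes x: "x \<in> Omega"
  shows "\<eta> x * ker x (x + \<eta> x * s) = ref_ker \<beta> s / (\<eta> x)\<^sup>2"
proof -
  define e where "e = \<eta> x"
  have e: "0 < e" using \<eta>_pos[OF x] by (simp add: e_def)
  have ind: "indicator {y. \<bar>y - x\<bar> < \<eta> x} (x + \<eta> x * s) = (indicator {-1<..<1} s :: real)"
    using e by (auto simp: indicator_def abs_mult simp flip: e_def)
  have "e * (e powr (- (3 - \<beta>)) / \<bar>x - (x + e * s)\<bar> powr \<beta>) = \<bar>s\<bar> powr (- \<beta>) / e\<^sup>2"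
  proof -
    have "\<bar>x - (x + e * s)\<bar> powr \<beta> = e powr \<beta> * \<bar>s\<bar> powr \<beta>"
      using e by (simp add: abs_mult powr_mult)
    moreover have "e powr (- (3 - \<beta>)) = e powr \<beta> / e ^ 3"
      using e by (simp add: powr_diff powr_numeral)
    ultimately show ?thesis
      using e by (simp add: powr_minus_divide power2_eq_square power3_eq_cube)
  qed
  note scaled = this
  have "e * ((3 - \<beta>) / 2 * e powr (- (3 - \<beta>)) * indicator {-1<..<1} s / \<bar>x - (x + e * s)\<bar> powr \<beta>)
      = (3 - \<beta>) / 2 * indicator {-1<..<1} s * (e * (e powr (- (3 - \<beta>)) / \<bar>x - (x + e * s)\<bar> powr \<beta>))"
    by simp
  also have "\<dots> = (3 - \<beta>) / 2 * \<bar>s\<bar> powr (- \<beta>) * indicator {-1<..<1} s / e\<^sup>2"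
    unfolding scaled by simp
  finally show ?thesis
    unfolding ker_def ref_ker_def ind by (simp only: e_def)
qed

lemma ker_measurable:
  "(\<lambda>p. ker (fst p) (snd p)) \<in> borel_measurable LOmega2"
proof -
  note [measurable] = \<eta>_measurable
  have "(\<lambda>p. (3 - \<beta>) / 2 * \<eta> (fst p) powr (- (3 - \<beta>))
      * (if \<bar>snd p - fst p\<bar> < \<eta> (fst p) then 1 else 0) / \<bar>fst p - snd p\<bar> powr \<beta>)
      \<in> borel_measurable LOmega2"
    by measurable
  then show ?thesis by (simp add: ker_def indicator_def)
qed

lemma ker_measurable_snd: "(\<lambda>y. ker x y) \<in> borel_measurable borel"
  unfolding ker_def by measurable

lemma slice_substitution:
  assumes x: "x \<in> Omega" and P: "P \<in> borel_measurable borel"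
  shows "(LINT y|LOmega. ker x y * P y) = (LINT s|lborel. ref_ker \<beta> s / (\<eta> x)\<^sup>2 * P (x + \<eta> x * s))"
proof -
  have e: "0 < \<eta> x" by (rule \<eta>_pos[OF x])
  have "(LINT y|LOmega. ker x y * P y) = (LINT y|lborel. indicator Omega y * (ker x y * P y))"
    by (rule LOmega_integral_lborel) (use P ker_measurable_snd in measurable)
  also have "\<dots> = \<bar>\<eta> x\<bar> *\<^sub>R (LINT s|lborel. indicator Omega (x + \<eta> x * s) * (ker x (x + \<eta> x * s) * P (x + \<eta> x * s)))"
    using e by (intro lborel_integral_real_affine) simp
  also have "\<dots> = (LINT s|lborel. \<eta> x * (indicator Omega (x + \<eta> x * s) * (ker x (x + \<eta> x * s) * P (x + \<eta> x * s))))"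
    using e by simp
  also have "\<dots> = (LINT s|lborel. ref_ker \<beta> s / (\<eta> x)\<^sup>2 * P (x + \<eta> x * s))"
  proof (rule Bochner_Integration.integral_cong)
    fix s :: real
    show "\<eta> x * (indicator Omega (x + \<eta> x * s) * (ker x (x + \<eta> x * s) * P (x + \<eta> x * s)))
        = ref_ker \<beta> s / (\<eta> x)\<^sup>2 * P (x + \<eta> x * s)"
    \<comment> \<open>For \<open>\<bar>s\<bar> < 1\<close> the shifted point stays in
      \<open>Omega\<close> and the indicator is 1; otherwise both sides vanish.\<close>
    proof (cases "\<bar>s\<bar> < 1")
      case True
      then have "x + \<eta> x * s \<in> Omega"
        using shift_in_Omega[OF x, of s] by (simp add: shift_def mult.commute)
      then show ?thesis by (simp add: ker_shift[OF x, of s] mult.assoc[symmetric])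
    next
      case False
      then have "ref_ker \<beta> s = 0" by (auto simp: ref_ker_def indicator_def)
      then show ?thesis using ker_shift[OF x, of s] e by simp
    qed
  qed simp
  finally show ?thesis .
qed

text \<open>The factor \<open>(x - y)\<^sup>2 = (\<eta> x * s)\<^sup>2\<close> cancels
  \<open>\<eta>\<^sup>-\<^sup>2\<close> and leaves the second moment of \<open>ref_ker\<close>. The
  bound is uniform in \<open>x\<close> and \<open>\<delta>\<close>, which later makes the energy of
  Lipschitz functions uniformly bounded.\<close>

lemma ker_second_moment:
  assumes x: "x \<in> Omega"
  shows "(\<integral>\<^sup>+y. ennreal (ker x y * (x - y)\<^sup>2) \<partial>LOmega) \<le> 1"
proof -
  have e: "0 < \<eta> x" by (rule \<eta>_pos[OF x])
  have "(\<integral>\<^sup>+y. ennreal (ker x y * (x - y)\<^sup>2) \<partial>LOmega)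
      = (\<integral>\<^sup>+y. ennreal (ker x y * (x - y)\<^sup>2) * indicator Omega y \<partial>lborel)"
    by (rule LOmega_nn_integral_lborel)
  also have "\<dots> \<le> (\<integral>\<^sup>+y. ennreal (ker x y * (x - y)\<^sup>2) \<partial>lborel)"
    by (rule nn_integral_mono) (auto simp: indicator_def)
  also have "\<dots> = ennreal \<bar>\<eta> x\<bar> * (\<integral>\<^sup>+s. ennreal (ker x (x + \<eta> x * s) * (x - (x + \<eta> x * s))\<^sup>2) \<partial>lborel)"
    by (rule nn_integral_real_affine) (use e ker_measurable_snd in \<open>auto intro!: measurable_compose[OF _ measurable_ennreal] borel_measurable_times\<close>)
  also have "\<dots> = (\<integral>\<^sup>+s. ennreal \<bar>\<eta> x\<bar> * ennreal (ker x (x + \<eta> x * s) * (x - (x + \<eta> x * s))\<^sup>2) \<partial>lborel)"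
    by (rule nn_integral_cmult[symmetric])
      (use measurable_compose[OF _ ker_measurable_snd[of x], of "\<lambda>s. x + \<eta> x * s" borel] in measurable)
  also have "\<dots> = (\<integral>\<^sup>+s. ennreal (ref_ker \<beta> s * s\<^sup>2) \<partial>lborel)"
  proof (rule nn_integral_cong)
    fix s :: real
    have "\<eta> x * (ker x (x + \<eta> x * s) * (x - (x + \<eta> x * s))\<^sup>2) = (\<eta> x * ker x (x + \<eta> x * s)) * (\<eta> x)\<^sup>2 * s\<^sup>2"
      by (simp add: power_mult_distrib)
    also have "\<dots> = ref_ker \<beta> s * s\<^sup>2"
      unfolding ker_shift[OF x] using e by simp
    finally show "ennreal \<bar>\<eta> x\<bar> * ennreal (ker x (x + \<eta> x * s) * (x - (x + \<eta> x * s))\<^sup>2) = ennreal (ref_ker \<beta> s * s\<^sup>2)"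
      using e ker_nonneg by (simp add: ennreal_mult[symmetric])
  qed
  also have "\<dots> = ennreal (LINT s|lborel. ref_ker \<beta> s * s\<^sup>2)"
    by (rule nn_integral_eq_integral)
      (use ref_ker_second_moment[OF \<beta>_less_3] ref_ker_nonneg[OF \<beta>_less_3] in auto)
  finally show ?thesis using ref_ker_second_moment[OF \<beta>_less_3] by simp
qed

definition energy_density :: "(real \<Rightarrow> real) \<Rightarrow> (real \<Rightarrow> real) \<Rightarrow> real \<times> real \<Rightarrow> real" where
  "energy_density u v p = ker (fst p) (snd p) * ((u (fst p) - u (snd p)) * (v (fst p) - v (snd p)))"

text \<open>An integral over the product space instead of the iterated one in
  \<open>B_delta\<close>: bilinearity, Cauchy-Schwarz and dominated convergence are applied to
  jointly integrable densities. \<open>energy_iterated\<close> recovers the iterated form.\<close>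

definition energy :: "(real \<Rightarrow> real) \<Rightarrow> (real \<Rightarrow> real) \<Rightarrow> real" where
  "energy u v = (LINT p|LOmega2. energy_density u v p)"

abbreviation finite_energy :: "(real \<Rightarrow> real) \<Rightarrow> bool" where
  "finite_energy u \<equiv> u \<in> borel_measurable LOmega \<and> integrable LOmega2 (energy_density u u)"

lemma energy_density_measurable:
  assumes [measurable]: "u \<in> borel_measurable LOmega" "v \<in> borel_measurable LOmega"
  shows "energy_density u v \<in> borel_measurable LOmega2"
proof -
  note [measurable] = ker_measurable
  show ?thesis unfolding energy_density_def[abs_def] by measurable
qed

lemma energy_density_nonneg: "0 \<le> energy_density u u p"
  unfolding energy_density_def by (rule mult_nonneg_nonneg[OF ker_nonneg zero_le_square])

lemma energy_iterated:
  assumes "integrable LOmega2 (energy_density u v)"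
  shows "(LINT x|LOmega. LINT y|LOmega. energy_density u v (x, y)) = energy u v"
  unfolding energy_def by (rule LO2.integral_fst'[OF assms])

lemma finite_energy_integrable:
  assumes "finite_energy u" "finite_energy v"
  shows "integrable LOmega2 (energy_density u v)"
proof (rule Bochner_Integration.integrable_bound)
  show "integrable LOmega2 (\<lambda>p. energy_density u u p + energy_density v v p)"
    using assms by simp
  show "energy_density u v \<in> borel_measurable LOmega2"
    using assms by (intro energy_density_measurable) auto
  have "\<bar>energy_density u v p\<bar> \<le> energy_density u u p + energy_density v v p" for p
    unfolding energy_density_def abs_mult[of "ker _ _"] distrib_left[symmetric]
    using ker_nonneg abs_mult_le_squares by (simp add: mult_left_mono power2_eq_square)
  then show "AE p in LOmega2. norm (energy_density u v p)
      \<le> norm (energy_density u u p + energy_density v v p)"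
    using energy_density_nonneg by (intro AE_I2) (simp add: add_nonneg_nonneg)
qed

lemma energy_density_lincomb_right:
  "energy_density w (\<lambda>x. u x + c * v x) p = energy_density w u p + c * energy_density w v p"
  by (simp add: energy_density_def algebra_simps)

lemma energy_density_commute: "energy_density u v p = energy_density v u p"
  by (simp add: energy_density_def mult_ac)

lemma energy_commute: "energy u v = energy v u"
  unfolding energy_def by (rule Bochner_Integration.integral_cong[OF refl energy_density_commute])

lemma finite_energy_lincomb:
  assumes u: "finite_energy u" and v: "finite_energy v"
  shows "finite_energy (\<lambda>x. u x + c * v x)"
proof -
  have "energy_density (\<lambda>x. u x + c * v x) (\<lambda>x. u x + c * v x) p
      = energy_density u u p + 2 * c * energy_density u v p + c\<^sup>2 * energy_density v v p" for p
    unfolding energy_density_lincomb_right energy_density_commute[of "\<lambda>x. u x + c * v x"]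
    by (simp add: energy_density_commute[of v u] algebra_simps power2_eq_square)
  then have "energy_density (\<lambda>x. u x + c * v x) (\<lambda>x. u x + c * v x)
      = (\<lambda>p. energy_density u u p + 2 * c * energy_density u v p + c\<^sup>2 * energy_density v v p)"
    by (rule ext)
  then show ?thesis
    using u v finite_energy_integrable[OF u v] by auto
qed

lemma energy_lincomb_right:
  assumes "finite_energy u" "finite_energy v" "finite_energy w"
  shows "energy w (\<lambda>x. u x + c * v x) = energy w u + c * energy w v"
  unfolding energy_def energy_density_lincomb_right
  using finite_energy_integrable[OF assms(3,1)] finite_energy_integrable[OF assms(3,2)] by simp

lemma energy_Cauchy_Schwarz:
  assumes u: "finite_energy u" and v: "finite_energy v"
  shows "(energy u v)\<^sup>2 \<le> energy u u * energy v v"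
proof (rule nonneg_quadratic_discriminant)
  fix t
  have "0 \<le> energy (\<lambda>x. v x + - t * u x) (\<lambda>x. v x + - t * u x)"
    unfolding energy_def by (intro Bochner_Integration.integral_nonneg energy_density_nonneg)
  also have "\<dots> = energy u u * t\<^sup>2 - 2 * energy u v * t + energy v v"
  proof -
    note fe = finite_energy_lincomb[OF v u, of "- t"]
    show ?thesis
      unfolding energy_lincomb_right[OF v u fe] energy_commute[of "\<lambda>x. v x + - t * u x"]
        energy_lincomb_right[OF v u u] energy_lincomb_right[OF v u v]
      by (simp add: energy_commute[of v u] algebra_simps power2_eq_square)
  qed
  finally show "0 \<le> energy u u * t\<^sup>2 - 2 * energy u v * t + energy v v" .
next
  show "0 \<le> energy u u"
    unfolding energy_def by (intro Bochner_Integration.integral_nonneg energy_density_nonneg)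
qed

text \<open>Up to the product of their Lipschitz constants, the integrable function that dominates
  the energy density of two Lipschitz functions.\<close>

definition moment :: "real \<times> real \<Rightarrow> real" where
  "moment p = ker (fst p) (snd p) * (fst p - snd p)\<^sup>2"

lemma moment_integrable: "integrable LOmega2 moment"
  and moment_integral_le: "(LINT p|LOmega2. moment p) \<le> 1"
proof -
  have m: "moment \<in> borel_measurable LOmega2"
  proof -
    note [measurable] = ker_measurable
    show ?thesis unfolding moment_def[abs_def] by measurable
  qed
  have nn: "0 \<le> moment p" for p using ker_nonneg by (simp add: moment_def)
  have "(\<integral>\<^sup>+p. ennreal (moment p) \<partial>LOmega2)
      = (\<integral>\<^sup>+x. \<integral>\<^sup>+y. ennreal (moment (x, y)) \<partial>LOmega \<partial>LOmega)"
    by (rule LO.nn_integral_fst[symmetric]) (use m in measurable)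
  also have "\<dots> \<le> (\<integral>\<^sup>+x. 1 \<partial>LOmega)"
    by (rule nn_integral_mono) (use ker_second_moment in \<open>simp add: moment_def\<close>)
  also have "\<dots> = 1"
    by (simp add: emeasure_restrict_space)
  finally have le: "(\<integral>\<^sup>+p. ennreal (moment p) \<partial>LOmega2) \<le> 1" .
  show int: "integrable LOmega2 moment"
    by (rule integrableI_nonneg[OF m]) (use nn le in \<open>auto simp: less_top[symmetric] top_unique\<close>)
  have "ennreal (LINT p|LOmega2. moment p) \<le> ennreal 1"
    using le nn_integral_eq_integral[OF int] nn by simp
  then show "(LINT p|LOmega2. moment p) \<le> 1"
    by (subst (asm) ennreal_le_iff) auto
qed

lemma energy_density_lipschitz:
  assumes u: "\<And>x y. x \<in> Omega \<Longrightarrow> y \<in> Omega \<Longrightarrow> \<bar>u x - u y\<bar> \<le> A * \<bar>x - y\<bar>"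
    and v: "\<And>x y. x \<in> Omega \<Longrightarrow> y \<in> Omega \<Longrightarrow> \<bar>v x - v y\<bar> \<le> B * \<bar>x - y\<bar>"
    and p: "p \<in> Omega \<times> Omega" and AB: "0 \<le> A" "0 \<le> B"
  shows "\<bar>energy_density u v p\<bar> \<le> A * B * moment p"
proof -
  obtain x y where xy: "p = (x, y)" "x \<in> Omega" "y \<in> Omega" using p by auto
  have "\<bar>(u x - u y) * (v x - v y)\<bar> \<le> (A * \<bar>x - y\<bar>) * (B * \<bar>x - y\<bar>)"
    unfolding abs_mult using u[OF xy(2,3)] v[OF xy(2,3)] AB by (intro mult_mono) auto
  also have "\<dots> = A * B * (x - y)\<^sup>2"
    by (simp add: power2_eq_square)
  finally have "ker x y * \<bar>(u x - u y) * (v x - v y)\<bar> \<le> ker x y * (A * B * (x - y)\<^sup>2)"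
    by (rule mult_left_mono[OF _ ker_nonneg])
  then show ?thesis
    using ker_nonneg[of x y] by (simp add: xy(1) energy_density_def moment_def abs_mult mult_ac)
qed

lemma lipschitz_measurable:
  fixes u :: "real \<Rightarrow> real"
  assumes "\<And>x y. x \<in> Omega \<Longrightarrow> y \<in> Omega \<Longrightarrow> \<bar>u x - u y\<bar> \<le> A * \<bar>x - y\<bar>"
  shows "u \<in> borel_measurable LOmega"
  by (rule continuous_on_LOmega[OF abs_lipschitz_continuous_on[OF assms]])

lemma lipschitz_energy:
  assumes u: "\<And>x y. x \<in> Omega \<Longrightarrow> y \<in> Omega \<Longrightarrow> \<bar>u x - u y\<bar> \<le> A * \<bar>x - y\<bar>"
    and v: "\<And>x y. x \<in> Omega \<Longrightarrow> y \<in> Omega \<Longrightarrow> \<bar>v x - v y\<bar> \<le> B * \<bar>x - y\<bar>"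
    and AB: "0 \<le> A" "0 \<le> B"
  shows "integrable LOmega2 (energy_density u v)" "\<bar>energy u v\<bar> \<le> A * B"
proof -
  have le: "\<bar>energy_density u v p\<bar> \<le> A * B * moment p" if "p \<in> space LOmega2" for p
    using energy_density_lipschitz[OF u v _ AB, of p] that by (simp add: space_pair_measure)
  have m: "integrable LOmega2 (\<lambda>p. A * B * moment p)"
    using moment_integrable by simp
  show int: "integrable LOmega2 (energy_density u v)"
  proof (rule Bochner_Integration.integrable_bound[OF m])
    show "energy_density u v \<in> borel_measurable LOmega2"
      by (intro energy_density_measurable lipschitz_measurable[OF u] lipschitz_measurable[OF v])
    show "AE p in LOmega2. norm (energy_density u v p) \<le> norm (A * B * moment p)"
      using le by (intro AE_I2) fastforce
  qed
  have "\<bar>energy u v\<bar> \<le> (LINT p|LOmega2. \<bar>energy_density u v p\<bar>)"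
    unfolding energy_def using integral_norm_bound[of _ "energy_density u v"] by simp
  also have "\<dots> \<le> (LINT p|LOmega2. A * B * moment p)"
    by (rule Bochner_Integration.integral_mono) (use int m le in auto)
  also have "\<dots> = A * B * (LINT p|LOmega2. moment p)" by simp
  also have "\<dots> \<le> A * B"
    using moment_integral_le AB by (simp add: mult_left_le)
  finally show "\<bar>energy u v\<bar> \<le> A * B" .
qed

end

subsection \<open>The consistency estimate\<close>

locale horizon_H4_form =
  horizon_H4 \<eta> \<eta>1 \<eta>2 \<eta>3 K \<delta> U g M + horizon_form \<eta> \<eta>1 \<eta>2 \<eta>3 K \<delta> \<beta>
  for \<eta> \<eta>1 \<eta>2 \<eta>3 :: "real \<Rightarrow> real" and K \<delta> :: real and U g M and \<beta> :: real
begin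

lemma U_lipschitz:
  assumes "x \<in> Omega" "y \<in> Omega"
  shows "\<bar>U 0 x - U 0 y\<bar> \<le> M * \<bar>x - y\<bar>"
proof (rule DERIV_bound_interval[of "min x y" "max x y" "U 0" "U 1"])
  fix t assume "t \<in> {min x y..max x y}"
  then have "t \<in> Omega" using assms by auto
  then show "(U 0 has_real_derivative U 1 t) (at t)" by (rule U_DERIV'(1))
  show "\<bar>U 1 t\<bar> \<le> M" by (rule U_le) simp
qed auto

text \<open>The substitution in \<open>y\<close> at fixed \<open>x\<close> makes \<open>s\<close>
  the inner variable, and Fubini moves it outside. Joint integrability comes from the two Lipschitz
  bounds: their product \<open>M * L * (s * \<eta> x)\<^sup>2\<close> cancels
  \<open>\<eta>\<^sup>-\<^sup>2\<close> and leaves the second moment of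
  \<open>ref_ker\<close>.\<close>

lemma energy_as_slices:
  assumes f: "\<And>x y. x \<in> Omega \<Longrightarrow> y \<in> Omega \<Longrightarrow> \<bar>f x - f y\<bar> \<le> L * \<bar>x - y\<bar>"
    and zero: "\<And>x. x \<notin> Omega \<Longrightarrow> f x = 0" and L: "0 \<le> L"
  defines "I \<equiv> \<lambda>s. LINT x|LOmega. quot s x * (f x - f (shift s x))"
  shows "integrable lborel (\<lambda>s. ref_ker \<beta> s * I s)" "energy (U 0) f = (LINT s|lborel. ref_ker \<beta> s * I s)"
proof -
  have f_cont: "continuous_on Omega f" by (rule abs_lipschitz_continuous_on[OF f])
  \<comment> \<open>Extension by zero gives Borel functions on the whole line, so that joint
    measurability in \<open>x\<close> and \<open>s\<close> can be checked for \<open>lborel\<close>;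
    for \<open>x\<close> in \<open>Omega\<close> and \<open>\<bar>s\<bar> < 1\<close> nothing
    changes.\<close>
  define Ue where "Ue x = indicator Omega x * U 0 x" for x
  define \<eta>e where "\<eta>e x = indicator Omega x * \<eta> x" for x
  have [measurable]: "Ue \<in> borel_measurable borel" "\<eta>e \<in> borel_measurable borel" "f \<in> borel_measurable borel"
  proof -
    show "Ue \<in> borel_measurable borel"
      using borel_measurable_continuous_on_indicator[of Omega "U 0"] U_continuous[of 0]
      by (simp add: Ue_def[abs_def])
    show "\<eta>e \<in> borel_measurable borel"
      using borel_measurable_continuous_on_indicator[of Omega \<eta>] \<eta>_continuous(1)
      by (simp add: \<eta>e_def[abs_def])
    have "(\<lambda>x. indicator Omega x *\<^sub>R f x) = f"
    proof
      show "indicator Omega x *\<^sub>R f x = f x" for x using zero[of x] by (cases "x \<in> Omega") auto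
    qed
    then show "f \<in> borel_measurable borel"
      using borel_measurable_continuous_on_indicator[of Omega f] f_cont by simp
  qed
  define H where "H s x = (Ue x - Ue (x + s * \<eta>e x)) / (\<eta>e x)\<^sup>2 * (f x - f (x + s * \<eta>e x))" for s x
  define J where "J x s = indicator Omega x * (ref_ker \<beta> s * H s x)" for x s
  have H_meas [measurable]: "H s \<in> borel_measurable borel" for s
    unfolding H_def by measurable
  have J_meas: "(\<lambda>(x, s). J x s) \<in> borel_measurable (lborel \<Otimes>\<^sub>M lborel)"
    unfolding J_def H_def split_beta' by measurable
  have H_eq: "H s x = quot s x * (f x - f (shift s x))" if "x \<in> Omega" "\<bar>s\<bar> < 1" for x s
    using that shift_in_Omega[OF that(1), of s]
    by (simp add: H_def Ue_def \<eta>e_def quot_def shift_def)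
  have J_zero: "J x s = 0" if "\<not> \<bar>s\<bar> < 1" for x s
    using that by (auto simp: J_def ref_ker_def indicator_def)
  have J_le: "\<bar>J x s\<bar> \<le> indicator Omega x * (M * L * (ref_ker \<beta> s * s\<^sup>2))" for x s
  proof (cases "x \<in> Omega \<and> \<bar>s\<bar> < 1")
    case True
    then have x: "x \<in> Omega" and s: "\<bar>s\<bar> \<le> 1" "\<bar>s\<bar> < 1" by auto
    have sx: "shift s x \<in> Omega" by (rule shift_in_Omega[OF x s(1)])
    have e: "0 < \<eta> x" by (rule \<eta>_pos[OF x])
    have d: "\<bar>x - shift s x\<bar> = \<bar>s\<bar> * \<eta> x" using e by (simp add: shift_def abs_mult)
    have "\<bar>(U 0 x - U 0 (shift s x)) * (f x - f (shift s x))\<bar> \<le> (M * (\<bar>s\<bar> * \<eta> x)) * (L * (\<bar>s\<bar> * \<eta> x))"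
      unfolding abs_mult[of "_ - _"] d[symmetric]
      using U_lipschitz[OF x sx] f[OF x sx] M_nonneg L by (intro mult_mono) auto
    also have "\<dots> = M * L * s\<^sup>2 * (\<eta> x)\<^sup>2"
      by (simp add: power2_eq_square)
    finally have "\<bar>quot s x * (f x - f (shift s x))\<bar> \<le> M * L * s\<^sup>2"
      using e by (simp add: quot_def shift_def abs_mult pos_divide_le_eq)
    then have "ref_ker \<beta> s * \<bar>H s x\<bar> \<le> ref_ker \<beta> s * (M * L * s\<^sup>2)"
      unfolding H_eq[OF x s(2)] by (rule mult_left_mono[OF _ ref_ker_nonneg[OF \<beta>_less_3]])
    then show ?thesis
      using x ref_ker_nonneg[OF \<beta>_less_3, of s] by (simp add: J_def abs_mult mult_ac)
  next
    case False
    then have "J x s = 0" using J_zero by (auto simp: J_def)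
    then show ?thesis
      using ref_ker_nonneg[OF \<beta>_less_3, of s] M_nonneg L by simp
  qed
  have dom: "integrable (lborel \<Otimes>\<^sub>M lborel) (\<lambda>(x, s). indicator Omega x * (M * L * (ref_ker \<beta> s * s\<^sup>2)))"
  proof (rule lborel_pair.Fubini_integrable)
    have rk: "integrable lborel (\<lambda>s. M * L * (ref_ker \<beta> s * s\<^sup>2))"
      using ref_ker_second_moment(1)[OF \<beta>_less_3] by simp
    have "integrable lborel (\<lambda>x. indicator Omega x * (LINT s|lborel. \<bar>M * L * (ref_ker \<beta> s * s\<^sup>2)\<bar>))"
      by (intro integrable_mult_left) simp
    then show "integrable lborel (\<lambda>x. LINT s|lborel. norm (case (x, s) of (x, s) \<Rightarrow> indicator Omega x * (M * L * (ref_ker \<beta> s * s\<^sup>2))))"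
      by (simp add: abs_mult)
    show "AE x in lborel. integrable lborel (\<lambda>s. case (x, s) of (x, s) \<Rightarrow> indicator Omega x * (M * L * (ref_ker \<beta> s * s\<^sup>2)))"
      using rk by (intro AE_I2) simp
  qed measurable
  have J_int: "integrable (lborel \<Otimes>\<^sub>M lborel) (\<lambda>(x, s). J x s)"
  proof (rule Bochner_Integration.integrable_bound[OF dom J_meas], rule AE_I2)
    fix p :: "real \<times> real"
    show "norm (case p of (x, s) \<Rightarrow> J x s)
        \<le> norm (case p of (x, s) \<Rightarrow> indicator Omega x * (M * L * (ref_ker \<beta> s * s\<^sup>2)))"
      by (cases p) (auto simp only: prod.case real_norm_def intro: order_trans[OF J_le abs_ge_self])
  qed
  have inner_x: "(LINT y|LOmega. energy_density (U 0) f (x, y)) = (LINT s|lborel. J x s)" if x: "x \<in> Omega" for x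
  proof -
    define P where "P y = (U 0 x - Ue y) * (f x - f y)" for y
    have P_meas: "P \<in> borel_measurable borel" unfolding P_def by measurable
    have "(LINT y|LOmega. energy_density (U 0) f (x, y)) = (LINT y|LOmega. ker x y * P y)"
      by (rule Bochner_Integration.integral_cong) (auto simp: energy_density_def P_def Ue_def)
    also have "\<dots> = (LINT s|lborel. ref_ker \<beta> s / (\<eta> x)\<^sup>2 * P (x + \<eta> x * s))"
      by (rule slice_substitution[OF x P_meas])
    also have "\<dots> = (LINT s|lborel. J x s)"
      using x by (intro Bochner_Integration.integral_cong)
        (auto simp: J_def H_def P_def Ue_def \<eta>e_def mult.commute[of s for s])
    finally show ?thesis .
  qed
  have inner_s: "(LINT x|lborel. J x s) = ref_ker \<beta> s * I s" for s
  proof (cases "\<bar>s\<bar> < 1")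
    case True
    have "I s = (LINT x|LOmega. H s x)"
      unfolding I_def by (rule Bochner_Integration.integral_cong) (use True H_eq in auto)
    also have "\<dots> = (LINT x|lborel. indicator Omega x * H s x)"
      by (rule LOmega_integral_lborel) (rule H_meas)
    finally show ?thesis by (simp add: J_def mult.left_commute[of "indicator Omega _"])
  next
    case False
    then show ?thesis using J_zero by (auto simp: ref_ker_def indicator_def)
  qed
  show "integrable lborel (\<lambda>s. ref_ker \<beta> s * I s)"
    using lborel_pair.integrable_snd[OF J_int] by (simp add: inner_s)
  have "energy (U 0) f = (LINT x|LOmega. LINT y|LOmega. energy_density (U 0) f (x, y))"
    by (rule energy_iterated[symmetric])
      (rule lipschitz_energy(1)[OF U_lipschitz f M_nonneg L])
  also have "\<dots> = (LINT x|LOmega. LINT s|lborel. J x s)"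
    by (rule Bochner_Integration.integral_cong) (use inner_x in auto)
  also have "\<dots> = (LINT x|lborel. indicator Omega x * (LINT s|lborel. J x s))"
    by (rule LOmega_integral_lborel)
      (use lborel.borel_measurable_lebesgue_integral[OF J_meas] in simp)
  also have "\<dots> = (LINT x|lborel. LINT s|lborel. J x s)"
    by (rule Bochner_Integration.integral_cong) (auto simp: J_def indicator_def)
  also have "\<dots> = (LINT s|lborel. LINT x|lborel. J x s)"
    by (rule lborel_pair.Fubini_integral[OF J_int, symmetric])
  finally show "energy (U 0) f = (LINT s|lborel. ref_ker \<beta> s * I s)" by (simp add: inner_s)
qed

text \<open>As \<open>ref_ker\<close> is even, reflecting \<open>s\<close> writes twice the energy
  as an integral over symmetric pairs of slices. Their bound is integrated against the second moment
  1, and halving turns 50 into 25.\<close>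

lemma energy_compact_support:
  assumes f: "\<And>x y. x \<in> Omega \<Longrightarrow> y \<in> Omega \<Longrightarrow> \<bar>f x - f y\<bar> \<le> L * \<bar>x - y\<bar>"
    and zero: "\<And>x. x \<notin> {a..1 - a} \<Longrightarrow> f x = 0" and a: "0 < a" "a < 1 / 2" and L: "0 \<le> L"
  shows "\<bar>energy (U 0) f + (LINT x|LOmega. U 2 x * f x)\<bar> \<le> 25 * (K * \<delta>)\<^sup>2 * M * L2_norm f"
proof -
  define I where "I s = (LINT x|LOmega. quot s x * (f x - f (shift s x)))" for s
  define Z where "Z = (LINT x|LOmega. U 2 x * f x)"
  define c where "c = 50 * (K * \<delta>)\<^sup>2 * M * L2_norm f"
  have zero': "f x = 0" if "x \<notin> Omega" for x using zero[of x] that a by auto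
  have f_cont: "continuous_on Omega f" by (rule abs_lipschitz_continuous_on[OF f])
  note slices = energy_as_slices[OF f zero' L, folded I_def]
  have refl: "integrable lborel (\<lambda>s. ref_ker \<beta> s * I (- s))"
    "(LINT s|lborel. ref_ker \<beta> s * I (- s)) = energy (U 0) f"
    using lborel_integrable_real_affine[OF slices(1), of "-1" 0]
      lborel_integral_real_affine[of "-1" "\<lambda>s. ref_ker \<beta> s * I s" 0] slices(2)
    by (auto simp: ref_ker_even)
  note rk = ref_ker_second_moment[OF \<beta>_less_3]
  have "2 * (energy (U 0) f + Z)
      = (LINT s|lborel. ref_ker \<beta> s * I s + ref_ker \<beta> s * I (- s) + 2 * Z * (ref_ker \<beta> s * s\<^sup>2))"
    using slices refl rk by simp
  also have "\<bar>\<dots>\<bar> \<le> (LINT s|lborel. c * (ref_ker \<beta> s * s\<^sup>2))"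
  proof -
    have pw: "\<bar>ref_ker \<beta> s * I s + ref_ker \<beta> s * I (- s) + 2 * Z * (ref_ker \<beta> s * s\<^sup>2)\<bar>
        \<le> c * (ref_ker \<beta> s * s\<^sup>2)" for s
    proof (cases "\<bar>s\<bar> < 1")
      case True
      then have "\<bar>I s + I (- s) + 2 * s\<^sup>2 * Z\<bar> \<le> c * s\<^sup>2"
        using slice_estimate[OF f_cont zero a, of s] by (simp add: I_def Z_def c_def mult_ac)
      then have "ref_ker \<beta> s * \<bar>I s + I (- s) + 2 * s\<^sup>2 * Z\<bar> \<le> ref_ker \<beta> s * (c * s\<^sup>2)"
        by (rule mult_left_mono[OF _ ref_ker_nonneg[OF \<beta>_less_3]])
      moreover have "ref_ker \<beta> s * I s + ref_ker \<beta> s * I (- s) + 2 * Z * (ref_ker \<beta> s * s\<^sup>2)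
          = ref_ker \<beta> s * (I s + I (- s) + 2 * s\<^sup>2 * Z)"
        by (simp add: algebra_simps)
      ultimately show ?thesis
        using ref_ker_nonneg[OF \<beta>_less_3, of s] by (simp add: abs_mult mult_ac)
    next
      case False
      then have "ref_ker \<beta> s = 0" by (auto simp: ref_ker_def indicator_def)
      then show ?thesis by simp
    qed
    have int: "integrable lborel (\<lambda>s. ref_ker \<beta> s * I s + ref_ker \<beta> s * I (- s) + 2 * Z * (ref_ker \<beta> s * s\<^sup>2))"
      using slices refl rk by simp
    have "\<bar>LINT s|lborel. ref_ker \<beta> s * I s + ref_ker \<beta> s * I (- s) + 2 * Z * (ref_ker \<beta> s * s\<^sup>2)\<bar>
        \<le> (LINT s|lborel. \<bar>ref_ker \<beta> s * I s + ref_ker \<beta> s * I (- s) + 2 * Z * (ref_ker \<beta> s * s\<^sup>2)\<bar>)"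
      using integral_norm_bound[of lborel "\<lambda>s. ref_ker \<beta> s * I s + ref_ker \<beta> s * I (- s) + 2 * Z * (ref_ker \<beta> s * s\<^sup>2)"]
      by simp
    also have "\<dots> \<le> (LINT s|lborel. c * (ref_ker \<beta> s * s\<^sup>2))"
      by (rule Bochner_Integration.integral_mono[OF integrable_abs[OF int] _ pw]) (use rk in simp)
    finally show ?thesis .
  qed
  also have "\<dots> = c" using rk by simp
  finally have "\<bar>2 * (energy (U 0) f + Z)\<bar> \<le> c" .
  then have "2 * \<bar>energy (U 0) f + Z\<bar> \<le> c" unfolding abs_mult by simp
  then show ?thesis unfolding Z_def c_def by (simp add: mult_ac)
qed

text \<open>Soft thresholding, as the identity minus clamping to
  \<open>{-\<epsilon>..\<epsilon>}\<close>. It is 1-Lipschitz, so composition with it keeps the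
  constant \<open>L\<close> and leaves a dominating function that is independent of
  \<open>\<epsilon>\<close>.\<close>

definition soft :: "real \<Rightarrow> real \<Rightarrow> real" where
  "soft \<epsilon> t = t - max (- \<epsilon>) (min \<epsilon> t)"

lemma soft_props:
  assumes "0 \<le> \<epsilon>"
  shows "\<bar>soft \<epsilon> t - soft \<epsilon> t'\<bar> \<le> \<bar>t - t'\<bar>" "\<bar>soft \<epsilon> t\<bar> \<le> \<bar>t\<bar>" "\<bar>soft \<epsilon> t - t\<bar> \<le> \<epsilon>"
    "\<bar>t\<bar> \<le> \<epsilon> \<Longrightarrow> soft \<epsilon> t = 0"
  using assms by (auto simp: soft_def min_def max_def)

text \<open>Within distance \<open>a\<close> of an end point
  \<open>\<bar>f\<bar> \<le> L * a\<close>, so thresholding at a level of at least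
  \<open>L * a\<close> removes \<open>f\<close> there. The resulting bound does not contain
  \<open>L\<close>; this matters in \<open>energy_trace_zero\<close>, where the Lipschitz constants
  of the approximants are not controlled.\<close>

lemma energy_lipschitz_boundary:
  assumes f: "\<And>x y. x \<in> {0..1} \<Longrightarrow> y \<in> {0..1} \<Longrightarrow> \<bar>f x - f y\<bar> \<le> L * \<bar>x - y\<bar>"
    and f0: "f 0 = 0" "f 1 = 0" and L: "0 \<le> L"
  shows "\<bar>energy (U 0) f + (LINT x|LOmega. U 2 x * f x)\<bar> \<le> 25 * (K * \<delta>)\<^sup>2 * M * L2_norm f"
proof -
  define \<epsilon> where "\<epsilon> n = inverse (real (Suc n))" for n
  have \<epsilon>: "0 < \<epsilon> n" "0 \<le> \<epsilon> n" for n by (auto simp: \<epsilon>_def)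
  have \<epsilon>_lim: "\<epsilon> \<longlonglongrightarrow> 0" unfolding \<epsilon>_def by (rule LIMSEQ_inverse_real_of_nat)
  define h where "h n x = (if x \<in> Omega then soft (\<epsilon> n) (f x) else 0)" for n x
  have fO: "\<bar>f x - f y\<bar> \<le> L * \<bar>x - y\<bar>" if "x \<in> Omega" "y \<in> Omega" for x y
    using that by (intro f) auto
  have hO: "\<bar>h n x - h n y\<bar> \<le> L * \<bar>x - y\<bar>" if "x \<in> Omega" "y \<in> Omega" for n x y
    using soft_props(1)[OF \<epsilon>(2), of n "f x" "f y"] fO[OF that] that by (simp add: h_def)
  have f_meas: "f \<in> borel_measurable LOmega" and h_meas: "h n \<in> borel_measurable LOmega" for n
    using lipschitz_measurable[OF fO] lipschitz_measurable[OF hO] by auto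
  have f_bound: "\<bar>f x\<bar> \<le> L" if "x \<in> Omega" for x
  proof -
    have "\<bar>f x - f 0\<bar> \<le> L * \<bar>x - 0\<bar>" using that by (intro f) auto
    also have "\<dots> \<le> L" using that L by (simp add: mult_left_le)
    finally show ?thesis by (simp add: f0)
  qed
  have f_L2: "f \<in> L2" by (rule bounded_L2[OF f_meas f_bound])
  have h_le: "\<bar>h n x\<bar> \<le> \<bar>f x\<bar>" if "x \<in> Omega" for n x
    using soft_props(2)[OF \<epsilon>(2)] that by (simp add: h_def)
  have h_lim: "(\<lambda>n. h n x) \<longlonglongrightarrow> f x" if "x \<in> Omega" for x
  proof (rule LIM_zero_cancel, rule tendsto_rabs_zero_cancel, rule tendsto_sandwich[OF _ _ _ \<epsilon>_lim])
    show "\<forall>\<^sub>F n in sequentially. \<bar>h n x - f x\<bar> \<le> \<epsilon> n"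
      using soft_props(3)[OF \<epsilon>(2)] that by (simp add: h_def)
  qed auto
  have step: "\<bar>energy (U 0) (h n) + (LINT x|LOmega. U 2 x * h n x)\<bar> \<le> 25 * (K * \<delta>)\<^sup>2 * M * L2_norm f" for n
  proof -
    \<comment> \<open>The denominator \<open>L + 1\<close> avoids a division by zero for
      \<open>L = 0\<close> and still gives \<open>L * a \<le> \<epsilon> n\<close>; the cap 1/4
      ensures \<open>a < 1 / 2\<close>.\<close>
    define a where "a = min (1 / 4) (\<epsilon> n / (L + 1))"
    have a: "0 < a" "a < 1 / 2" using \<epsilon>[of n] L by (auto simp: a_def)
    have La: "L * a \<le> \<epsilon> n"
    proof -
      have "L * a \<le> L * (\<epsilon> n / (L + 1))" using L by (intro mult_left_mono) (auto simp: a_def)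
      also have "\<dots> \<le> \<epsilon> n" using L \<epsilon>(2)[of n] by (simp add: field_simps)
      finally show ?thesis .
    qed
    have zero: "h n x = 0" if "x \<notin> {a..1 - a}" for x
    proof (cases "x \<in> Omega")
      case True
      have "\<bar>f x\<bar> \<le> L * a"
      proof (cases "x < a")
        case True
        have "\<bar>f x - f 0\<bar> \<le> L * \<bar>x - 0\<bar>" using \<open>x \<in> Omega\<close> by (intro f) auto
        also have "\<dots> \<le> L * a" using True \<open>x \<in> Omega\<close> L by (intro mult_left_mono) auto
        finally show ?thesis by (simp add: f0)
      next
        case False
        then have "1 - x < a" using that by auto
        have "\<bar>f x - f 1\<bar> \<le> L * \<bar>x - 1\<bar>" using \<open>x \<in> Omega\<close> by (intro f) auto
        also have "\<dots> \<le> L * a" using \<open>1 - x < a\<close> \<open>x \<in> Omega\<close> L by (intro mult_left_mono) auto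
        finally show ?thesis by (simp add: f0)
      qed
      then show ?thesis using La soft_props(4)[OF \<epsilon>(2)] by (simp add: h_def)
    qed (auto simp: h_def)
    have h2: "integrable LOmega (\<lambda>x. (h n x)\<^sup>2)"
    proof (rule Bochner_Integration.integrable_bound)
      show "integrable LOmega (\<lambda>x. (f x)\<^sup>2)" using f_L2 by (simp add: L2_def)
      show "AE x in LOmega. norm ((h n x)\<^sup>2) \<le> norm ((f x)\<^sup>2)"
        using h_le by (intro AE_I2) (simp add: abs_le_square_iff)
    qed (use h_meas in simp)
    have "(L2_norm (h n))\<^sup>2 \<le> (L2_norm f)\<^sup>2"
      unfolding L2_norm_sq
      by (rule Bochner_Integration.integral_mono[OF h2]) (use h_le f_L2 in \<open>auto simp: L2_def abs_le_square_iff\<close>)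
    then have "L2_norm (h n) \<le> L2_norm f" by (rule power2_le_imp_le[OF _ L2_norm_nonneg])
    then have "25 * (K * \<delta>)\<^sup>2 * M * L2_norm (h n) \<le> 25 * (K * \<delta>)\<^sup>2 * M * L2_norm f"
      using M_nonneg by (intro mult_left_mono) auto
    then show ?thesis
      using energy_compact_support[OF hO zero a L] by (rule order_trans[rotated])
  qed
  have "(\<lambda>n. energy (U 0) (h n)) \<longlonglongrightarrow> energy (U 0) f"
    unfolding energy_def
  proof (rule integral_dominated_convergence[where w = "\<lambda>p. M * L * moment p"])
    show "energy_density (U 0) f \<in> borel_measurable LOmega2"
      "energy_density (U 0) (h n) \<in> borel_measurable LOmega2" for n
      by (intro energy_density_measurable lipschitz_measurable[OF U_lipschitz] f_meas h_meas; assumption)+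
    show "integrable LOmega2 (\<lambda>p. M * L * moment p)" using moment_integrable by simp
    show "AE p in LOmega2. norm (energy_density (U 0) (h n) p) \<le> M * L * moment p" for n
    proof (rule AE_I2)
      fix p assume "p \<in> space LOmega2"
      then have "p \<in> Omega \<times> Omega" by (simp add: space_pair_measure)
      then show "norm (energy_density (U 0) (h n) p) \<le> M * L * moment p"
        using energy_density_lipschitz[OF U_lipschitz hO _ M_nonneg L, of p] by simp
    qed
    show "AE p in LOmega2. (\<lambda>n. energy_density (U 0) (h n) p) \<longlonglongrightarrow> energy_density (U 0) f p"
      unfolding energy_density_def
      by (intro AE_I2 tendsto_intros h_lim) (auto simp: space_pair_measure)
  qed
  moreover have "(\<lambda>n. LINT x|LOmega. U 2 x * h n x) \<longlonglongrightarrow> (LINT x|LOmega. U 2 x * f x)"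
  proof (rule integral_dominated_convergence[where w = "\<lambda>x. M * L"])
    have U2: "U 2 \<in> borel_measurable LOmega" by (rule continuous_on_LOmega[OF U_continuous]) simp
    show "(\<lambda>x. U 2 x * f x) \<in> borel_measurable LOmega" "(\<lambda>x. U 2 x * h n x) \<in> borel_measurable LOmega" for n
      using U2 f_meas h_meas by auto
    show "AE x in LOmega. norm (U 2 x * h n x) \<le> M * L" for n
    proof (rule AE_I2)
      fix x assume "x \<in> space LOmega"
      then have "\<bar>h n x\<bar> \<le> L" using h_le[of x n] f_bound[of x] by auto
      then show "norm (U 2 x * h n x) \<le> M * L"
        using U_le[of 2 x] M_nonneg by (auto simp: abs_mult intro!: mult_mono)
    qed
    show "AE x in LOmega. (\<lambda>n. U 2 x * h n x) \<longlonglongrightarrow> U 2 x * f x"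
      by (intro AE_I2 tendsto_intros h_lim) auto
  qed simp
  ultimately have "(\<lambda>n. \<bar>energy (U 0) (h n) + (LINT x|LOmega. U 2 x * h n x)\<bar>)
      \<longlonglongrightarrow> \<bar>energy (U 0) f + (LINT x|LOmega. U 2 x * f x)\<bar>"
    by (intro tendsto_intros)
  then show ?thesis
    by (rule LIMSEQ_le_const2) (use step in blast)
qed

end

section \<open>Functions of trace zero as limits of smooth functions\<close>

lemma lipschitz_L2:
  assumes "\<And>x y. x \<in> {0..1} \<Longrightarrow> y \<in> {0..1} \<Longrightarrow> \<bar>u x - u y\<bar> \<le> A * \<bar>x - y\<bar>"
  shows "u \<in> L2"
proof -
  have c: "continuous_on {0..1} u" by (rule abs_lipschitz_continuous_on[OF assms])
  have "integrable LOmega (\<lambda>x. (u x)\<^sup>2)"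
    by (intro LOmega_integral_continuous(1) continuous_intros c)
  moreover have "u \<in> borel_measurable LOmega"
    by (rule borel_measurable_integrable[OF LOmega_integral_continuous(1)[OF c]])
  ultimately show ?thesis by (simp add: L2_def)
qed

lemma smooth_on_interval_lipschitz:
  assumes "smooth_on {0..1} \<phi>"
  obtains L where "0 \<le> L" "\<And>x y. x \<in> {0..1} \<Longrightarrow> y \<in> {0..1} \<Longrightarrow> \<bar>\<phi> x - \<phi> y\<bar> \<le> L * \<bar>x - y\<bar>"
proof -
  have C1: "Ck_on 1 {0..1} \<phi>" using assms by (simp add: smooth_on_def)
  have D: "(\<phi> has_real_derivative nderiv_on {0..1} 1 \<phi> x) (at x within {0..1})" if "x \<in> {0..1}" for x
    using nderiv_on_has_derivative[OF C1, of 0 x] that by (simp add: nderiv_on_def)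
  have "continuous_on {0..1} (nderiv_on {0..1} 1 \<phi>)"
    using C1 by (auto simp: Ck_on_def)
  then have "bounded (nderiv_on {0..1} 1 \<phi> ` {0..1})"
    by (intro compact_imp_bounded compact_continuous_image) auto
  then obtain B where "\<forall>x\<in>{0..1}. \<bar>nderiv_on {0..1} 1 \<phi> x\<bar> \<le> B"
    by (auto simp: bounded_iff)
  then have B: "\<bar>nderiv_on {0..1} 1 \<phi> x\<bar> \<le> B" if "x \<in> {0..1}" for x
    using that by blast
  have "\<bar>\<phi> x - \<phi> y\<bar> \<le> B * \<bar>x - y\<bar>" if "x \<in> {0..1}" "y \<in> {0..1}" for x y
    using field_differentiable_bound[of "{0..1}" \<phi> "nderiv_on {0..1} 1 \<phi>" B x y] D B that by auto
  moreover have "0 \<le> B" using B[of 0] by (simp add: order_trans[OF abs_ge_zero])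
  ultimately show ?thesis using that by blast
qed

context horizon_H4_form
begin

text \<open>The boundary values of \<open>\<phi> n\<close> tend to 0 but need not vanish.
  Subtracting their affine interpolant \<open>l n\<close> makes them vanish, and \<open>l n\<close>
  tends to 0 in energy and in \<open>L2\<close> because its Lipschitz constant and its maximum do.
  The difference \<open>v - \<phi> n\<close> is small in energy, which passes to the form with
  \<open>U 0\<close> by Cauchy-Schwarz.\<close>

lemma energy_trace_zero:
  assumes v: "v \<in> L2" "finite_energy v"
    and \<phi>: "\<And>n. smooth_on {0..1} (\<phi> n)"
    and w: "\<And>n. finite_energy (\<lambda>x. v x - \<phi> n x)"
    and w_energy: "(\<lambda>n. energy (\<lambda>x. v x - \<phi> n x) (\<lambda>x. v x - \<phi> n x)) \<longlonglongrightarrow> 0"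
    and w_L2: "(\<lambda>n. L2_norm (\<lambda>x. v x - \<phi> n x)) \<longlonglongrightarrow> 0"
    and trace: "(\<lambda>n. \<phi> n 0) \<longlonglongrightarrow> 0" "(\<lambda>n. \<phi> n 1) \<longlonglongrightarrow> 0"
  shows "\<bar>energy (U 0) v + (LINT x|LOmega. U 2 x * v x)\<bar> \<le> 25 * (K * \<delta>)\<^sup>2 * M * L2_norm v"
proof -
  define c where "c = 25 * (K * \<delta>)\<^sup>2 * M"
  have c: "0 \<le> c" using M_nonneg by (simp add: c_def)
  define l where "l n x = \<phi> n 0 + x * (\<phi> n 1 - \<phi> n 0)" for n x
  define w' where "w' n x = v x - \<phi> n x" for n x
  define \<psi> where "\<psi> n x = \<phi> n x - l n x" for n x
  \<comment> \<open>Bounds both the Lipschitz constant of \<open>l n\<close> and its absolute value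
    on \<open>Omega\<close>.\<close>
  define A where "A n = \<bar>\<phi> n 0\<bar> + \<bar>\<phi> n 1 - \<phi> n 0\<bar>" for n
  have A0: "0 \<le> A n" for n by (simp add: A_def)
  have A_lim: "A \<longlonglongrightarrow> 0"
    unfolding A_def using tendsto_add[OF tendsto_rabs[OF trace(1)] tendsto_rabs[OF tendsto_diff[OF trace(2,1)]]]
    by simp
  have l_lip: "\<bar>l n x - l n y\<bar> \<le> A n * \<bar>x - y\<bar>" for n x y
  proof -
    have "\<bar>l n x - l n y\<bar> = \<bar>\<phi> n 1 - \<phi> n 0\<bar> * \<bar>x - y\<bar>"
      by (simp add: l_def abs_mult[symmetric] algebra_simps)
    also have "\<dots> \<le> A n * \<bar>x - y\<bar>"
      by (intro mult_right_mono) (auto simp: A_def)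
    finally show ?thesis .
  qed
  have l_bound: "\<bar>l n x\<bar> \<le> A n" if "x \<in> Omega" for n x
  proof -
    have "\<bar>x * (\<phi> n 1 - \<phi> n 0)\<bar> \<le> \<bar>\<phi> n 1 - \<phi> n 0\<bar>"
      using that by (simp add: abs_mult mult_left_le_one_le)
    then show ?thesis
      unfolding l_def A_def using abs_triangle_ineq[of "\<phi> n 0" "x * (\<phi> n 1 - \<phi> n 0)"] by linarith
  qed
  have l_L2: "l n \<in> L2" for n by (rule lipschitz_L2[OF l_lip])
  have l_norm: "L2_norm (l n) \<le> A n" for n
  proof -
    have "(L2_norm (l n))\<^sup>2 \<le> (LINT x|LOmega. (A n)\<^sup>2)"
      unfolding L2_norm_sq
    proof (rule Bochner_Integration.integral_mono)
      fix x assume "x \<in> space LOmega"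
      then show "(l n x)\<^sup>2 \<le> (A n)\<^sup>2"
        using power_mono[OF l_bound[of x n], of 2] by simp
    qed (use l_L2[of n] in \<open>auto simp: L2_def\<close>)
    then have "(L2_norm (l n))\<^sup>2 \<le> (A n)\<^sup>2" by simp
    then show ?thesis by (rule power2_le_imp_le[OF _ A0])
  qed
  have fe_lip: "finite_energy u"
    if "\<And>x y. x \<in> Omega \<Longrightarrow> y \<in> Omega \<Longrightarrow> \<bar>u x - u y\<bar> \<le> B * \<bar>x - y\<bar>" "0 \<le> B" for u B
    using lipschitz_measurable[OF that(1)] lipschitz_energy(1)[OF that(1) that(1) that(2) that(2)] by blast
  have fe_U: "finite_energy (U 0)" by (rule fe_lip[OF U_lipschitz M_nonneg])
  have fe_l: "finite_energy (l n)" for n by (rule fe_lip[OF l_lip A0])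
  have fe_w: "finite_energy (w' n)" for n using w by (simp add: w'_def[abs_def])
  have w'_L2: "w' n \<in> L2" for n
  proof -
    obtain L where "\<And>x y. x \<in> {0..1} \<Longrightarrow> y \<in> {0..1} \<Longrightarrow> \<bar>\<phi> n x - \<phi> n y\<bar> \<le> L * \<bar>x - y\<bar>"
      using smooth_on_interval_lipschitz[OF \<phi>] by blast
    then have "\<phi> n \<in> L2" by (rule lipschitz_L2)
    then have "(\<lambda>x. - \<phi> n x) \<in> L2" by (simp add: L2_def)
    then show ?thesis using L2_add[OF v(1)] by (fastforce simp: w'_def[abs_def])
  qed
  have v_eq: "\<psi> n = (\<lambda>x. (v x + -1 * w' n x) + -1 * l n x)" for n
    by (auto simp: \<psi>_def w'_def)
  have \<psi>: "\<bar>energy (U 0) (\<psi> n) + (LINT x|LOmega. U 2 x * \<psi> n x)\<bar> \<le> c * L2_norm (\<psi> n)" for n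
  proof -
    obtain L where L: "0 \<le> L" "\<And>x y. x \<in> {0..1} \<Longrightarrow> y \<in> {0..1} \<Longrightarrow> \<bar>\<phi> n x - \<phi> n y\<bar> \<le> L * \<bar>x - y\<bar>"
      using smooth_on_interval_lipschitz[OF \<phi>] by blast
    show ?thesis
      unfolding c_def
    proof (rule energy_lipschitz_boundary)
      fix x y :: real assume "x \<in> {0..1}" "y \<in> {0..1}"
      then have "\<bar>\<phi> n x - \<phi> n y\<bar> \<le> L * \<bar>x - y\<bar>" by (rule L(2))
      moreover have "\<bar>\<psi> n x - \<psi> n y\<bar> \<le> \<bar>\<phi> n x - \<phi> n y\<bar> + \<bar>l n x - l n y\<bar>"
        by (simp add: \<psi>_def)
      ultimately show "\<bar>\<psi> n x - \<psi> n y\<bar> \<le> (L + A n) * \<bar>x - y\<bar>"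
        using l_lip[of n x y] unfolding distrib_right by linarith
    qed (use L(1) A0 in \<open>auto simp: \<psi>_def l_def\<close>)
  qed
  have energy_split: "energy (U 0) (\<psi> n) = energy (U 0) v - energy (U 0) (w' n) - energy (U 0) (l n)" for n
    unfolding v_eq energy_lincomb_right[OF finite_energy_lincomb[OF v(2) fe_w] fe_l fe_U]
      energy_lincomb_right[OF v(2) fe_w fe_U] by simp
  have e_w: "(\<lambda>n. energy (U 0) (w' n)) \<longlonglongrightarrow> 0"
  proof (rule tendsto_rabs_zero_cancel, rule tendsto_sandwich[of "\<lambda>_. 0"])
    show "\<forall>\<^sub>F n in sequentially. \<bar>energy (U 0) (w' n)\<bar> \<le> sqrt (energy (U 0) (U 0) * energy (w' n) (w' n))"
      using energy_Cauchy_Schwarz[OF fe_U fe_w]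
      by (intro always_eventually allI real_le_rsqrt) (simp add: power2_abs)
    have "(\<lambda>n. sqrt (energy (U 0) (U 0) * energy (w' n) (w' n))) \<longlonglongrightarrow> sqrt (energy (U 0) (U 0) * 0)"
      using w_energy by (intro tendsto_intros) (simp add: w'_def[abs_def])
    then show "(\<lambda>n. sqrt (energy (U 0) (U 0) * energy (w' n) (w' n))) \<longlonglongrightarrow> 0" by simp
  qed auto
  have e_l: "(\<lambda>n. energy (U 0) (l n)) \<longlonglongrightarrow> 0"
  proof (rule tendsto_rabs_zero_cancel, rule tendsto_sandwich[of "\<lambda>_. 0"])
    show "\<forall>\<^sub>F n in sequentially. \<bar>energy (U 0) (l n)\<bar> \<le> M * A n"
      using lipschitz_energy(2)[OF U_lipschitz l_lip M_nonneg A0] by simp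
    show "(\<lambda>n. M * A n) \<longlonglongrightarrow> 0" using tendsto_mult_right_zero[OF A_lim] .
  qed auto
  have e_lim: "(\<lambda>n. energy (U 0) (\<psi> n)) \<longlonglongrightarrow> energy (U 0) v"
    unfolding energy_split using tendsto_diff[OF tendsto_diff[OF tendsto_const e_w] e_l] by simp
  have U2_L2: "U 2 \<in> L2"
    by (rule bounded_L2[OF continuous_on_LOmega[OF U_continuous] U_le]) simp_all
  have pair_small: "\<bar>LINT x|LOmega. U 2 x * f x\<bar> \<le> L2_norm (U 2) * L2_norm f" if "f \<in> L2" for f
    using integral_norm_bound[of LOmega "\<lambda>x. U 2 x * f x"] L2_Cauchy_Schwarz[OF U2_L2 that]
    unfolding real_norm_def by (rule order_trans)
  have pair_zero: "(\<lambda>n. LINT x|LOmega. U 2 x * f n x) \<longlonglongrightarrow> 0"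
    if "\<And>n. f n \<in> L2" "(\<lambda>n. L2_norm (f n)) \<longlonglongrightarrow> 0" for f :: "nat \<Rightarrow> real \<Rightarrow> real"
  proof (rule tendsto_rabs_zero_cancel, rule tendsto_sandwich[of "\<lambda>_. 0"])
    show "\<forall>\<^sub>F n in sequentially. \<bar>LINT x|LOmega. U 2 x * f n x\<bar> \<le> L2_norm (U 2) * L2_norm (f n)"
      using pair_small that(1) by simp
    show "(\<lambda>n. L2_norm (U 2) * L2_norm (f n)) \<longlonglongrightarrow> 0" using tendsto_mult_right_zero[OF that(2)] .
  qed auto
  have l_norm_lim: "(\<lambda>n. L2_norm (l n)) \<longlonglongrightarrow> 0"
    by (rule tendsto_sandwich[OF _ _ tendsto_const A_lim]) (use l_norm L2_norm_nonneg in auto)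
  have w_norm_lim: "(\<lambda>n. L2_norm (w' n)) \<longlonglongrightarrow> 0" using w_L2 by (simp add: w'_def[abs_def])
  have pair_split: "(LINT x|LOmega. U 2 x * \<psi> n x)
      = (LINT x|LOmega. U 2 x * v x) - (LINT x|LOmega. U 2 x * w' n x) - (LINT x|LOmega. U 2 x * l n x)" for n
    unfolding v_eq
    using L2_mult_integrable[OF U2_L2 v(1)] L2_mult_integrable[OF U2_L2 w'_L2[of n]]
      L2_mult_integrable[OF U2_L2 l_L2[of n]]
    by (simp add: right_diff_distrib)
  have p_lim: "(\<lambda>n. LINT x|LOmega. U 2 x * \<psi> n x) \<longlonglongrightarrow> (LINT x|LOmega. U 2 x * v x)"
    unfolding pair_split
    using tendsto_diff[OF tendsto_diff[OF tendsto_const pair_zero[OF w'_L2 w_norm_lim]] pair_zero[OF l_L2 l_norm_lim]]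
    by simp
  have norm_le: "L2_norm (\<psi> n) \<le> L2_norm v + L2_norm (w' n) + L2_norm (l n)" for n
  proof -
    have neg: "(\<lambda>x. -1 * f x) \<in> L2" "L2_norm (\<lambda>x. -1 * f x) = L2_norm f" if "f \<in> L2" for f
      using that by (auto simp: L2_def L2_norm_def L2_inner_def)
    have "L2_norm (\<psi> n) \<le> L2_norm (\<lambda>x. v x + -1 * w' n x) + L2_norm (\<lambda>x. -1 * l n x)"
      unfolding v_eq by (rule L2_norm_triangle[OF L2_add[OF v(1) neg(1)[OF w'_L2]] neg(1)[OF l_L2]])
    also have "L2_norm (\<lambda>x. v x + -1 * w' n x) \<le> L2_norm v + L2_norm (\<lambda>x. -1 * w' n x)"
      by (rule L2_norm_triangle[OF v(1) neg(1)[OF w'_L2]])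
    finally show ?thesis unfolding neg(2)[OF w'_L2] neg(2)[OF l_L2] by simp
  qed
  have step: "\<bar>energy (U 0) (\<psi> n) + (LINT x|LOmega. U 2 x * \<psi> n x)\<bar>
      \<le> c * (L2_norm v + L2_norm (w' n) + L2_norm (l n))" for n
    using \<psi>[of n] mult_left_mono[OF norm_le[of n] c] by linarith
  have "(\<lambda>n. c * (L2_norm v + L2_norm (w' n) + L2_norm (l n))) \<longlonglongrightarrow> c * (L2_norm v + 0 + 0)"
    by (intro tendsto_intros w_norm_lim l_norm_lim)
  moreover have "(\<lambda>n. \<bar>energy (U 0) (\<psi> n) + (LINT x|LOmega. U 2 x * \<psi> n x)\<bar>)
      \<longlonglongrightarrow> \<bar>energy (U 0) v + (LINT x|LOmega. U 2 x * v x)\<bar>"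
    by (intro tendsto_intros e_lim p_lim)
  ultimately have "\<bar>energy (U 0) v + (LINT x|LOmega. U 2 x * v x)\<bar> \<le> c * (L2_norm v + 0 + 0)"
    by (rule tendsto_le[OF sequentially_bot _ _ always_eventually[OF allI[OF step]]])
  then show ?thesis by (simp add: c_def)
qed

end

section \<open>Return to the original form, spaces and norms\<close>

lemma B_integrand_eq_energy_density:
  assumes "horizon_form (eta_delta q lam \<delta>) \<eta>1 \<eta>2 \<eta>3 K \<delta> \<beta>"
  shows "B_integrand q lam \<beta> \<delta> u v x y
    = horizon_form.energy_density (eta_delta q lam \<delta>) \<beta> u v (x, y)"
proof -
  interpret horizon_form "eta_delta q lam \<delta>" \<eta>1 \<eta>2 \<eta>3 K \<delta> \<beta> by fact
  show ?thesis
    by (simp add: B_integrand_def energy_density_def ker_def w_delta_def)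
qed

text \<open>Here \<open>u\<close> is replaced by its representative \<open>U 0\<close>, convergence
  in \<open>W_norm\<close> is split into convergence in energy and in \<open>L2\<close>, and
  \<open>B_zero\<close> becomes an integral of \<open>U 2\<close>. With
  \<open>M = 2 * Hk_norm 4 u\<close> the constant 25 becomes 50.\<close>

lemma B_delta_estimate:
  assumes hz: "horizon (eta_delta q lam \<delta>) \<eta>1 \<eta>2 \<eta>3 K \<delta>" and \<beta>: "\<beta> < 3"
    and u: "u \<in> Hk 4" and v: "v \<in> W0_space q lam \<beta> \<delta>"
  shows "\<bar>B_delta q lam \<beta> \<delta> u v - B_zero u v\<bar> \<le> 50 * (K * \<delta>)\<^sup>2 * Hk_norm 4 u * L2_norm v"
proof -
  let ?\<eta> = "eta_delta q lam \<delta>"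
  obtain U g where
    U: "\<And>j x. j < 3 \<Longrightarrow> x \<in> Omega \<Longrightarrow> (U j has_real_derivative U (Suc j) x) (at x)"
      "continuous_on Omega (U 3)"
      "\<And>x y. x \<le> y \<Longrightarrow> \<bar>U 3 y - U 3 x\<bar> \<le> (LINT t|LOmega. indicator {x<..y} t * \<bar>g t\<bar>)"
      "\<And>j x. j \<le> 3 \<Longrightarrow> \<bar>U j x\<bar> \<le> 2 * Hk_norm 4 u"
    and uU: "AE x in LOmega. u x = U 0 x" and wU: "AE x in LOmega. weak_deriv 2 u x = U 2 x"
    and g: "g \<in> L2" "L2_norm g \<le> Hk_norm 4 u"
    using H4_representative[OF u] by blast
  interpret horizon ?\<eta> \<eta>1 \<eta>2 \<eta>3 K \<delta> by fact
  interpret horizon_H4_form ?\<eta> \<eta>1 \<eta>2 \<eta>3 K \<delta> U g "2 * Hk_norm 4 u" \<beta>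
    by unfold_locales (use U g \<beta> Hk_norm_nonneg[of 4 u] in auto)
  note B_eq = B_integrand_eq_energy_density[OF horizon_form_axioms]
  have W_finite: "finite_energy f" "f \<in> L2" if "f \<in> W_space q lam \<beta> \<delta>" for f
  proof -
    show L2: "f \<in> L2" using that by (simp add: W_space_def)
    then have m: "f \<in> borel_measurable LOmega" by (simp add: L2_def)
    have dm: "energy_density f f \<in> borel_measurable LOmega2" by (rule energy_density_measurable[OF m m])
    have "(\<integral>\<^sup>+p. ennreal (energy_density f f p) \<partial>LOmega2)
        = (\<integral>\<^sup>+x. \<integral>\<^sup>+y. ennreal (energy_density f f (x, y)) \<partial>LOmega \<partial>LOmega)"
      by (rule LO.nn_integral_fst[symmetric]) (use dm in measurable)
    also have "\<dots> < \<infinity>" using that by (simp add: W_space_def B_eq)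
    finally have "integrable LOmega2 (energy_density f f)"
      using energy_density_nonneg by (intro integrableI_nonneg[OF dm]) auto
    with m show "finite_energy f" by blast
  qed
  have B_energy: "B_delta q lam \<beta> \<delta> f h = energy f h" if "finite_energy f" "finite_energy h" for f h
    unfolding B_delta_def B_eq by (rule energy_iterated[OF finite_energy_integrable[OF that]])
  have vW: "v \<in> W_space q lam \<beta> \<delta>" using v by (simp add: W0_space_def)
  obtain \<phi> where \<phi>: "\<And>n. smooth_on {0..1} (\<phi> n)"
    and \<phi>W: "\<And>n. (\<lambda>x. v x - \<phi> n x) \<in> W_space q lam \<beta> \<delta>"
    and lim: "(\<lambda>n. W_norm q lam \<beta> \<delta> (\<lambda>x. v x - \<phi> n x)) \<longlonglongrightarrow> 0"
    and trace: "(\<lambda>n. \<phi> n 0) \<longlonglongrightarrow> 0" "(\<lambda>n. \<phi> n 1) \<longlonglongrightarrow> 0"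
    using v by (auto simp: W0_space_def has_trace_def)
  define w where "w n = (\<lambda>x. v x - \<phi> n x)" for n
  have w_norm: "(W_norm q lam \<beta> \<delta> (w n))\<^sup>2 = (L2_norm (w n))\<^sup>2 + energy (w n) (w n)"
    and w_energy: "0 \<le> energy (w n) (w n)" for n
  proof -
    show e: "0 \<le> energy (w n) (w n)"
      unfolding energy_def by (intro Bochner_Integration.integral_nonneg energy_density_nonneg)
    show "(W_norm q lam \<beta> \<delta> (w n))\<^sup>2 = (L2_norm (w n))\<^sup>2 + energy (w n) (w n)"
      using B_energy[of "w n" "w n"] W_finite(1)[OF \<phi>W[of n]] e by (simp add: W_norm_def w_def)
  qed
  have sq_lim: "(\<lambda>n. (W_norm q lam \<beta> \<delta> (w n))\<^sup>2) \<longlonglongrightarrow> 0"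
    using tendsto_power[OF lim, of 2] by (simp add: w_def)
  have e_lim: "(\<lambda>n. energy (w n) (w n)) \<longlonglongrightarrow> 0"
    by (rule tendsto_sandwich[OF _ _ tendsto_const sq_lim]) (use w_norm w_energy in auto)
  have "(\<lambda>n. (L2_norm (w n))\<^sup>2) \<longlonglongrightarrow> 0"
    by (rule tendsto_sandwich[OF _ _ tendsto_const sq_lim]) (use w_norm w_energy in auto)
  then have l_lim: "(\<lambda>n. L2_norm (w n)) \<longlonglongrightarrow> 0"
    using tendsto_real_sqrt[of "\<lambda>n. (L2_norm (w n))\<^sup>2" 0] L2_norm_nonneg by simp
  have main: "\<bar>energy (U 0) v + (LINT x|LOmega. U 2 x * v x)\<bar>
      \<le> 25 * (K * \<delta>)\<^sup>2 * (2 * Hk_norm 4 u) * L2_norm v"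
    by (rule energy_trace_zero[of v \<phi>])
      (use W_finite[OF vW] W_finite(1)[OF \<phi>W] \<phi> trace e_lim l_lim in \<open>auto simp: w_def\<close>)
  have u_m: "u \<in> borel_measurable LOmega" using u by (simp add: Hk_def L2_def)
  have v_m: "v \<in> borel_measurable LOmega" using W_finite[OF vW] by blast
  have U_m: "U 0 \<in> borel_measurable LOmega" by (rule continuous_on_LOmega[OF U_continuous]) simp
  have section_m: "(\<lambda>x. LINT y|LOmega. energy_density f v (x, y)) \<in> borel_measurable LOmega"
    "x \<in> Omega \<Longrightarrow> (\<lambda>y. energy_density f v (x, y)) \<in> borel_measurable LOmega"
    if "f \<in> borel_measurable LOmega" for f x
    using energy_density_measurable[OF that v_m] by measurable
  have "B_delta q lam \<beta> \<delta> u v = (LINT x|LOmega. LINT y|LOmega. energy_density u v (x, y))"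
    unfolding B_delta_def B_eq ..
  also have "\<dots> = (LINT x|LOmega. LINT y|LOmega. energy_density (U 0) v (x, y))"
  proof (rule integral_cong_AE[OF section_m(1)[OF u_m] section_m(1)[OF U_m]])
    \<comment> \<open>The functions \<open>u\<close> and \<open>U 0\<close> differ on a null set
      only: exceptional \<open>x\<close> are discarded in the outer integral and, for each remaining
      \<open>x\<close>, exceptional \<open>y\<close> in the inner one.\<close>
    show "AE x in LOmega. (LINT y|LOmega. energy_density u v (x, y)) = (LINT y|LOmega. energy_density (U 0) v (x, y))"
      using uU AE_space
    proof eventually_elim
      fix x assume x: "u x = U 0 x" "x \<in> space LOmega"
      show "(LINT y|LOmega. energy_density u v (x, y)) = (LINT y|LOmega. energy_density (U 0) v (x, y))"
      proof (rule integral_cong_AE)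
        show "AE y in LOmega. energy_density u v (x, y) = energy_density (U 0) v (x, y)"
          using uU by eventually_elim (simp add: energy_density_def x)
      qed (use section_m(2)[OF u_m] section_m(2)[OF U_m] x(2) in auto)
    qed
  qed
  also have "\<dots> = energy (U 0) v"
    by (rule energy_iterated[OF finite_energy_integrable])
      (use W_finite(1)[OF vW] U_m lipschitz_energy(1)[OF U_lipschitz U_lipschitz M_nonneg M_nonneg] in auto)
  finally have B: "B_delta q lam \<beta> \<delta> u v = energy (U 0) v" .
  have "B_zero u v = (LINT x|LOmega. - (U 2 x * v x))"
    unfolding B_zero_def L2_inner_def
  proof (rule integral_cong_AE)
    show "AE x in LOmega. - weak_deriv 2 u x * v x = - (U 2 x * v x)"
      using wU by eventually_elim simp
    have "weak_deriv 2 u \<in> borel_measurable LOmega"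
      using weak_deriv_spec(1)[OF u, of 2] by (simp add: L2_def)
    then show "(\<lambda>x. - weak_deriv 2 u x * v x) \<in> borel_measurable LOmega" using v_m by simp
    have "U 2 \<in> borel_measurable LOmega" by (rule continuous_on_LOmega[OF U_continuous]) simp
    then show "(\<lambda>x. - (U 2 x * v x)) \<in> borel_measurable LOmega" using v_m by simp
  qed
  then have "B_zero u v = - (LINT x|LOmega. U 2 x * v x)" by simp
  then show ?thesis using main B by simp
qed

lemma L2_norm_le_W_norm:
  assumes "\<beta> < 3"
  shows "L2_norm v \<le> W_norm q lam \<beta> \<delta> v"
proof -
  have "0 \<le> B_integrand q lam \<beta> \<delta> v v x y" for x y
    using assms by (simp add: B_integrand_def w_delta_def zero_le_square)
  then have "0 \<le> B_delta q lam \<beta> \<delta> v v"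
    unfolding B_delta_def by (intro Bochner_Integration.integral_nonneg)
  then show ?thesis
    unfolding W_norm_def by (intro real_le_rsqrt) simp
qed

theorem proposition4p8:
  fixes q lam :: "real \<Rightarrow> real" and Cq \<beta> :: real and \<kappa> :: "nat \<Rightarrow> real"
  assumes "0 < \<beta>" and "\<beta> < 3"
    and "smooth_localization_pair q lam Cq \<kappa>"
  shows "\<exists>C>0. \<forall>\<delta>. 0 < \<delta> \<and> \<delta> < delta_star Cq \<kappa> \<longrightarrow>
           (\<forall>u \<in> Hk 4 \<inter> H10. \<forall>v \<in> W0_space q lam \<beta> \<delta>.
              \<bar>B_delta q lam \<beta> \<delta> u v - B_zero u v\<bar> \<le> C * \<delta>\<^sup>2 * Hk_norm 4 u * L2_norm v \<and>
              \<bar>B_delta q lam \<beta> \<delta> u v - B_zero u v\<bar>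
                \<le> C * \<delta>\<^sup>2 * Hk_norm 4 u * W_norm q lam \<beta> \<delta> v)"
proof -
  obtain K where K: "\<And>\<delta>. 0 < \<delta> \<Longrightarrow> \<delta> < delta_star Cq \<kappa> \<Longrightarrow>
      \<exists>\<eta>1 \<eta>2 \<eta>3. horizon (eta_delta q lam \<delta>) \<eta>1 \<eta>2 \<eta>3 K \<delta>"
    using smooth_localization_pair_horizon[OF assms(3)] by blast
  \<comment> \<open>The summand 1 gives positivity without any information on \<open>K\<close>,
    whose lower bound is available only inside the locale \<open>horizon\<close>.\<close>
  define C where "C = 50 * K\<^sup>2 + 1"
  have C: "0 < C" by (simp add: C_def add_nonneg_pos)
  have L2_bound: "\<bar>B_delta q lam \<beta> \<delta> u v - B_zero u v\<bar> \<le> C * \<delta>\<^sup>2 * Hk_norm 4 u * L2_norm v"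
    if \<delta>: "0 < \<delta>" "\<delta> < delta_star Cq \<kappa>" and u: "u \<in> Hk 4" and v: "v \<in> W0_space q lam \<beta> \<delta>"
    for \<delta> u v
  proof -
    obtain \<eta>1 \<eta>2 \<eta>3 where "horizon (eta_delta q lam \<delta>) \<eta>1 \<eta>2 \<eta>3 K \<delta>"
      using K[OF \<delta>] by blast
    then have "\<bar>B_delta q lam \<beta> \<delta> u v - B_zero u v\<bar> \<le> 50 * (K * \<delta>)\<^sup>2 * Hk_norm 4 u * L2_norm v"
      by (rule B_delta_estimate[OF _ assms(2) u v])
    also have "\<dots> \<le> C * \<delta>\<^sup>2 * Hk_norm 4 u * L2_norm v"
      by (intro mult_right_mono Hk_norm_nonneg L2_norm_nonneg)
        (simp add: C_def power_mult_distrib distrib_right)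
    finally show ?thesis .
  qed
  have W_bound: "C * \<delta>\<^sup>2 * Hk_norm 4 u * L2_norm v \<le> C * \<delta>\<^sup>2 * Hk_norm 4 u * W_norm q lam \<beta> \<delta> v" for \<delta> u v
    using C by (intro mult_left_mono L2_norm_le_W_norm assms(2) mult_nonneg_nonneg Hk_norm_nonneg) auto
  show ?thesis
  proof (intro exI[of _ C] conjI allI impI ballI C)
    fix \<delta> u v
    assume "0 < \<delta> \<and> \<delta> < delta_star Cq \<kappa>" "u \<in> Hk 4 \<inter> H10" "v \<in> W0_space q lam \<beta> \<delta>"
    then show L2: "\<bar>B_delta q lam \<beta> \<delta> u v - B_zero u v\<bar> \<le> C * \<delta>\<^sup>2 * Hk_norm 4 u * L2_norm v"
      by (intro L2_bound) auto
    show "\<bar>B_delta q lam \<beta> \<delta> u v - B_zero u v\<bar> \<le> C * \<delta>\<^sup>2 * Hk_norm 4 u * W_norm q lam \<beta> \<delta> v"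
      by (rule order_trans[OF L2 W_bound])
  qed
qed

end
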